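(* Suppose $\kappa$ is strongly compact and $M$ is an inner model. Then the following are equivalent: (1) $M$ is a $\kappa$-pseudoground. (2) $\kappa$ is strongly compact in $M$, every $\kappa$-complete ultrafilter $U$ over a set in $M$ satisfies $U\cap M\in M$, and every $W\in M$ which $M$ believes is a $\kappa$-complete ultrafilter over some set $X$ is contained in some $\kappa$-complete ultrafilter over $X$ (in $V$). (3) Every regular cardinal of $M$ above $\kappa$ has cofinality (in $V$) at least $\kappa$, and every $\kappa$-complete ultrafilter $U$ over a set in $M$ satisfies $U\cap M\in M$.
   Context: An inner model is a transitive class model of ZFC containing all ordinals. $M$ has the $\kappa$-cover property if every $\sigma\subseteq M$ with $|\sigma|<\kappa$ is contained in some $\tau\in M$ with $|\tau|<\kappa$; it has the $\kappa$-approximation property if every $A\subseteq M$ with $A\cap\sigma\in M$ for all $\sigma\in M$ of cardinality $<\kappa$ belongs to $M$. $M$ is a $\kappa$-pseudoground if it has both properties. $\kappa$ is strongly compact if for every $\lambda\ge\kappa$ there is a $\kappa$-complete fine ultrafilter over $P_\kappa(\lambda)$. *)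

theory Defs
  imports Main
begin

text \<open>
  The ambient universe V is an arbitrary model of first-order ZFC: the elements of a type
  with an arbitrary binary relation \<open>E\<close> as membership.  All set-theoretic notions are defined in a
  structure \<open>(D, E)\<close> with every quantifier over sets restricted to \<open>D\<close>, so that one
  definition yields both the notion in V (\<open>D = UNIV\<close>) and the notion in an
  inner model (\<open>D = M\<close>).
\<close>

text \<open>
  Formulas of the language of set theory with an additional unary predicate symbol
  (\<open>Cls\<close>), with de Bruijn variables: \<open>All\<close> binds variable 0.
\<close>

datatype fm = Mem nat nat | Eq nat nat | Cls nat | Neg fm | Conj fm fm | All fm

locale set_structure =
  fixes D :: "'a set" and E :: "'a \<Rightarrow> 'a \<Rightarrow> bool"
begin

definition ext :: "'a \<Rightarrow> 'a set" where
  "ext x = {y \<in> D. E y x}"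

primrec sat :: "'a set \<Rightarrow> fm \<Rightarrow> (nat \<Rightarrow> 'a) \<Rightarrow> bool" where
  "sat P (Mem i j) s \<longleftrightarrow> E (s i) (s j)"
| "sat P (Eq i j) s \<longleftrightarrow> s i = s j"
| "sat P (Cls i) s \<longleftrightarrow> s i \<in> P"
| "sat P (Neg \<phi>) s \<longleftrightarrow> \<not> sat P \<phi> s"
| "sat P (Conj \<phi> \<psi>) s \<longleftrightarrow> sat P \<phi> s \<and> sat P \<psi> s"
| "sat P (All \<phi>) s \<longleftrightarrow> (\<forall>x\<in>D. sat P \<phi> (case_nat x s))"

text \<open>
  \<open>zfc_with P\<close>: the structure satisfies ZFC, with Separation and Replacement for all
  formulas (with parameters) that may also mention \<open>P\<close>; that is, \<open>P\<close> is a class of the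
  structure.  This covers every \<open>P\<close> definable with parameters over a model of ZFC, and every
  class of a model of NBG.
\<close>

definition zfc_with :: "'a set \<Rightarrow> bool" where
  "zfc_with P \<longleftrightarrow>
     (\<comment> \<open>Extensionality\<close>
      \<forall>x\<in>D. \<forall>y\<in>D. ext x = ext y \<longrightarrow> x = y) \<and>
     (\<comment> \<open>Foundation\<close>
      \<forall>x\<in>D. ext x \<noteq> {} \<longrightarrow> (\<exists>y\<in>ext x. ext y \<inter> ext x = {})) \<and>
     (\<comment> \<open>Pairing\<close>
      \<forall>x\<in>D. \<forall>y\<in>D. \<exists>p\<in>D. ext p = {x, y}) \<and>
     (\<comment> \<open>Union\<close>
      \<forall>x\<in>D. \<exists>u\<in>D. ext u = (\<Union>y\<in>ext x. ext y)) \<and>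
     (\<comment> \<open>Power set\<close>
      \<forall>x\<in>D. \<exists>p\<in>D. ext p = {y \<in> D. ext y \<subseteq> ext x}) \<and>
     (\<comment> \<open>Infinity\<close>
      \<exists>w\<in>D. (\<exists>e\<in>ext w. ext e = {}) \<and> (\<forall>x\<in>ext w. \<exists>y\<in>ext w. ext y = insert x (ext x))) \<and>
     (\<comment> \<open>Separation\<close>
      \<forall>\<phi> s. (\<forall>i. s i \<in> D) \<longrightarrow>
        (\<forall>a\<in>D. \<exists>b\<in>D. ext b = {x \<in> ext a. sat P \<phi> (case_nat x s)})) \<and>
     (\<comment> \<open>Replacement\<close>
      \<forall>\<phi> s. (\<forall>i. s i \<in> D) \<longrightarrow>
        (\<forall>a\<in>D. (\<forall>x\<in>ext a. \<exists>!y. y \<in> D \<and> sat P \<phi> (case_nat x (case_nat y s))) \<longrightarrow>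
          (\<exists>b\<in>D. ext b = {y \<in> D. \<exists>x\<in>ext a. sat P \<phi> (case_nat x (case_nat y s))}))) \<and>
     (\<comment> \<open>Choice\<close>
      \<forall>a\<in>D. (\<forall>x\<in>ext a. ext x \<noteq> {}) \<and>
             (\<forall>x\<in>ext a. \<forall>y\<in>ext a. x \<noteq> y \<longrightarrow> ext x \<inter> ext y = {}) \<longrightarrow>
        (\<exists>c\<in>D. \<forall>x\<in>ext a. \<exists>!z. z \<in> ext x \<inter> ext c))"

text \<open>Interpreting \<open>Cls\<close> by the empty set leaves exactly the schemes of the pure language.\<close>

definition zfc :: bool where
  "zfc \<longleftrightarrow> zfc_with {}"

text \<open>In the presence of Foundation, a transitive set linearly ordered by membership is
  well-ordered by it.\<close>

definition ordinal :: "'a \<Rightarrow> bool" where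
  "ordinal \<alpha> \<longleftrightarrow>
     (\<forall>x\<in>ext \<alpha>. ext x \<subseteq> ext \<alpha>) \<and> (\<forall>x\<in>ext \<alpha>. \<forall>y\<in>ext \<alpha>. E x y \<or> x = y \<or> E y x)"

text \<open>Kuratowski pairs.\<close>

definition is_pair :: "'a \<Rightarrow> 'a \<Rightarrow> 'a \<Rightarrow> bool" where
  "is_pair p x y \<longleftrightarrow> (\<exists>a\<in>D. \<exists>b\<in>D. ext p = {a, b} \<and> ext a = {x} \<and> ext b = {x, y})"

definition maps_to :: "'a \<Rightarrow> 'a \<Rightarrow> 'a \<Rightarrow> bool" where
  "maps_to f x y \<longleftrightarrow> (\<exists>p\<in>ext f. is_pair p x y)"

definition is_function :: "'a \<Rightarrow> 'a \<Rightarrow> 'a \<Rightarrow> bool" where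
  "is_function f a b \<longleftrightarrow>
     (\<forall>p\<in>ext f. \<exists>x\<in>ext a. \<exists>y\<in>ext b. is_pair p x y) \<and>
     (\<forall>x\<in>ext a. \<exists>!y. y \<in> ext b \<and> maps_to f x y)"

definition is_bijection :: "'a \<Rightarrow> 'a \<Rightarrow> 'a \<Rightarrow> bool" where
  "is_bijection f a b \<longleftrightarrow>
     is_function f a b \<and> (\<forall>y\<in>ext b. \<exists>!x. x \<in> ext a \<and> maps_to f x y)"

definition equipotent :: "'a \<Rightarrow> 'a \<Rightarrow> bool" where
  "equipotent a b \<longleftrightarrow> (\<exists>f\<in>D. is_bijection f a b)"

definition cardinal :: "'a \<Rightarrow> bool" where
  "cardinal \<kappa> \<longleftrightarrow> ordinal \<kappa> \<and> (\<forall>\<alpha>\<in>ext \<kappa>. \<not> equipotent \<alpha> \<kappa>)"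

text \<open>\<open>card_less x \<kappa>\<close>: the cardinality of \<open>x\<close> is less than \<open>\<kappa>\<close>.\<close>

definition card_less :: "'a \<Rightarrow> 'a \<Rightarrow> bool" where
  "card_less x \<kappa> \<longleftrightarrow> (\<exists>\<mu>\<in>ext \<kappa>. cardinal \<mu> \<and> equipotent x \<mu>)"

definition cofinal_map :: "'a \<Rightarrow> 'a \<Rightarrow> 'a \<Rightarrow> bool" where
  "cofinal_map f \<beta> \<alpha> \<longleftrightarrow>
     is_function f \<beta> \<alpha> \<and>
     (\<forall>x\<in>ext \<alpha>. \<exists>u\<in>ext \<beta>. \<exists>v\<in>ext \<alpha>. maps_to f u v \<and> (x = v \<or> E x v))"

text \<open>\<open>is_cof \<beta> \<alpha>\<close>: the cofinality of the ordinal \<open>\<alpha>\<close> is \<open>\<beta>\<close>.\<close>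

definition is_cof :: "'a \<Rightarrow> 'a \<Rightarrow> bool" where
  "is_cof \<beta> \<alpha> \<longleftrightarrow>
     ordinal \<beta> \<and> (\<exists>f\<in>D. cofinal_map f \<beta> \<alpha>) \<and>
     (\<forall>\<gamma>\<in>ext \<beta>. \<not> (\<exists>f\<in>D. cofinal_map f \<gamma> \<alpha>))"

text \<open>The second and third conjuncts say that \<open>\<delta>\<close> is a nonzero limit ordinal, which for a
  cardinal means that it is infinite.\<close>

definition regular_cardinal :: "'a \<Rightarrow> bool" where
  "regular_cardinal \<delta> \<longleftrightarrow>
     cardinal \<delta> \<and> ext \<delta> \<noteq> {} \<and> (\<forall>x\<in>ext \<delta>. \<exists>y\<in>ext \<delta>. E x y) \<and> is_cof \<delta> \<delta>"

definition ultrafilter_over :: "'a \<Rightarrow> 'a \<Rightarrow> bool" where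
  "ultrafilter_over U X \<longleftrightarrow>
     (\<forall>A\<in>ext U. ext A \<subseteq> ext X) \<and>
     X \<in> ext U \<and>
     (\<forall>A\<in>ext U. ext A \<noteq> {}) \<and>
     (\<forall>A\<in>ext U. \<forall>B\<in>D. ext A \<subseteq> ext B \<and> ext B \<subseteq> ext X \<longrightarrow> B \<in> ext U) \<and>
     (\<forall>A\<in>ext U. \<forall>B\<in>ext U. \<exists>C\<in>ext U. ext C = ext A \<inter> ext B) \<and>
     (\<forall>A\<in>D. ext A \<subseteq> ext X \<longrightarrow> A \<in> ext U \<or> (\<exists>B\<in>ext U. ext B = ext X - ext A))"

definition complete_ultrafilter_over :: "'a \<Rightarrow> 'a \<Rightarrow> 'a \<Rightarrow> bool" where
  "complete_ultrafilter_over \<kappa> U X \<longleftrightarrow>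
     ultrafilter_over U X \<and>
     (\<forall>F\<in>D. ext F \<noteq> {} \<and> ext F \<subseteq> ext U \<and> card_less F \<kappa> \<longrightarrow>
        (\<exists>B\<in>ext U. ext B = (\<Inter>A\<in>ext F. ext A)))"

text \<open>\<open>is_Pk \<kappa> \<lambda> X\<close>: \<open>X\<close> is the set of subsets of \<open>\<lambda>\<close> of cardinality less than \<open>\<kappa>\<close>.\<close>

definition is_Pk :: "'a \<Rightarrow> 'a \<Rightarrow> 'a \<Rightarrow> bool" where
  "is_Pk \<kappa> l X \<longleftrightarrow> ext X = {\<sigma> \<in> D. ext \<sigma> \<subseteq> ext l \<and> card_less \<sigma> \<kappa>}"

definition fine :: "'a \<Rightarrow> 'a \<Rightarrow> 'a \<Rightarrow> bool" where
  "fine l U X \<longleftrightarrow> (\<forall>\<alpha>\<in>ext l. \<exists>A\<in>ext U. ext A = {\<sigma> \<in> ext X. \<alpha> \<in> ext \<sigma>})"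

text \<open>Uncountability of \<open>\<kappa>\<close> is not required, so the least infinite cardinal counts as
  strongly compact.  Finite cardinals do not: \<open>P\<^sub>\<kappa>(\<kappa>)\<close> carries no such
  ultrafilter for them.\<close>

definition strongly_compact :: "'a \<Rightarrow> bool" where
  "strongly_compact \<kappa> \<longleftrightarrow>
     cardinal \<kappa> \<and>
     (\<forall>l\<in>D. cardinal l \<and> (l = \<kappa> \<or> E \<kappa> l) \<longrightarrow>
        (\<exists>X\<in>D. \<exists>U\<in>D. is_Pk \<kappa> l X \<and> complete_ultrafilter_over \<kappa> U X \<and> fine l U X))"

end

text \<open>\<open>set_structure.foo UNIV E\<close> is the notion \<open>foo\<close> in V.  That \<open>M\<close> satisfies ZFC is a
  scheme in the pure language, relativised to \<open>M\<close>.\<close>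

definition inner_model :: "('a \<Rightarrow> 'a \<Rightarrow> bool) \<Rightarrow> 'a set \<Rightarrow> bool" where
  "inner_model E M \<longleftrightarrow>
     (\<forall>x\<in>M. \<forall>y. E y x \<longrightarrow> y \<in> M) \<and>
     (\<forall>\<alpha>. set_structure.ordinal UNIV E \<alpha> \<longrightarrow> \<alpha> \<in> M) \<and>
     set_structure.zfc M E"

text \<open>Cardinalities in the next two definitions are computed in V.  For sets in \<open>M\<close> and a cardinal
  \<open>\<kappa>\<close> of V it makes no difference whether \<open>card_less\<close> is computed in \<open>M\<close> or in V.\<close>

definition cover_property :: "('a \<Rightarrow> 'a \<Rightarrow> bool) \<Rightarrow> 'a \<Rightarrow> 'a set \<Rightarrow> bool" where
  "cover_property E \<kappa> M \<longleftrightarrow>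
     (\<forall>\<sigma>. set_structure.ext UNIV E \<sigma> \<subseteq> M \<and> set_structure.card_less UNIV E \<sigma> \<kappa> \<longrightarrow>
        (\<exists>\<tau>\<in>M. set_structure.ext UNIV E \<sigma> \<subseteq> set_structure.ext UNIV E \<tau> \<and>
                set_structure.card_less UNIV E \<tau> \<kappa>))"

definition approximation_property :: "('a \<Rightarrow> 'a \<Rightarrow> bool) \<Rightarrow> 'a \<Rightarrow> 'a set \<Rightarrow> bool" where
  "approximation_property E \<kappa> M \<longleftrightarrow>
     (\<forall>A. set_structure.ext UNIV E A \<subseteq> M \<and>
          (\<forall>\<sigma>\<in>M. set_structure.card_less UNIV E \<sigma> \<kappa> \<longrightarrow>
             (\<exists>c\<in>M. set_structure.ext UNIV E c =
                     set_structure.ext UNIV E A \<inter> set_structure.ext UNIV E \<sigma>)) \<longrightarrow>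
          A \<in> M)"

definition pseudoground :: "('a \<Rightarrow> 'a \<Rightarrow> bool) \<Rightarrow> 'a \<Rightarrow> 'a set \<Rightarrow> bool" where
  "pseudoground E \<kappa> M \<longleftrightarrow> cover_property E \<kappa> M \<and> approximation_property E \<kappa> M"

text \<open>Every \<open>\<kappa>\<close>-complete ultrafilter \<open>U\<close> over a set in \<open>M\<close> satisfies \<open>U \<inter> M \<in> M\<close>.\<close>

definition ultrafilters_amenable :: "('a \<Rightarrow> 'a \<Rightarrow> bool) \<Rightarrow> 'a \<Rightarrow> 'a set \<Rightarrow> bool" where
  "ultrafilters_amenable E \<kappa> M \<longleftrightarrow>
     (\<forall>X\<in>M. \<forall>U. set_structure.complete_ultrafilter_over UNIV E \<kappa> U X \<longrightarrow>
        (\<exists>c\<in>M. set_structure.ext UNIV E c = set_structure.ext UNIV E U \<inter> M))"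

text \<open>Every \<open>W \<in> M\<close> that \<open>M\<close> believes to be a \<open>\<kappa>\<close>-complete ultrafilter over a set \<open>X\<close> is
  contained in a \<open>\<kappa>\<close>-complete ultrafilter over \<open>X\<close> in V.\<close>

definition ultrafilters_extend :: "('a \<Rightarrow> 'a \<Rightarrow> bool) \<Rightarrow> 'a \<Rightarrow> 'a set \<Rightarrow> bool" where
  "ultrafilters_extend E \<kappa> M \<longleftrightarrow>
     (\<forall>W\<in>M. \<forall>X\<in>M. set_structure.complete_ultrafilter_over M E \<kappa> W X \<longrightarrow>
        (\<exists>U. set_structure.complete_ultrafilter_over UNIV E \<kappa> U X \<and>
             set_structure.ext UNIV E W \<subseteq> set_structure.ext UNIV E U))"

definition regulars_have_large_cofinality :: "('a \<Rightarrow> 'a \<Rightarrow> bool) \<Rightarrow> 'a \<Rightarrow> 'a set \<Rightarrow> bool" where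
  "regulars_have_large_cofinality E \<kappa> M \<longleftrightarrow>
     (\<forall>\<delta>\<in>M. set_structure.regular_cardinal M E \<delta> \<and> E \<kappa> \<delta> \<longrightarrow>
        (\<exists>\<beta>. set_structure.is_cof UNIV E \<beta> \<delta> \<and> (\<beta> = \<kappa> \<or> E \<kappa> \<beta>)))"

end

theory Submission
  imports Defs
begin

text \<open>
  Cover and approximation give amenability because a \<open>\<kappa>\<close>-complete ultrafilter restricted to a small
  family is read off from a single point; pushing fine ultrafilters forward along a covering map
  gives strong compactness in \<open>M\<close>, and along a choice of points of small intersections it gives the
  extension property.  Applying the extension property to a fine ultrafilter on \<open>P\<^sub>\<kappa>(\<delta>)\<close> of \<open>M\<close> shows
  that \<open>\<delta>\<close> has large cofinality.

  Conversely, cover and amenability yield approximation: let \<open>U\<close> be fine on \<open>P\<^sub>\<kappa>(a)\<close> of \<open>M\<close> and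
  push it forward along \<open>\<sigma> \<mapsto> A \<inter> \<sigma>\<close>; then \<open>A\<close> is the set of \<open>x\<close> that belong to almost every set of
  the resulting measure, whose trace on \<open>M\<close> is in \<open>M\<close>.

  Cover follows from large cofinalities by an argument in the style of Ketonen.  For \<open>\<delta>\<close> regular in
  \<open>M\<close>, a weakly normal \<open>\<kappa>\<close>-complete ultrafilter on \<open>\<delta>\<close> concentrates on ordinals \<open>\<xi>\<close> of
  cofinality below \<open>\<kappa>\<close>, also in the sense of \<open>M\<close>.  Inside \<open>M\<close>, using only the trace of the
  ultrafilter, \<open>\<delta>\<close> is cut into intervals each of which meets almost every one of fixed small cofinal
  sets \<open>C\<^sub>\<xi> \<subseteq> \<xi>\<close>.  The sets of indices of intervals met by \<open>C\<^sub>\<xi>\<close> are small, belong to \<open>M\<close>, and cover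
  every small subset of \<open>\<delta>\<close>.
\<close>


section \<open>Definability with parameters\<close>

text \<open>The universe is an arbitrary first-order model: sets and functions of HOL on its type
  need not be sets or classes of the model, and its membership need not be well-founded from
  outside. Each use of Separation, Replacement, recursion or induction therefore carries a proof of
  definability, and ordinary set theory is developed once for a structure \<open>(D, E)\<close> that
  stands for V or for \<open>M\<close>.

  No ultrapower is formed. Its well-foundedness becomes the inspection of a descending sequence of
  functions at one point, which needs completeness for sequences of length \<open>\<omega>\<close>
  and so a limit ordinal below \<open>\<kappa>\<close>. If there is none, small sets are finite in
  the sense of the model and belong to \<open>M\<close> outright.

  In the cover argument the ultrafilter lies outside \<open>M\<close> while the sequence of
  intervals has to lie in \<open>M\<close>. The recursion asks only whether certain sets of
  \<open>M\<close> are large, and amenability turns each such question into membership in an element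
  of \<open>M\<close>. Weak normality ends an interval: choosing from each small cofinal set a point
  past a given ordinal is a regressive function, so almost all chosen points have a common bound
  below \<open>\<delta>\<close>.\<close>

primrec ren :: "(nat \<Rightarrow> nat) \<Rightarrow> fm \<Rightarrow> fm" where
  "ren f (Mem i j) = Mem (f i) (f j)"
| "ren f (Eq i j) = Eq (f i) (f j)"
| "ren f (Cls i) = Cls (f i)"
| "ren f (Neg \<phi>) = Neg (ren f \<phi>)"
| "ren f (Conj \<phi> \<psi>) = Conj (ren f \<phi>) (ren f \<psi>)"
| "ren f (All \<phi>) = All (ren (case_nat 0 (\<lambda>i. Suc (f i))) \<phi>)"

text \<open>Interleaving keeps infinitely many slots for parameters beside the variables, so no
  bound on the variables of a formula has to be tracked and two parameter lists can be joined into
  one.\<close>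

definition merge :: "(nat \<Rightarrow> 'a) \<Rightarrow> (nat \<Rightarrow> 'a) \<Rightarrow> nat \<Rightarrow> 'a" where
  "merge s t i = (if even i then s (i div 2) else t (i div 2))"

lemma merge_simps [simp]: "merge s t (2 * i) = s i" "merge s t (Suc (2 * i)) = t i"
  by (auto simp: merge_def)

text \<open>Closure rules for definability, applied backwards by \<open>intro dfn\<close>: they
  translate an expression of HOL into a formula of the model along its syntax.\<close>

named_theorems dfn

text \<open>Instantiated twice: with \<open>D = UNIV\<close> and \<open>P = M\<close> for the
  universe, where \<open>M\<close> becomes a class usable in the axiom schemes, and with
  \<open>D = M\<close> and \<open>P = {}\<close> for the inner model.\<close>

locale zf_class = set_structure D E for D :: "'a set" and E +
  fixes P :: "'a set"
  assumes zfc_with: "zfc_with P"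
begin

lemma sat_ren: "sat P (ren f \<phi>) s \<longleftrightarrow> sat P \<phi> (\<lambda>i. s (f i))"
proof (induction \<phi> arbitrary: f s)
  case (All \<phi>)
  have "(\<lambda>i. case_nat x s (case_nat 0 (\<lambda>i. Suc (f i)) i)) = case_nat x (\<lambda>i. s (f i))" for x
    by (auto simp: fun_eq_iff split: nat.split)
  then show ?case using All by simp
qed auto

definition env :: "(nat \<Rightarrow> 'a) \<Rightarrow> bool" where
  "env s \<longleftrightarrow> (\<forall>i. s i \<in> D)"

lemma env_case_nat [simp]: "env (case_nat x s) \<longleftrightarrow> x \<in> D \<and> env s"
  by (auto simp: env_def split: nat.splits)

lemma envD [simp]: "env s \<Longrightarrow> s i \<in> D"
  by (simp add: env_def)

lemma env_comp [simp]: "env s \<Longrightarrow> env (\<lambda>i. s (f i))"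
  by (simp add: env_def)

lemma env_merge: "env s \<Longrightarrow> env t \<Longrightarrow> env (merge s t)"
  by (simp add: env_def merge_def)

text \<open>The parameters \<open>t\<close> occupy the odd variables.\<close>

definition definable :: "((nat \<Rightarrow> 'a) \<Rightarrow> bool) \<Rightarrow> bool" where
  "definable R \<longleftrightarrow> (\<exists>\<phi> t. env t \<and> (\<forall>s. env s \<longrightarrow> (R s \<longleftrightarrow> sat P \<phi> (merge s t))))"

text \<open>A term enters formulas through its graph, with the value in variable 0; this is the
  shape in which \<open>definable_subst\<close> eliminates it by an existential quantifier.\<close>

definition defterm :: "((nat \<Rightarrow> 'a) \<Rightarrow> 'a) \<Rightarrow> bool" where
  "defterm t \<longleftrightarrow> (\<forall>s. env s \<longrightarrow> t s \<in> D) \<and> definable (\<lambda>s. s 0 = t (\<lambda>i. s (Suc i)))"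

definition defset :: "((nat \<Rightarrow> 'a) \<Rightarrow> 'a set) \<Rightarrow> bool" where
  "defset A \<longleftrightarrow> (\<forall>s. env s \<longrightarrow> A s \<subseteq> D) \<and> definable (\<lambda>s. s 0 \<in> A (\<lambda>i. s (Suc i)))"

lemmas zfc_axioms = zfc_with[unfolded zfc_with_def]
lemmas zfc_extensionality = zfc_axioms[THEN conjunct1]
lemmas zfc_foundation = zfc_axioms[THEN conjunct2, THEN conjunct1]
lemmas zfc_pairing = zfc_axioms[THEN conjunct2, THEN conjunct2, THEN conjunct1]
lemmas zfc_union = zfc_axioms[THEN conjunct2, THEN conjunct2, THEN conjunct2, THEN conjunct1]
lemmas zfc_power = zfc_axioms[THEN conjunct2, THEN conjunct2, THEN conjunct2, THEN conjunct2, THEN conjunct1]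
lemmas zfc_infinity = zfc_axioms[THEN conjunct2, THEN conjunct2, THEN conjunct2, THEN conjunct2, THEN conjunct2, THEN conjunct1]
lemmas zfc_separation = zfc_axioms[THEN conjunct2, THEN conjunct2, THEN conjunct2, THEN conjunct2, THEN conjunct2, THEN conjunct2, THEN conjunct1]
lemmas zfc_replacement = zfc_axioms[THEN conjunct2, THEN conjunct2, THEN conjunct2, THEN conjunct2, THEN conjunct2, THEN conjunct2, THEN conjunct2, THEN conjunct1]
lemmas zfc_choice = zfc_axioms[THEN conjunct2, THEN conjunct2, THEN conjunct2, THEN conjunct2, THEN conjunct2, THEN conjunct2, THEN conjunct2, THEN conjunct2]

lemma extensionality: "x \<in> D \<Longrightarrow> y \<in> D \<Longrightarrow> ext x = ext y \<Longrightarrow> x = y"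
  using zfc_extensionality by blast

lemma zfc_nonempty: "\<exists>e\<in>D. ext e = {}"
  using zfc_infinity by (auto simp: ext_def)

lemma D_nonempty: "\<exists>x. x \<in> D"
  using zfc_nonempty by blast

lemma env_const: "p \<in> D \<Longrightarrow> env (\<lambda>_. p)"
  by (simp add: env_def)

lemma definable_cong: "definable R \<Longrightarrow> (\<And>s. env s \<Longrightarrow> R s \<longleftrightarrow> Q s) \<Longrightarrow> definable Q"
  unfolding definable_def by metis

lemma definable_rename:
  assumes "definable R"
  shows "definable (\<lambda>s. R (\<lambda>i. s (f i)))"
proof -
  obtain \<phi> t where t: "env t" and \<phi>: "\<And>s. env s \<Longrightarrow> R s \<longleftrightarrow> sat P \<phi> (merge s t)"
    using assms unfolding definable_def by blast
  define g where "g i = (if even i then 2 * f (i div 2) else i)" for i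
  have "merge (\<lambda>i. s (f i)) t = (\<lambda>i. merge s t (g i))" for s
    by (auto simp: fun_eq_iff merge_def g_def)
  then have "R (\<lambda>i. s (f i)) \<longleftrightarrow> sat P (ren g \<phi>) (merge s t)" if "env s" for s
    using \<phi>[of "\<lambda>i. s (f i)"] that by (simp add: sat_ren)
  then show ?thesis unfolding definable_def using t by blast
qed

lemma definable_neg [dfn]:
  assumes "definable R"
  shows "definable (\<lambda>s. \<not> R s)"
proof -
  obtain \<phi> t where t: "env t" and \<phi>: "\<And>s. env s \<Longrightarrow> R s \<longleftrightarrow> sat P \<phi> (merge s t)"
    using assms unfolding definable_def by blast
  then have "\<not> R s \<longleftrightarrow> sat P (Neg \<phi>) (merge s t)" if "env s" for s
    using that by simp
  then show ?thesis unfolding definable_def using t by blast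
qed

lemma definable_conj [dfn]:
  assumes "definable R" "definable Q"
  shows "definable (\<lambda>s. R s \<and> Q s)"
proof -
  obtain \<phi> t where t: "env t" and \<phi>: "\<And>s. env s \<Longrightarrow> R s \<longleftrightarrow> sat P \<phi> (merge s t)"
    using assms unfolding definable_def by blast
  obtain \<psi> u where u: "env u" and \<psi>: "\<And>s. env s \<Longrightarrow> Q s \<longleftrightarrow> sat P \<psi> (merge s u)"
    using assms unfolding definable_def by blast
  \<comment> \<open>\<open>g\<close> and \<open>h\<close> send the parameter slots of the two
    formulas to the two halves of the joint list \<open>merge t u\<close> and leave the proper
    variables in place.\<close>
  define g where "g i = (if even i then i else Suc (2 * (2 * (i div 2))))" for i :: nat
  define h where "h i = (if even i then i else Suc (2 * Suc (2 * (i div 2))))" for i :: nat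
  have 1: "merge s t i = merge s (merge t u) (g i)" for s i
  proof (cases "even i")
    case False
    then show ?thesis unfolding g_def by (simp only: if_False merge_simps) (simp add: merge_def)
  qed (simp add: g_def merge_def)
  have 2: "merge s u i = merge s (merge t u) (h i)" for s i
  proof (cases "even i")
    case False
    then show ?thesis unfolding h_def by (simp only: if_False merge_simps) (simp add: merge_def)
  qed (simp add: h_def merge_def)
  have eqs: "merge s t = (\<lambda>i. merge s (merge t u) (g i))"
    "merge s u = (\<lambda>i. merge s (merge t u) (h i))" for s
    by (rule ext, fact 1, rule ext, fact 2)
  have "R s \<and> Q s \<longleftrightarrow> sat P (Conj (ren g \<phi>) (ren h \<psi>)) (merge s (merge t u))" if "env s" for s
    using \<phi>[OF that] \<psi>[OF that] by (simp only: sat.simps sat_ren eqs[symmetric])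
  then show ?thesis unfolding definable_def using env_merge[OF t u] by blast
qed

lemma definable_All:
  assumes "definable (\<lambda>s. Q (s 0) (\<lambda>i. s (Suc i)))"
  shows "definable (\<lambda>s. \<forall>x\<in>D. Q x s)"
proof -
  obtain \<phi> t where t: "env t" and
    \<phi>: "\<And>s. env s \<Longrightarrow> Q (s 0) (\<lambda>i. s (Suc i)) \<longleftrightarrow> sat P \<phi> (merge s t)"
    using assms unfolding definable_def by blast
  \<comment> \<open>Binding a variable shifts all slots by one and would exchange the parities of
    variables and parameters; \<open>g\<close> restores them.\<close>
  define g where "g i = (if i = 0 then 0 else if even i then i - 1 else Suc i)" for i :: nat
  have g: "merge (case_nat x s) t = (\<lambda>i. case_nat x (merge s t) (g i))" for x s
  proof
    fix i :: nat
    consider "i = 0" | j where "i = 2 * Suc j" | j where "i = Suc (2 * j)"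
      by (metis mult_0_right not0_implies_Suc oddE Suc_eq_plus1 evenE)
    then show "merge (case_nat x s) t i = case_nat x (merge s t) (g i)"
    proof cases
      case 1 then show ?thesis using merge_simps(1)[of "case_nat x s" t 0] by (simp add: g_def)
    next
      case (2 j) then show ?thesis unfolding 2 merge_simps by (simp add: g_def)
    next
      case (3 j) then show ?thesis unfolding 3 merge_simps by (simp add: g_def)
    qed
  qed
  have "(\<forall>x\<in>D. Q x s) \<longleftrightarrow> sat P (All (ren g \<phi>)) (merge s t)" if "env s" for s
    using \<phi>[of "case_nat _ s"] that by (simp add: sat_ren g)
  then show ?thesis unfolding definable_def using t by blast
qed

lemma definable_var_mem: "definable (\<lambda>s. E (s i) (s j))"
  and definable_var_eq: "definable (\<lambda>s. s i = s j)"
  and definable_var_Cls: "definable (\<lambda>s. s i \<in> P)"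
proof -
  obtain p where "p \<in> D" using D_nonempty by blast
  then have *: "env (\<lambda>_. p)" by (simp add: env_def)
  have "E (s i) (s j) \<longleftrightarrow> sat P (Mem (2 * i) (2 * j)) (merge s (\<lambda>_. p))"
    "s i = s j \<longleftrightarrow> sat P (Eq (2 * i) (2 * j)) (merge s (\<lambda>_. p))"
    "s i \<in> P \<longleftrightarrow> sat P (Cls (2 * i)) (merge s (\<lambda>_. p))" for s
    by simp_all
  then show "definable (\<lambda>s. E (s i) (s j))" "definable (\<lambda>s. s i = s j)" "definable (\<lambda>s. s i \<in> P)"
    unfolding definable_def using * by blast+
qed

lemma definable_eq_const:
  assumes "p \<in> D" shows "definable (\<lambda>s. s i = p)"
proof -
  have "s i = p \<longleftrightarrow> sat P (Eq (2 * i) (Suc (2 * 0))) (merge s (\<lambda>_. p))" for s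
    unfolding sat.simps merge_simps by simp
  then show ?thesis unfolding definable_def using assms by (metis env_const)
qed

lemma definable_const [dfn]: "definable (\<lambda>s. b)"
proof (cases b)
  case True then show ?thesis using definable_var_eq[of 0 0] by simp
next
  case False then show ?thesis using definable_neg[OF definable_var_eq[of 0 0]] by simp
qed

lemma definable_disj [dfn]: "definable R \<Longrightarrow> definable Q \<Longrightarrow> definable (\<lambda>s. R s \<or> Q s)"
  using definable_neg[OF definable_conj[OF definable_neg definable_neg], of R Q] by simp

lemma definable_imp [dfn]:
  assumes "definable R" "definable Q" shows "definable (\<lambda>s. R s \<longrightarrow> Q s)"
  by (rule definable_cong[OF definable_disj[OF definable_neg[OF assms(1)] assms(2)]]) blast

lemma definable_iff [dfn]:
  assumes "definable R" "definable Q" shows "definable (\<lambda>s. R s = Q s)"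
  by (rule definable_cong[OF definable_conj[OF definable_imp[OF assms] definable_imp[OF assms(2,1)]]])
    blast

lemma definable_Ex:
  "definable (\<lambda>s. Q (s 0) (\<lambda>i. s (Suc i))) \<Longrightarrow> definable (\<lambda>s. \<exists>x\<in>D. Q x s)"
  using definable_neg[OF definable_All[OF definable_neg], of Q] by simp

lemma defterm_shift:
  assumes "defterm t" shows "defterm (\<lambda>s. t (\<lambda>i. s (f i)))"
proof -
  have "definable (\<lambda>s. s 0 = t (\<lambda>i. s (Suc i)))" using assms by (simp add: defterm_def)
  from definable_rename[OF this, of "case_nat 0 (\<lambda>i. Suc (f i))"] show ?thesis
    using assms by (simp add: defterm_def)
qed

lemma definable_eq_shift:
  assumes "defterm t" shows "definable (\<lambda>s. s i = t (\<lambda>i. s (f i)))"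
proof -
  have "definable (\<lambda>s. s 0 = t (\<lambda>i. s (Suc i)))" using assms by (simp add: defterm_def)
  from definable_rename[OF this, of "case_nat i f"] show ?thesis by simp
qed

lemma defterm_var [dfn]: "defterm (\<lambda>s. s i)"
  by (simp add: defterm_def definable_var_eq)

lemma defterm_const [dfn]: "p \<in> D \<Longrightarrow> defterm (\<lambda>s. p)"
  by (simp add: defterm_def definable_eq_const)

lemma defterm_in: "defterm t \<Longrightarrow> env s \<Longrightarrow> t s \<in> D"
  by (simp add: defterm_def)

lemma definable_subst:
  assumes "definable R" "defterm t"
  shows "definable (\<lambda>s. R (case_nat (t s) s))"
proof -
  have "definable (\<lambda>s. \<exists>x\<in>D. x = t s \<and> R (case_nat x s))"
  proof (rule definable_Ex, rule definable_conj)
    show "definable (\<lambda>s. s 0 = t (\<lambda>i. s (Suc i)))" by (rule definable_eq_shift[OF assms(2)])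
    have "case_nat (s 0) (\<lambda>i. s (Suc i)) = s" for s :: "nat \<Rightarrow> 'a"
      by (auto simp: fun_eq_iff split: nat.split)
    then show "definable (\<lambda>s. R (case_nat (s 0) (\<lambda>i. s (Suc i))))" using assms(1) by simp
  qed
  then show ?thesis by (rule definable_cong) (auto simp: defterm_in[OF assms(2)])
qed

section \<open>Definable relations and functions of fixed arity\<close>

definition drel1 :: "('a \<Rightarrow> bool) \<Rightarrow> bool" where
  "drel1 R \<longleftrightarrow> definable (\<lambda>s. R (s 0))"

definition drel2 :: "('a \<Rightarrow> 'a \<Rightarrow> bool) \<Rightarrow> bool" where
  "drel2 R \<longleftrightarrow> definable (\<lambda>s. R (s 0) (s (Suc 0)))"

definition drel3 :: "('a \<Rightarrow> 'a \<Rightarrow> 'a \<Rightarrow> bool) \<Rightarrow> bool" where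
  "drel3 R \<longleftrightarrow> definable (\<lambda>s. R (s 0) (s (Suc 0)) (s (Suc (Suc 0))))"

definition dfun1 :: "('a \<Rightarrow> 'a) \<Rightarrow> bool" where
  "dfun1 h \<longleftrightarrow> defterm (\<lambda>s. h (s 0))"

definition dfun2 :: "('a \<Rightarrow> 'a \<Rightarrow> 'a) \<Rightarrow> bool" where
  "dfun2 h \<longleftrightarrow> defterm (\<lambda>s. h (s 0) (s (Suc 0)))"

lemma drel1D: "drel1 R \<Longrightarrow> defterm t \<Longrightarrow> definable (\<lambda>s. R (t s))"
  unfolding drel1_def by (drule definable_subst) auto

lemma drel2D:
  assumes "drel2 R" "defterm t" "defterm u"
  shows "definable (\<lambda>s. R (t s) (u s))"
  using definable_subst[OF definable_subst[OF assms(1)[unfolded drel2_def]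
      defterm_shift[OF assms(2), of Suc]] assms(3)] by simp

lemma drel3D:
  assumes "drel3 R" "defterm t" "defterm u" "defterm v"
  shows "definable (\<lambda>s. R (t s) (u s) (v s))"
  using definable_subst[OF definable_subst[OF definable_subst[OF assms(1)[unfolded drel3_def]
      defterm_shift[OF assms(2), of "\<lambda>i. Suc (Suc i)"]]
      defterm_shift[OF assms(3), of Suc]] assms(4)] by simp

lemma dfun1D:
  assumes "dfun1 h" "defterm t" shows "defterm (\<lambda>s. h (t s))"
proof -
  have h: "drel2 (\<lambda>x y. x = h y)" and "\<And>x. x \<in> D \<Longrightarrow> h x \<in> D"
    using assms unfolding dfun1_def defterm_def drel2_def by (blast, metis env_const)
  then show ?thesis
    using drel2D[OF h defterm_var defterm_shift[OF assms(2)]] defterm_in[OF assms(2)]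
    unfolding defterm_def by blast
qed

lemma dfun2D:
  assumes "dfun2 h" "defterm t" "defterm u" shows "defterm (\<lambda>s. h (t s) (u s))"
proof -
  have h: "drel3 (\<lambda>x y z. x = h y z)"
    using assms unfolding dfun2_def defterm_def drel3_def by blast
  have "h x y \<in> D" if "x \<in> D" "y \<in> D" for x y
    using assms(1) that D_nonempty env_case_nat[of x "case_nat y (\<lambda>_. x)"]
    unfolding dfun2_def defterm_def by (metis env_case_nat env_const nat.case)
  then show ?thesis
    using drel3D[OF h defterm_var defterm_shift[OF assms(2)] defterm_shift[OF assms(3)]]
      defterm_in[OF assms(2)] defterm_in[OF assms(3)]
    unfolding defterm_def by blast
qed

lemma dfun1_in: "dfun1 h \<Longrightarrow> x \<in> D \<Longrightarrow> h x \<in> D"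
  unfolding dfun1_def defterm_def by (metis env_const)

lemma definable_mem [dfn]: "defterm t \<Longrightarrow> defterm u \<Longrightarrow> definable (\<lambda>s. E (t s) (u s))"
  by (rule drel2D) (simp_all add: drel2_def definable_var_mem)

lemma definable_eq [dfn]: "defterm t \<Longrightarrow> defterm u \<Longrightarrow> definable (\<lambda>s. t s = u s)"
  by (rule drel2D[of "(=)"]) (simp_all add: drel2_def definable_var_eq)

lemma definable_Cls: "defterm t \<Longrightarrow> definable (\<lambda>s. t s \<in> P)"
  by (rule drel1D[of "\<lambda>x. x \<in> P"]) (simp_all add: drel1_def definable_var_Cls)

lemma defset_sub: "defset A \<Longrightarrow> env s \<Longrightarrow> A s \<subseteq> D"
  by (simp add: defset_def)

lemma definable_in [dfn]:
  assumes "defterm t" "defset A" shows "definable (\<lambda>s. t s \<in> A s)"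
proof -
  have "definable (\<lambda>s. s 0 \<in> A (\<lambda>i. s (Suc i)))" using assms by (simp add: defset_def)
  from definable_subst[OF this assms(1)] show ?thesis by simp
qed

lemma defset_shift:
  assumes "defset A" shows "defset (\<lambda>s. A (\<lambda>i. s (f i)))"
proof -
  have "definable (\<lambda>s. s 0 \<in> A (\<lambda>i. s (Suc i)))" using assms by (simp add: defset_def)
  from definable_rename[OF this, of "case_nat 0 (\<lambda>i. Suc (f i))"] show ?thesis
    using assms by (simp add: defset_def)
qed

lemma definable_Ball [dfn]:
  assumes "defset A" "definable (\<lambda>s. Q (s 0) (\<lambda>i. s (Suc i)))"
  shows "definable (\<lambda>s. \<forall>x\<in>A s. Q x s)"
proof -
  have "definable (\<lambda>s. \<forall>x\<in>D. x \<in> A s \<longrightarrow> Q x s)"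
    by (intro definable_All definable_imp definable_in defterm_var defset_shift[OF assms(1)] assms(2))
  then show ?thesis by (rule definable_cong) (use defset_sub[OF assms(1)] in blast)
qed

lemma definable_Bex [dfn]:
  assumes "defset A" "definable (\<lambda>s. Q (s 0) (\<lambda>i. s (Suc i)))"
  shows "definable (\<lambda>s. \<exists>x\<in>A s. Q x s)"
  using definable_neg[OF definable_Ball[OF assms(1) definable_neg[OF assms(2)]]] by simp

lemma definable_Bex1 [dfn]:
  assumes "defset A" "definable (\<lambda>s. Q (s 0) (\<lambda>i. s (Suc i)))"
  shows "definable (\<lambda>s. \<exists>!x. x \<in> A s \<and> Q x s)"
proof -
  have "definable (\<lambda>s. \<exists>x\<in>A s. Q x s \<and> (\<forall>y\<in>A s. Q y s \<longrightarrow> y = x))"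
    using definable_rename[OF assms(2), of "case_nat 0 (\<lambda>i. Suc (Suc i))"]
    by (intro definable_Bex definable_Ball definable_conj definable_imp defset_shift[OF assms(1)] dfn assms) simp
  then show ?thesis by (rule definable_cong) blast
qed

lemma definable_subset [dfn]:
  assumes "defset A" "defset B" shows "definable (\<lambda>s. A s \<subseteq> B s)"
  unfolding subset_eq
  by (intro definable_Ball definable_in defset_shift[OF assms(2)] dfn assms)

lemma definable_set_eq [dfn]:
  assumes "defset A" "defset B" shows "definable (\<lambda>s. A s = B s)"
  by (rule definable_cong[OF definable_conj[OF definable_subset[OF assms] definable_subset[OF assms(2,1)]]])
    blast

lemma defset_D [dfn]: "defset (\<lambda>s. D)"
  unfolding defset_def by (auto intro!: definable_cong[OF definable_const[of True]])

lemma ext_D [simp]: "y \<in> ext x \<Longrightarrow> y \<in> D" by (auto simp: ext_def)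

lemma defset_ext [dfn]:
  assumes "defterm t" shows "defset (\<lambda>s. ext (t s))"
proof -
  have "definable (\<lambda>s. s 0 \<in> D \<and> E (s 0) (t (\<lambda>i. s (Suc i))))"
    by (intro dfn defterm_shift[OF assms])
  then show ?thesis unfolding defset_def ext_def by auto
qed

lemma defset_empty [dfn]: "defset (\<lambda>s. {})"
  unfolding defset_def by (simp add: definable_const)

context
  fixes A B :: "(nat \<Rightarrow> 'a) \<Rightarrow> 'a set"
  assumes A: "defset A" and B: "defset B"
begin

private lemma mem: "definable (\<lambda>s. s 0 \<in> A (\<lambda>i. s (Suc i)))" "definable (\<lambda>s. s 0 \<in> B (\<lambda>i. s (Suc i)))"
  using A B by (simp_all add: defset_def)

lemma defset_Un [dfn]: "defset (\<lambda>s. A s \<union> B s)"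
  using definable_disj[OF mem] A B by (auto simp: defset_def)

lemma defset_Int [dfn]: "defset (\<lambda>s. A s \<inter> B s)"
  using definable_conj[OF mem] A B by (auto simp: defset_def)

lemma defset_Diff [dfn]: "defset (\<lambda>s. A s - B s)"
  using definable_conj[OF mem(1) definable_neg[OF mem(2)]] A B by (auto simp: defset_def)

end

lemma defset_Collect [dfn]:
  assumes "defset A" "definable (\<lambda>s. Q (s 0) (\<lambda>i. s (Suc i)))"
  shows "defset (\<lambda>s. {x \<in> A s. Q x s})"
proof -
  have "definable (\<lambda>s. s 0 \<in> A (\<lambda>i. s (Suc i)))" using assms(1) by (simp add: defset_def)
  from definable_conj[OF this assms(2)] show ?thesis using assms(1) by (auto simp: defset_def)
qed

lemma defset_insert [dfn]:
  assumes "defterm t" "defset A" shows "defset (\<lambda>s. insert (t s) (A s))"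
proof -
  have "definable (\<lambda>s. s 0 = t (\<lambda>i. s (Suc i)) \<or> s 0 \<in> A (\<lambda>i. s (Suc i)))"
    by (intro dfn defterm_shift[OF assms(1)] defset_shift[OF assms(2)])
  then show ?thesis using assms unfolding defset_def by (auto simp: defterm_in)
qed

lemma defset_image [dfn]:
  assumes "defset A" "defterm (\<lambda>s. h (s 0) (\<lambda>i. s (Suc i)))"
  shows "defset (\<lambda>s. (\<lambda>x. h x s) ` A s)"
proof -
  have h: "h x s \<in> D" if "env s" "x \<in> A s" for x s
    using defterm_in[OF assms(2), of "case_nat x s"] that assms(1) defset_sub by fastforce
  have "definable (\<lambda>s. \<exists>x\<in>A (\<lambda>i. s (Suc i)). s 0 = h x (\<lambda>i. s (Suc i)))"
    using defterm_shift[OF assms(2), of "case_nat 0 (\<lambda>i. Suc (Suc i))"]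
    by (intro dfn defset_shift[OF assms(1)]) simp
  then show ?thesis unfolding defset_def image_def using h by auto
qed

lemma defset_UN [dfn]:
  assumes "defset A" "defset (\<lambda>s. B (s 0) (\<lambda>i. s (Suc i)))"
  shows "defset (\<lambda>s. \<Union>x\<in>A s. B x s)"
proof -
  have h: "B x s \<subseteq> D" if "env s" "x \<in> A s" for x s
    using defset_sub[OF assms(2), of "case_nat x s"] that assms(1) defset_sub by fastforce
  have "definable (\<lambda>s. \<exists>x\<in>A (\<lambda>i. s (Suc i)). s 0 \<in> B x (\<lambda>i. s (Suc i)))"
    using defset_shift[OF assms(2), of "case_nat 0 (\<lambda>i. Suc (Suc i))"]
    by (intro dfn defset_shift[OF assms(1)]) simp
  then show ?thesis unfolding defset_def using h by auto
qed

text \<open>The element with a given extension, and the empty set if there is none.\<close>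

definition mk :: "'a set \<Rightarrow> 'a" where
  "mk A = (if \<exists>z\<in>D. ext z = A then THE z. z \<in> D \<and> ext z = A else THE z. z \<in> D \<and> ext z = {})"

definition isset :: "'a set \<Rightarrow> bool" where
  "isset A \<longleftrightarrow> (\<exists>z\<in>D. ext z = A)"

text \<open>The default value keeps the operator total with values in \<open>D\<close>, so that
  \<open>defterm_dTHE\<close> has no existence premise.\<close>

definition dTHE :: "('a \<Rightarrow> bool) \<Rightarrow> 'a" where
  "dTHE Q = (if \<exists>!y. y \<in> D \<and> Q y then THE y. y \<in> D \<and> Q y else mk {})"

lemma the_ext: "z \<in> D \<Longrightarrow> (THE y. y \<in> D \<and> ext y = ext z) = z"
  by (auto intro: extensionality)

lemma isset_ext [simp]: "z \<in> D \<Longrightarrow> isset (ext z)"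
  by (auto simp: isset_def)

lemma isset_empty [simp]: "isset {}"
  unfolding isset_def using zfc_nonempty by blast

lemma mk_ext [simp]: "z \<in> D \<Longrightarrow> mk (ext z) = z"
  by (auto simp: mk_def the_ext)

lemma ext_mk [simp]: "isset A \<Longrightarrow> ext (mk A) = A"
  by (auto simp: isset_def)

lemma mk_not_isset: "\<not> isset A \<Longrightarrow> mk A = mk {}"
  using isset_empty by (auto simp: mk_def isset_def)

lemma mk_in [simp]: "mk A \<in> D"
  by (metis isset_def isset_empty mk_ext mk_not_isset)

text \<open>First-order description of the graph of \<open>mk\<close>, default case included;
  through it set formation may occur inside formulas.\<close>

lemma eq_mk_iff:
  assumes "z \<in> D"
  shows "z = mk A \<longleftrightarrow> ext z = A \<or> \<not> (\<exists>y\<in>D. ext y = A) \<and> ext z = {}"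
  using assms by (metis ext_mk isset_def isset_empty mk_ext mk_not_isset)

lemma defterm_mk [dfn]:
  assumes "defset A" shows "defterm (\<lambda>s. mk (A s))"
proof -
  have "definable (\<lambda>s. ext (s 0) = A (\<lambda>i. s (Suc i)) \<or>
    \<not> (\<exists>y\<in>D. ext y = A (\<lambda>i. s (Suc i))) \<and> ext (s 0) = {})"
    by (intro dfn defset_shift[OF assms])
  then show ?thesis unfolding defterm_def by (auto elim!: definable_cong simp: eq_mk_iff)
qed

lemma dTHE_in [simp]: "dTHE Q \<in> D"
proof (cases "\<exists>!y. y \<in> D \<and> Q y")
  case True
  then show ?thesis unfolding dTHE_def if_P[OF True] using theI'[OF True] by blast
next
  case False
  then show ?thesis unfolding dTHE_def if_not_P[OF False] by simp
qed

lemma dTHE_eq: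
  assumes "y \<in> D" "Q y" "\<And>z. z \<in> D \<Longrightarrow> Q z \<Longrightarrow> z = y"
  shows "dTHE Q = y"
proof -
  have *: "\<exists>!y. y \<in> D \<and> Q y" using assms by blast
  show ?thesis unfolding dTHE_def if_P[OF *] using assms by (intro the_equality) blast+
qed

lemma defterm_dTHE [dfn]:
  assumes "definable (\<lambda>s. Q (s 0) (\<lambda>i. s (Suc i)))"
  shows "defterm (\<lambda>s. dTHE (\<lambda>x. Q x s))"
proof -
  have "definable (\<lambda>s. Q (s 0) (\<lambda>i. s (Suc i)) \<and> (\<exists>!y. y \<in> D \<and> Q y (\<lambda>i. s (Suc i))) \<or>
     \<not> (\<exists>!y. y \<in> D \<and> Q y (\<lambda>i. s (Suc i))) \<and> s 0 = mk {})"
    using definable_rename[OF assms, of "case_nat 0 (\<lambda>i. Suc (Suc i))"]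
    by (intro dfn assms) simp_all
  moreover have "z = dTHE R \<longleftrightarrow> R z \<and> (\<exists>!y. y \<in> D \<and> R y) \<or> \<not> (\<exists>!y. y \<in> D \<and> R y) \<and> z = mk {}"
    if "z \<in> D" for R z
  proof (cases "\<exists>!y. y \<in> D \<and> R y")
    case True
    then obtain y where "y \<in> D" "R y" "\<And>x. x \<in> D \<Longrightarrow> R x \<Longrightarrow> x = y" by blast
    then show ?thesis using that True dTHE_eq[of y R] by metis
  next
    case False
    then show ?thesis by (simp only: dTHE_def if_False) blast
  qed
  ultimately show ?thesis unfolding defterm_def by (auto elim!: definable_cong)
qed

lemma defterm_If [dfn]:
  assumes "definable R" "defterm t" "defterm u"
  shows "defterm (\<lambda>s. if R s then t s else u s)"
proof -
  note R = definable_rename[OF assms(1), of Suc]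
  have eq: "definable (\<lambda>s. s 0 = t (\<lambda>i. s (Suc i)))" "definable (\<lambda>s. s 0 = u (\<lambda>i. s (Suc i)))"
    using assms by (simp_all add: defterm_def)
  have "definable (\<lambda>s. R (\<lambda>i. s (Suc i)) \<and> s 0 = t (\<lambda>i. s (Suc i)) \<or>
    \<not> R (\<lambda>i. s (Suc i)) \<and> s 0 = u (\<lambda>i. s (Suc i)))"
    by (rule definable_disj[OF definable_conj[OF R eq(1)] definable_conj[OF definable_neg[OF R] eq(2)]])
  then have "definable (\<lambda>s. s 0 = (if R (\<lambda>i. s (Suc i)) then t (\<lambda>i. s (Suc i)) else u (\<lambda>i. s (Suc i))))"
    by (rule definable_cong) simp
  then show ?thesis unfolding defterm_def using defterm_in[OF assms(2)] defterm_in[OF assms(3)] by simp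
qed

section \<open>Sets and functions\<close>

text \<open>Adapts a definable relation to the axiom schemes, where the two arguments sit in
  variables 0 and 1 and the parameters follow, instead of alternating with the variables.\<close>

lemma drel2_formula:
  assumes "drel2 Q"
  shows "\<exists>u \<phi>. (\<forall>i. u i \<in> D) \<and>
    (\<forall>x\<in>D. \<forall>y\<in>D. Q x y \<longleftrightarrow> sat P \<phi> (case_nat x (case_nat y u)))"
proof -
  obtain \<phi> t where t: "env t" and
    \<phi>: "\<And>s. env s \<Longrightarrow> Q (s 0) (s (Suc 0)) \<longleftrightarrow> sat P \<phi> (merge s t)"
    using assms unfolding drel2_def definable_def by blast
  obtain p where p: "p \<in> D" using D_nonempty by blast
  define u where "u = merge (\<lambda>_. p) t"
  define g where "g i = (if i = 0 then 0 else if i = 2 then 1 else Suc (Suc i))" for i :: nat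
  have g: "merge (case_nat x (case_nat y (\<lambda>_. p))) t i = case_nat x (case_nat y u) (g i)" for x y i
  proof (cases "even i")
    case True
    then obtain j where j: "i = 2 * j" by blast
    show ?thesis
    proof (cases "j = 0 \<or> j = 1")
      case False
      then obtain k where "j = Suc (Suc k)" by (metis One_nat_def not0_implies_Suc)
      then show ?thesis unfolding j merge_simps by (simp add: g_def u_def merge_def)
    qed (auto simp: j g_def merge_def)
  next
    case False
    then show ?thesis by (auto simp: g_def u_def merge_def)
  qed
  have "merge (case_nat x (case_nat y (\<lambda>_. p))) t = (\<lambda>i. case_nat x (case_nat y u) (g i))" for x y
    by (rule ext) (rule g)
  then have "Q x y \<longleftrightarrow> sat P (ren g \<phi>) (case_nat x (case_nat y u))" if "x \<in> D" "y \<in> D" for x y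
    using \<phi>[of "case_nat x (case_nat y (\<lambda>_. p))"] that p by (simp add: sat_ren env_const)
  moreover have "\<forall>i. u i \<in> D"
    using env_merge[OF env_const[OF p] t] unfolding u_def env_def .
  ultimately show ?thesis by blast
qed

lemma isset_in: "isset A \<Longrightarrow> x \<in> A \<Longrightarrow> x \<in> D"
  unfolding isset_def by auto

lemma isset_separation:
  assumes "isset A" "B \<subseteq> A" "defset (\<lambda>s. B)"
  shows "isset B"
proof -
  obtain a where a: "a \<in> D" "ext a = A" using assms by (auto simp: isset_def)
  have "drel2 (\<lambda>x y. x \<in> B)" unfolding drel2_def by (intro dfn assms)
  from drel2_formula[OF this] obtain u \<phi> where u: "\<forall>i. u i \<in> D"
    and \<phi>: "\<And>x y. x \<in> D \<Longrightarrow> y \<in> D \<Longrightarrow> x \<in> B \<longleftrightarrow> sat P \<phi> (case_nat x (case_nat y u))"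
    by blast
  \<comment> \<open>Separation has one argument variable only; \<open>a\<close> fills the place of
    the idle second argument.\<close>
  have "\<forall>i. case_nat a u i \<in> D" using a u by (auto split: nat.split)
  then obtain b where b: "b \<in> D" "ext b = {x \<in> ext a. sat P \<phi> (case_nat x (case_nat a u))}"
    using zfc_separation[rule_format, of "case_nat a u" a \<phi>] a by blast
  have "ext b = B"
    unfolding b(2) using \<phi>[OF _ a(1)] a(2) assms(2) isset_in[OF assms(1)] by blast
  then show ?thesis unfolding isset_def using b by blast
qed

lemma isset_Collect:
  assumes "isset A" "definable (\<lambda>s. Q (s 0))"
  shows "isset {x \<in> A. Q x}"
proof -
  obtain a where a: "a \<in> D" "ext a = A" using assms by (auto simp: isset_def)
  show ?thesis unfolding a(2)[symmetric]
    by (rule isset_separation[OF isset_ext[OF a(1)]]) (auto intro!: dfn assms a)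
qed

lemma isset_image:
  assumes "isset A" "dfun1 h"
  shows "isset (h ` A)"
proof -
  obtain a where a: "a \<in> D" "ext a = A" using assms by (auto simp: isset_def)
  have "drel2 (\<lambda>x y. y = h x)" unfolding drel2_def by (intro dfn dfun1D[OF assms(2)])
  from drel2_formula[OF this] obtain u \<phi> where u: "\<forall>i. u i \<in> D"
    and \<phi>: "\<And>x y. x \<in> D \<Longrightarrow> y \<in> D \<Longrightarrow> y = h x \<longleftrightarrow> sat P \<phi> (case_nat x (case_nat y u))"
    by blast
  have ex1: "\<forall>x\<in>ext a. \<exists>!y. y \<in> D \<and> sat P \<phi> (case_nat x (case_nat y u))"
  proof
    fix x assume "x \<in> ext a"
    then have x: "x \<in> D" by simp
    show "\<exists>!y. y \<in> D \<and> sat P \<phi> (case_nat x (case_nat y u))"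
      using \<phi>[OF x] dfun1_in[OF assms(2) x] by (intro ex1I[of _ "h x"]) blast+
  qed
  then obtain b where b: "b \<in> D" "ext b = {y \<in> D. \<exists>x\<in>ext a. sat P \<phi> (case_nat x (case_nat y u))}"
    using zfc_replacement[rule_format, of u a \<phi>] a u by blast
  have "y \<in> ext b \<longleftrightarrow> y \<in> h ` A" for y
  proof -
    have "y \<in> ext b \<longleftrightarrow> y \<in> D \<and> (\<exists>x\<in>ext a. sat P \<phi> (case_nat x (case_nat y u)))" unfolding b(2) by blast
    also have "\<dots> \<longleftrightarrow> y \<in> D \<and> (\<exists>x\<in>ext a. y = h x)" using \<phi>[of _ y] ext_D by blast
    also have "\<dots> \<longleftrightarrow> y \<in> h ` A" using dfun1_in[OF assms(2)] ext_D a(2) by blast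
    finally show ?thesis .
  qed
  then have "ext b = h ` A" by blast
  then show ?thesis unfolding isset_def using b by blast
qed

lemma isset_Union:
  assumes "isset A" shows "isset (\<Union>x\<in>A. ext x)"
proof -
  obtain a where a: "a \<in> D" "ext a = A" using assms by (auto simp: isset_def)
  then show ?thesis unfolding isset_def using zfc_union by blast
qed

lemma isset_UN:
  assumes "isset A" "dfun1 h" shows "isset (\<Union>x\<in>A. ext (h x))"
  using isset_Union[OF isset_image[OF assms]] by simp

lemma isset_pair: "x \<in> D \<Longrightarrow> y \<in> D \<Longrightarrow> isset {x, y}"
  unfolding isset_def using zfc_pairing by blast

lemma isset_Un:
  assumes "isset A" "isset B" shows "isset (A \<union> B)"
proof -
  have "isset (\<Union>x\<in>{mk A, mk B}. ext x)" by (intro isset_Union isset_pair) simp_all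
  then show ?thesis using assms by simp
qed

lemma isset_insert [simp]: "x \<in> D \<Longrightarrow> isset A \<Longrightarrow> isset (insert x A)"
  using isset_Un[OF isset_pair[of x x], of A] by simp

lemma isset_Pow:
  assumes "isset A" shows "isset {y \<in> D. ext y \<subseteq> A}"
proof -
  obtain a where a: "a \<in> D" "ext a = A" using assms by (auto simp: isset_def)
  then show ?thesis unfolding isset_def using zfc_power by blast
qed

lemma dclass_isset: "isset A \<Longrightarrow> defset (\<lambda>s. A)"
  unfolding isset_def by (auto intro!: dfn)

lemma isset_Int: "isset A \<Longrightarrow> isset B \<Longrightarrow> isset (A \<inter> B)"
  by (rule isset_separation[of A, OF _ _ defset_Int[OF dclass_isset dclass_isset]]) auto

lemma isset_Diff: "isset A \<Longrightarrow> isset B \<Longrightarrow> isset (A - B)"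
  by (rule isset_separation[of A, OF _ _ defset_Diff[OF dclass_isset dclass_isset]]) auto

lemma mk_inject: "isset A \<Longrightarrow> isset B \<Longrightarrow> mk A = mk B \<longleftrightarrow> A = B"
  by (metis ext_mk)

lemma ext_E: "x \<in> ext y \<longleftrightarrow> x \<in> D \<and> E x y"
  unfolding ext_def by blast

lemma foundation:
  assumes "isset A" "A \<noteq> {}" shows "\<exists>y\<in>A. \<forall>z\<in>A. \<not> E z y"
proof -
  obtain a where a: "a \<in> D" "ext a = A" using assms by (auto simp: isset_def)
  have "\<exists>y\<in>ext a. ext y \<inter> ext a = {}" using zfc_foundation[rule_format, OF a(1)] a(2) assms(2) by simp
  then obtain y where y: "y \<in> A" "ext y \<inter> A = {}" unfolding a(2) by blast
  have "\<not> E z y" if "z \<in> A" for z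
    using that isset_in[OF assms(1) that] y(2) ext_E by blast
  with y(1) show ?thesis by blast
qed

lemma mem_irrefl:
  assumes "x \<in> D" shows "\<not> E x x"
  using foundation[OF isset_insert[OF assms isset_empty]] by simp

lemma mem_asym:
  assumes "x \<in> D" "y \<in> D" "E x y" shows "\<not> E y x"
  using foundation[OF isset_pair[OF assms(1,2)]] assms by simp

lemma mem_no_3cycle:
  assumes "x \<in> D" "y \<in> D" "z \<in> D" "E x y" "E y z" shows "\<not> E z x"
  using foundation[OF isset_insert[OF assms(1) isset_pair[OF assms(2,3)]]] assms by simp

section \<open>Ordered pairs, and functions as sets\<close>

definition opair :: "'a \<Rightarrow> 'a \<Rightarrow> 'a" where
  "opair x y = mk {mk {x}, mk {x, y}}"

lemma dfun2_opair: "dfun2 opair"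
  unfolding dfun2_def opair_def by (intro dfn)

lemmas defterm_opair [dfn] = dfun2D[OF dfun2_opair]

lemma opair_in [simp]: "opair x y \<in> D"
  by (simp add: opair_def)

lemma opair_inject [simp]:
  assumes "x \<in> D" "y \<in> D" "x' \<in> D" "y' \<in> D"
  shows "opair x y = opair x' y' \<longleftrightarrow> x = x' \<and> y = y'"
  unfolding opair_def using assms by (auto simp: mk_inject doubleton_eq_iff)

lemma is_pair_iff:
  assumes "p \<in> D" "x \<in> D" "y \<in> D" shows "is_pair p x y \<longleftrightarrow> p = opair x y"
proof
  assume "is_pair p x y"
  then obtain a b where ab: "a \<in> D" "b \<in> D" "ext p = {a, b}" "ext a = {x}" "ext b = {x, y}"
    unfolding is_pair_def by blast
  then have "a = mk {x}" "b = mk {x, y}" "p = mk {a, b}" using assms by (metis mk_ext)+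
  then show "p = opair x y" by (simp add: opair_def)
next
  assume "p = opair x y"
  then show "is_pair p x y"
    unfolding is_pair_def opair_def using assms
    by (intro bexI[of _ "mk {x}"] bexI[of _ "mk {x, y}"]) simp_all
qed

lemma maps_to_iff:
  assumes "x \<in> D" "y \<in> D" shows "maps_to f x y \<longleftrightarrow> E (opair x y) f"
  unfolding maps_to_def using assms is_pair_iff[OF _ assms] by (auto simp: ext_E)

definition app :: "'a \<Rightarrow> 'a \<Rightarrow> 'a" where
  "app f x = dTHE (\<lambda>y. E (opair x y) f)"

lemma dfun2_app: "dfun2 app"
  unfolding dfun2_def app_def by (intro dfn)

lemmas defterm_app [dfn] = dfun2D[OF dfun2_app]

lemma dfun1_app: "f \<in> D \<Longrightarrow> dfun1 (app f)"
  unfolding dfun1_def by (intro dfn)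

lemma app_in [simp]: "app f x \<in> D"
  by (simp add: app_def)

text \<open>\<open>lam\<close> and \<open>app\<close> pass between definable class functions and
  function sets of the model: arguments run with the former, and sets appear only where the model
  quantifies over functions.\<close>

definition lam :: "'a \<Rightarrow> ('a \<Rightarrow> 'a) \<Rightarrow> 'a" where
  "lam a h = mk ((\<lambda>x. opair x (h x)) ` ext a)"

lemma lam_in [simp]: "lam a h \<in> D"
  by (simp add: lam_def)

lemma ext_lam:
  assumes "dfun1 h" "a \<in> D" shows "ext (lam a h) = (\<lambda>x. opair x (h x)) ` ext a"
proof -
  have "dfun1 (\<lambda>x. opair x (h x))" unfolding dfun1_def by (intro dfn dfun1D[OF assms(1)])
  then show ?thesis unfolding lam_def using assms by (simp add: isset_image)
qed

lemma mem_lam: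
  assumes "dfun1 h" "a \<in> D" "x \<in> D" "y \<in> D"
  shows "E (opair x y) (lam a h) \<longleftrightarrow> x \<in> ext a \<and> y = h x"
proof -
  have "E (opair x y) (lam a h) \<longleftrightarrow> opair x y \<in> ext (lam a h)" by (simp add: ext_E)
  also have "\<dots> \<longleftrightarrow> (\<exists>z\<in>ext a. opair x y = opair z (h z))"
    unfolding ext_lam[OF assms(1,2)] by blast
  also have "\<dots> \<longleftrightarrow> x \<in> ext a \<and> y = h x" using assms dfun1_in[OF assms(1)] by auto
  finally show ?thesis .
qed

lemma app_lam [simp]:
  assumes "dfun1 h" "a \<in> D" "x \<in> ext a" shows "app (lam a h) x = h x"
  unfolding app_def using assms dfun1_in[OF assms(1)] by (intro dTHE_eq) (auto simp: mem_lam)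

text \<open>In \<open>is_function\<close> the value is unique only among the elements of
  \<open>b\<close>. It is unique outright because every element of \<open>f\<close> is a pair with
  second component in \<open>b\<close>, so the description in \<open>app\<close> picks it.\<close>

lemma is_function_maps_to:
  assumes "is_function f a b" "x \<in> D" "y \<in> D"
  shows "maps_to f x y \<longleftrightarrow> x \<in> ext a \<and> y = app f x"
proof
  assume m: "maps_to f x y"
  then obtain p where p: "p \<in> ext f" "is_pair p x y" unfolding maps_to_def by blast
  then obtain x' y' where "x' \<in> ext a" "y' \<in> ext b" "is_pair p x' y'"
    using assms unfolding is_function_def by blast
  then have x: "x \<in> ext a" "y \<in> ext b"
    using p assms by (auto simp: is_pair_iff)
  moreover have "app f x = y"
    unfolding app_def
  proof (rule dTHE_eq)
    show "E (opair x y) f" using m assms by (simp add: maps_to_iff)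
    fix z assume z: "z \<in> D" "E (opair x z) f"
    then have m': "maps_to f x z" using assms by (simp add: maps_to_iff)
    then obtain p where p: "p \<in> ext f" "is_pair p x z" unfolding maps_to_def by blast
    then obtain x' y' where "x' \<in> ext a" "y' \<in> ext b" "is_pair p x' y'"
      using assms unfolding is_function_def by blast
    then have "z \<in> ext b" using p assms z by (auto simp: is_pair_iff)
    then show "z = y" using m m' x assms(1) unfolding is_function_def by blast
  qed (use assms in simp)
  ultimately show "x \<in> ext a \<and> y = app f x" by blast
next
  assume x: "x \<in> ext a \<and> y = app f x"
  then have "\<exists>!z. z \<in> ext b \<and> maps_to f x z" using assms(1) unfolding is_function_def by blast
  then obtain z where z: "z \<in> ext b" "maps_to f x z"
    and unique: "\<And>z'. z' \<in> ext b \<and> maps_to f x z' \<Longrightarrow> z' = z"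
    unfolding Ex1_def by blast
  have "app f x = z"
    unfolding app_def
  proof (rule dTHE_eq)
    show "E (opair x z) f" using z assms by (simp add: maps_to_iff)
    fix w assume w: "w \<in> D" "E (opair x w) f"
    then have m': "maps_to f x w" using assms by (simp add: maps_to_iff)
    then obtain p where p: "p \<in> ext f" "is_pair p x w" unfolding maps_to_def by blast
    then obtain x' y' where "x' \<in> ext a" "y' \<in> ext b" "is_pair p x' y'"
      using assms unfolding is_function_def by blast
    then have "w \<in> ext b" using p assms w by (auto simp: is_pair_iff)
    then show "w = z" using m' unique by blast
  qed (use z in simp)
  then show "maps_to f x y" using x z by blast
qed

lemma is_function_app:
  assumes "is_function f a b" "x \<in> ext a" shows "app f x \<in> ext b"
proof -
  obtain z where z: "z \<in> ext b" "maps_to f x z" using assms unfolding is_function_def by blast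
  then show ?thesis using is_function_maps_to[OF assms(1), of x z] assms by auto
qed

lemma is_function_lam:
  assumes "dfun1 h" "a \<in> D" "h ` ext a \<subseteq> ext b" shows "is_function (lam a h) a b"
  unfolding is_function_def
proof (intro conjI ballI)
  fix p assume "p \<in> ext (lam a h)"
  then obtain x where "x \<in> ext a" "p = opair x (h x)" unfolding ext_lam[OF assms(1,2)] by blast
  then show "\<exists>x\<in>ext a. \<exists>y\<in>ext b. is_pair p x y" using assms
    by (intro bexI[of _ x] bexI[of _ "h x"]) (auto simp: is_pair_iff dfun1_in)
next
  fix x assume "x \<in> ext a"
  then show "\<exists>!y. y \<in> ext b \<and> maps_to (lam a h) x y"
    using assms by (intro ex1I[of _ "h x"]) (auto simp: maps_to_iff mem_lam dfun1_in)
qed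

lemma maps_to_lam:
  assumes "dfun1 h" "a \<in> D" "x \<in> D" "y \<in> D"
  shows "maps_to (lam a h) x y \<longleftrightarrow> x \<in> ext a \<and> y = h x"
  using assms by (simp add: maps_to_iff mem_lam)

lemma is_bijection_app:
  assumes "is_bijection f a b" shows "bij_betw (app f) (ext a) (ext b)"
proof -
  have f: "is_function f a b" and u: "\<forall>y\<in>ext b. \<exists>!x. x \<in> ext a \<and> maps_to f x y"
    using assms unfolding is_bijection_def by blast+
  have m: "\<And>x y. x \<in> D \<Longrightarrow> y \<in> D \<Longrightarrow> maps_to f x y \<longleftrightarrow> x \<in> ext a \<and> y = app f x"
    using is_function_maps_to[OF f] .
  show ?thesis unfolding bij_betw_def
  proof
    show "inj_on (app f) (ext a)"
    proof (rule inj_onI)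
      fix x y assume xy: "x \<in> ext a" "y \<in> ext a" "app f x = app f y"
      then have "maps_to f x (app f x)" "maps_to f y (app f x)" by (simp_all add: m)
      then show "x = y" using u is_function_app[OF f xy(1)] xy by blast
    qed
    show "app f ` ext a = ext b" using u m is_function_app[OF f] ext_D by blast
  qed
qed

lemma is_bijection_lam:
  assumes "dfun1 h" "a \<in> D" "bij_betw h (ext a) (ext b)" shows "is_bijection (lam a h) a b"
  unfolding is_bijection_def
proof (intro conjI ballI)
  show "is_function (lam a h) a b" using assms by (auto intro!: is_function_lam simp: bij_betw_def)
  fix y assume y: "y \<in> ext b"
  then have "y \<in> h ` ext a" by (simp add: bij_betw_imp_surj_on[OF assms(3)])
  then obtain x where x: "x \<in> ext a" "h x = y" by blast
  have yD: "y \<in> D" and m: "\<And>z. z \<in> ext a \<Longrightarrow> maps_to (lam a h) z y \<longleftrightarrow> y = h z"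
    using y assms(1,2) by (simp_all add: maps_to_lam)
  show "\<exists>!x. x \<in> ext a \<and> maps_to (lam a h) x y"
  proof (rule ex1I[of _ x])
    fix z assume "z \<in> ext a \<and> maps_to (lam a h) z y"
    then show "z = x" using m x inj_onD[OF bij_betw_imp_inj_on[OF assms(3)], of z x] by metis
  qed (use x m in metis)
qed

lemma equipotent_iff:
  assumes "a \<in> D"
  shows "equipotent a b \<longleftrightarrow> (\<exists>h. dfun1 h \<and> bij_betw h (ext a) (ext b))"
  unfolding equipotent_def
  using is_bijection_app is_bijection_lam[OF _ assms] dfun1_app lam_in by metis

lemma drel1_ordinal: "drel1 ordinal"
  unfolding drel1_def ordinal_def by (intro dfn)

lemma drel3_is_pair: "drel3 is_pair"
  unfolding drel3_def is_pair_def by (intro dfn)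

lemmas [dfn] = drel1D[OF drel1_ordinal] drel3D[OF drel3_is_pair]

lemma drel3_maps_to: "drel3 maps_to"
  unfolding drel3_def maps_to_def by (intro dfn)

lemmas [dfn] = drel3D[OF drel3_maps_to]

lemma drel3_is_function: "drel3 is_function"
  unfolding drel3_def is_function_def by (intro dfn)

lemmas [dfn] = drel3D[OF drel3_is_function]

lemma drel3_is_bijection: "drel3 is_bijection"
  unfolding drel3_def is_bijection_def by (intro dfn)

lemmas [dfn] = drel3D[OF drel3_is_bijection]

lemma drel3_cofinal_map: "drel3 cofinal_map"
  unfolding drel3_def cofinal_map_def by (intro dfn)

lemmas [dfn] = drel3D[OF drel3_cofinal_map]

lemma drel2_equipotent: "drel2 equipotent"
  unfolding drel2_def equipotent_def by (intro dfn)

lemmas [dfn] = drel2D[OF drel2_equipotent]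

lemma drel1_cardinal: "drel1 cardinal"
  unfolding drel1_def cardinal_def by (intro dfn)

lemmas [dfn] = drel1D[OF drel1_cardinal]

lemma drel2_card_less: "drel2 card_less"
  unfolding drel2_def card_less_def by (intro dfn)

lemmas [dfn] = drel2D[OF drel2_card_less]

section \<open>Ordinals, recursion and choice\<close>

definition Ord :: "'a \<Rightarrow> bool" where
  "Ord \<alpha> \<longleftrightarrow> \<alpha> \<in> D \<and> ordinal \<alpha>"

lemma drel1_Ord: "drel1 Ord"
  unfolding drel1_def Ord_def by (intro dfn)

lemmas [dfn] = drel1D[OF drel1_Ord]

lemma Ord_in [simp]: "Ord \<alpha> \<Longrightarrow> \<alpha> \<in> D"
  by (simp add: Ord_def)

lemma OrdI:
  assumes "\<alpha> \<in> D" "\<And>x. x \<in> ext \<alpha> \<Longrightarrow> ext x \<subseteq> ext \<alpha>"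
    "\<And>x y. x \<in> ext \<alpha> \<Longrightarrow> y \<in> ext \<alpha> \<Longrightarrow> E x y \<or> x = y \<or> E y x"
  shows "Ord \<alpha>"
  unfolding Ord_def ordinal_def using assms by blast

lemma Ord_trans: "Ord \<alpha> \<Longrightarrow> \<beta> \<in> ext \<alpha> \<Longrightarrow> \<gamma> \<in> ext \<beta> \<Longrightarrow> \<gamma> \<in> ext \<alpha>"
  unfolding Ord_def ordinal_def by blast

lemma Ord_elem_linear: "Ord \<alpha> \<Longrightarrow> \<beta> \<in> ext \<alpha> \<Longrightarrow> \<gamma> \<in> ext \<alpha> \<Longrightarrow> E \<beta> \<gamma> \<or> \<beta> = \<gamma> \<or> E \<gamma> \<beta>"
  unfolding Ord_def ordinal_def by blast

text \<open>A member of a member of \<open>\<beta>\<close> is comparable with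
  \<open>\<beta>\<close>, and the two unwanted cases are membership cycles of length two and three,
  which Foundation excludes.\<close>

lemma Ord_elem:
  assumes "Ord \<alpha>" "\<beta> \<in> ext \<alpha>" shows "Ord \<beta>"
proof (rule OrdI)
  show bD: "\<beta> \<in> D" using assms(2) by (rule ext_D)
  show "ext x \<subseteq> ext \<beta>" if x: "x \<in> ext \<beta>" for x
  proof
    fix z assume z: "z \<in> ext x"
    have xa: "x \<in> ext \<alpha>" using Ord_trans[OF assms x] .
    have za: "z \<in> ext \<alpha>" using Ord_trans[OF assms(1) xa z] .
    have D: "x \<in> D" "z \<in> D" and E: "E x \<beta>" "E z x" using x z ext_E by blast+
    consider "E z \<beta>" | "z = \<beta>" | "E \<beta> z" using Ord_elem_linear[OF assms(1) za assms(2)] by blast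
    then show "z \<in> ext \<beta>"
    proof cases
      case 1 then show ?thesis using D ext_E by blast
    next
      case 2 then show ?thesis using mem_asym[OF D(1) bD] E by blast
    next
      case 3 then show ?thesis using mem_no_3cycle[OF bD D(2,1)] E by blast
    qed
  qed
  show "E x y \<or> x = y \<or> E y x" if "x \<in> ext \<beta>" "y \<in> ext \<beta>" for x y
    using Ord_elem_linear[OF assms(1) Ord_trans[OF assms that(1)] Ord_trans[OF assms that(2)]] .
qed

text \<open>The \<open>E\<close>-minimal element of \<open>ext \<beta> - ext \<alpha>\<close> has
  the same members as \<open>\<alpha>\<close>.\<close>

lemma Ord_subset:
  assumes "Ord \<alpha>" "Ord \<beta>" "ext \<alpha> \<subseteq> ext \<beta>" shows "\<alpha> = \<beta> \<or> \<alpha> \<in> ext \<beta>"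
proof (cases "ext \<beta> - ext \<alpha> = {}")
  case True
  then have "ext \<alpha> = ext \<beta>" using assms by blast
  then show ?thesis using extensionality assms by simp
next
  case False
  have "isset (ext \<beta> - ext \<alpha>)" using assms by (intro isset_Diff isset_ext) simp_all
  from foundation[OF this False] obtain y where y: "y \<in> ext \<beta>" "y \<notin> ext \<alpha>"
    and min: "\<And>z. z \<in> ext \<beta> - ext \<alpha> \<Longrightarrow> \<not> E z y" by blast
  have "ext y = ext \<alpha>"
  proof (intro equalityI subsetI)
    fix x assume x: "x \<in> ext y"
    then have "x \<in> ext \<beta>" "E x y" using Ord_trans[OF assms(2) y(1)] ext_E by blast+
    then show "x \<in> ext \<alpha>" using min[of x] by blast
  next
    fix x assume x: "x \<in> ext \<alpha>"
    then have xb: "x \<in> ext \<beta>" using assms by blast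
    consider "E x y" | "x = y" | "E y x" using Ord_elem_linear[OF assms(2) xb y(1)] by blast
    then show "x \<in> ext y"
    proof cases
      case 1 then show ?thesis using ext_E ext_D[OF x] by blast
    next
      case 2 then show ?thesis using x y by blast
    next
      case 3
      then have "y \<in> ext x" using ext_E ext_D[OF y(1)] by blast
      then show ?thesis using Ord_trans[OF assms(1) x] y by blast
    qed
  qed
  then have "y = \<alpha>" using extensionality[OF ext_D[OF y(1)] Ord_in[OF assms(1)]] by blast
  then show ?thesis using y by blast
qed

text \<open>The intersection of the two is an ordinal that equals or belongs to each of them; it
  cannot belong to both, for then it would belong to itself.\<close>

lemma Ord_linear:
  assumes "Ord \<alpha>" "Ord \<beta>" shows "\<alpha> \<in> ext \<beta> \<or> \<alpha> = \<beta> \<or> \<beta> \<in> ext \<alpha>"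
proof -
  define \<gamma> where "\<gamma> = mk (ext \<alpha> \<inter> ext \<beta>)"
  have g: "ext \<gamma> = ext \<alpha> \<inter> ext \<beta>"
    unfolding \<gamma>_def using assms by (intro ext_mk isset_Int isset_ext) simp_all
  have og: "Ord \<gamma>"
  proof (rule OrdI)
    show "\<gamma> \<in> D" by (simp add: \<gamma>_def)
    show "ext x \<subseteq> ext \<gamma>" if "x \<in> ext \<gamma>" for x
      using Ord_trans[OF assms(1)] Ord_trans[OF assms(2)] that unfolding g by blast
    show "E x y \<or> x = y \<or> E y x" if "x \<in> ext \<gamma>" "y \<in> ext \<gamma>" for x y
      using Ord_elem_linear[OF assms(1)] that unfolding g by blast
  qed
  have "\<gamma> = \<alpha> \<or> \<gamma> \<in> ext \<alpha>" using Ord_subset[OF og assms(1)] g by blast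
  moreover have "\<gamma> = \<beta> \<or> \<gamma> \<in> ext \<beta>" using Ord_subset[OF og assms(2)] g by blast
  moreover have "\<gamma> \<notin> ext \<gamma>" using mem_irrefl[OF Ord_in[OF og]] ext_E by blast
  ultimately show ?thesis using g by blast
qed

lemma Ord_irrefl: "Ord \<alpha> \<Longrightarrow> \<alpha> \<notin> ext \<alpha>"
  using mem_irrefl ext_E Ord_in by blast

lemma Ord_asym: "Ord \<alpha> \<Longrightarrow> \<beta> \<in> ext \<alpha> \<Longrightarrow> \<alpha> \<notin> ext \<beta>"
  using Ord_trans Ord_irrefl by blast

lemma Ord_subset_iff:
  assumes "Ord \<alpha>" "Ord \<beta>" shows "ext \<alpha> \<subseteq> ext \<beta> \<longleftrightarrow> \<alpha> = \<beta> \<or> \<alpha> \<in> ext \<beta>"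
  using Ord_subset[OF assms] Ord_trans[OF assms(2)] by blast

lemma Ord_not_mem: "Ord \<alpha> \<Longrightarrow> Ord \<beta> \<Longrightarrow> \<alpha> \<notin> ext \<beta> \<longleftrightarrow> ext \<beta> \<subseteq> ext \<alpha>"
  using Ord_linear Ord_subset_iff Ord_irrefl Ord_asym by metis

lemma Ord_least:
  assumes "definable (\<lambda>s. Q (s 0))" "Ord \<alpha>" "Q \<alpha>"
  shows "\<exists>\<beta>. Ord \<beta> \<and> Q \<beta> \<and> (\<forall>\<gamma>\<in>ext \<beta>. \<not> Q \<gamma>)"
proof -
  define A where "A = {\<gamma> \<in> insert \<alpha> (ext \<alpha>). Q \<gamma>}"
  have "isset A" unfolding A_def using assms by (intro isset_Collect isset_insert isset_ext) simp_all
  moreover have "A \<noteq> {}" unfolding A_def using assms by blast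
  ultimately obtain \<beta> where b: "\<beta> \<in> A" "\<And>z. z \<in> A \<Longrightarrow> \<not> E z \<beta>" using foundation by blast
  have "\<beta> = \<alpha> \<or> \<beta> \<in> ext \<alpha>" and q: "Q \<beta>" using b(1) unfolding A_def by blast+
  then have "Ord \<beta>" and *: "\<And>\<gamma>. \<gamma> \<in> ext \<beta> \<Longrightarrow> \<gamma> \<in> ext \<alpha>"
    using assms(2) Ord_elem Ord_trans by blast+
  moreover have "\<not> Q \<gamma>" if g: "\<gamma> \<in> ext \<beta>" for \<gamma>
  proof
    assume "Q \<gamma>"
    then have "\<gamma> \<in> A" unfolding A_def using *[OF g] by blast
    moreover have "E \<gamma> \<beta>" using g ext_E by blast
    ultimately show False using b(2) by blast
  qed
  ultimately show ?thesis using q by blast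
qed

text \<open>Taking the least witness makes the selection definable, so that the result is a class
  function to which Replacement applies.\<close>

lemma least_ordinal_function:
  assumes Q: "drel2 Q"
  shows "\<exists>r. dfun1 r \<and> (\<forall>u\<in>D. \<forall>\<alpha>. Ord \<alpha> \<longrightarrow> Q u \<alpha> \<longrightarrow> Ord (r u) \<and> Q u (r u))"
proof -
  define r where "r u = dTHE (\<lambda>\<alpha>. Ord \<alpha> \<and> Q u \<alpha> \<and> (\<forall>\<beta>\<in>ext \<alpha>. \<not> Q u \<beta>))" for u
  have "dfun1 r" unfolding dfun1_def r_def by (intro dfn drel2D[OF Q])
  moreover have "Ord (r u) \<and> Q u (r u)" if u: "u \<in> D" and a: "Ord \<alpha>" "Q u \<alpha>" for u \<alpha>
  proof -
    have "definable (\<lambda>s. Q u (s 0))" by (intro dfn drel2D[OF Q] u)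
    from Ord_least[of "Q u", OF this a] obtain \<beta> where
      b: "Ord \<beta>" "Q u \<beta>" "\<And>\<gamma>. \<gamma> \<in> ext \<beta> \<Longrightarrow> \<not> Q u \<gamma>" by blast
    have "r u = \<beta>" unfolding r_def
    proof (rule dTHE_eq)
      fix z assume z: "Ord z \<and> Q u z \<and> (\<forall>\<beta>\<in>ext z. \<not> Q u \<beta>)"
      then have "z \<notin> ext \<beta>" "\<beta> \<notin> ext z" using b by blast+
      then show "z = \<beta>" using Ord_linear z b(1) by blast
    qed (use b in simp_all)
    then show ?thesis using b by simp
  qed
  ultimately show ?thesis by blast
qed

lemma Ord_induct:
  assumes "definable (\<lambda>s. Q (s 0))" "\<And>\<alpha>. Ord \<alpha> \<Longrightarrow> (\<And>\<beta>. \<beta> \<in> ext \<alpha> \<Longrightarrow> Q \<beta>) \<Longrightarrow> Q \<alpha>" "Ord \<alpha>"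
  shows "Q \<alpha>"
proof (rule ccontr)
  assume n: "\<not> Q \<alpha>"
  obtain \<beta> where "Ord \<beta>" "\<not> Q \<beta>" "\<And>\<gamma>. \<gamma> \<in> ext \<beta> \<Longrightarrow> \<not> \<not> Q \<gamma>"
    using Ord_least[of "\<lambda>x. \<not> Q x", OF definable_neg[OF assms(1)] assms(3) n] by blast
  then show False using assms(2) by blast
qed

definition osucc :: "'a \<Rightarrow> 'a" where
  "osucc \<alpha> = mk (insert \<alpha> (ext \<alpha>))"

lemma ext_osucc [simp]: "\<alpha> \<in> D \<Longrightarrow> ext (osucc \<alpha>) = insert \<alpha> (ext \<alpha>)"
  unfolding osucc_def by (intro ext_mk isset_insert isset_ext)

lemma osucc_in [simp]: "osucc \<alpha> \<in> D"
  by (simp add: osucc_def)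

lemma Ord_osucc:
  assumes "Ord \<alpha>" shows "Ord (osucc \<alpha>)"
proof (rule OrdI)
  have e: "ext (osucc \<alpha>) = insert \<alpha> (ext \<alpha>)" using assms by simp
  show "ext x \<subseteq> ext (osucc \<alpha>)" if "x \<in> ext (osucc \<alpha>)" for x
    using that Ord_trans[OF assms] unfolding e by blast
  show "E x y \<or> x = y \<or> E y x" if "x \<in> ext (osucc \<alpha>)" "y \<in> ext (osucc \<alpha>)" for x y
    using that Ord_elem_linear[OF assms] ext_E unfolding e by blast
qed simp

lemma Ord_Sup:
  assumes "isset A" "\<And>x. x \<in> A \<Longrightarrow> Ord x"
  shows "Ord (mk (\<Union>x\<in>A. ext x))"
proof (rule OrdI)
  have e: "ext (mk (\<Union>x\<in>A. ext x)) = (\<Union>x\<in>A. ext x)" using isset_Union[OF assms(1)] by simp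
  show "ext x \<subseteq> ext (mk (\<Union>x\<in>A. ext x))" if "x \<in> ext (mk (\<Union>x\<in>A. ext x))" for x
    using that Ord_trans assms(2) unfolding e by blast
  fix x y assume "x \<in> ext (mk (\<Union>x\<in>A. ext x))" "y \<in> ext (mk (\<Union>x\<in>A. ext x))"
  then have "Ord x" "Ord y" using Ord_elem assms(2) unfolding e by blast+
  then show "E x y \<or> x = y \<or> E y x" using Ord_linear ext_E by blast
qed simp

text \<open>Burali-Forti: the successor of the supremum of the ordinals in \<open>A\<close> escapes
  \<open>A\<close>.\<close>

lemma Ord_unbounded:
  assumes "isset A" shows "\<exists>\<alpha>. Ord \<alpha> \<and> \<alpha> \<notin> A"
proof (rule ccontr)
  assume "\<not> ?thesis"
  then have all: "\<And>\<alpha>. Ord \<alpha> \<Longrightarrow> \<alpha> \<in> A" by blast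
  define B where "B = {\<alpha> \<in> A. Ord \<alpha>}"
  have B: "isset B" unfolding B_def by (intro isset_Collect assms dfn)
  define S where "S = mk (\<Union>x\<in>B. ext x)"
  have S: "Ord S" unfolding S_def by (rule Ord_Sup[OF B]) (simp add: B_def)
  have e: "ext S = (\<Union>x\<in>B. ext x)" unfolding S_def using isset_Union[OF B] by simp
  have "osucc S \<in> B" unfolding B_def using all Ord_osucc[OF S] by blast
  moreover have "S \<in> ext (osucc S)" using S by simp
  ultimately have "S \<in> ext S" using e by blast
  then show False using Ord_irrefl[OF S] by blast
qed

lemma Ord_empty: "Ord (mk {})"
  by (rule OrdI) simp_all

section \<open>Recursion on ordinals, choice and well-ordering\<close>

definition attempt :: "('a \<Rightarrow> 'a) \<Rightarrow> 'a \<Rightarrow> 'a \<Rightarrow> bool" where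
  "attempt F f \<alpha> \<longleftrightarrow> (\<forall>\<beta>\<in>insert \<alpha> (ext \<alpha>). app f \<beta> = F (mk (app f ` ext \<beta>)))"

lemma attempt_mono:
  assumes "Ord \<alpha>" "\<beta> \<in> ext \<alpha>" "attempt F f \<alpha>" shows "attempt F f \<beta>"
proof -
  have "insert \<beta> (ext \<beta>) \<subseteq> insert \<alpha> (ext \<alpha>)" using Ord_trans assms by blast
  then show ?thesis using assms(3) unfolding attempt_def by blast
qed

text \<open>Approximations are arbitrary sets \<open>f\<close> whose values up to and including
  \<open>\<alpha>\<close> obey the equation. Any two agree there, so their common value defines
  \<open>G\<close>. The step function receives the set of earlier values rather than the sequence,
  which is enough for every use below.\<close>

theorem recursion:
  assumes F: "dfun1 F"
  shows "\<exists>G. dfun1 G \<and> (\<forall>\<alpha>. Ord \<alpha> \<longrightarrow> G \<alpha> = F (mk (G ` ext \<alpha>)))"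
proof -
  have "drel2 (attempt F)"
    unfolding drel2_def attempt_def by (intro dfn dfun1D[OF F])
  note att [dfn] = drel2D[OF this]
  have unique: "attempt F f \<beta> \<and> attempt F f' \<beta> \<longrightarrow> app f \<beta> = app f' \<beta>"
    if "f \<in> D" "f' \<in> D" and b: "Ord \<beta>" for f f' \<beta>
  proof (rule Ord_induct[OF _ _ b])
    show "definable (\<lambda>s. attempt F f (s 0) \<and> attempt F f' (s 0) \<longrightarrow> app f (s 0) = app f' (s 0))"
      using that by (intro dfn)
    fix \<alpha> assume a: "Ord \<alpha>"
      and IH: "\<And>\<beta>. \<beta> \<in> ext \<alpha> \<Longrightarrow> attempt F f \<beta> \<and> attempt F f' \<beta> \<longrightarrow> app f \<beta> = app f' \<beta>"
    show "attempt F f \<alpha> \<and> attempt F f' \<alpha> \<longrightarrow> app f \<alpha> = app f' \<alpha>"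
    proof
      assume at: "attempt F f \<alpha> \<and> attempt F f' \<alpha>"
      have "app f ` ext \<alpha> = app f' ` ext \<alpha>"
        using IH attempt_mono[OF a] at by (intro image_cong) blast+
      then show "app f \<alpha> = app f' \<alpha>" using at unfolding attempt_def by simp
    qed
  qed
  define G where "G \<beta> = dTHE (\<lambda>y. \<exists>f\<in>D. attempt F f \<beta> \<and> y = app f \<beta>)" for \<beta>
  have G: "dfun1 G" unfolding dfun1_def G_def by (intro dfn)
  have G_eq: "G \<beta> = app f \<beta>" if "Ord \<beta>" "f \<in> D" "attempt F f \<beta>" for f \<beta>
    unfolding G_def
  proof (rule dTHE_eq)
    show "\<exists>f'\<in>D. attempt F f' \<beta> \<and> app f \<beta> = app f' \<beta>" using that by blast
    fix z assume "\<exists>f\<in>D. attempt F f \<beta> \<and> z = app f \<beta>"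
    then obtain f' where f': "f' \<in> D" "attempt F f' \<beta>" "z = app f' \<beta>" by blast
    then show "z = app f \<beta>" using unique[OF f'(1) that(2,1)] that(3) by simp
  qed simp
  have ex: "\<exists>f\<in>D. attempt F f \<alpha>" if "Ord \<alpha>" for \<alpha>
  proof (rule Ord_induct[OF _ _ that])
    show "definable (\<lambda>s. \<exists>f\<in>D. attempt F f (s 0))" by (intro dfn)
    fix \<alpha> assume a: "Ord \<alpha>" and IH: "\<And>\<beta>. \<beta> \<in> ext \<alpha> \<Longrightarrow> \<exists>f\<in>D. attempt F f \<beta>"
    have aD: "\<alpha> \<in> D" using a by simp
    \<comment> \<open>Below \<open>\<alpha>\<close> the value is already \<open>G\<close>; only the
      top value has to be supplied, and \<open>lam\<close> makes a set of this class function by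
      Replacement.\<close>
    define h where "h x = (if x = \<alpha> then F (mk (G ` ext \<alpha>)) else G x)" for x
    have h: "dfun1 h" unfolding dfun1_def h_def using aD by (intro dfn dfun1D[OF F] dfun1D[OF G])
    define f where "f = lam (osucc \<alpha>) h"
    have f: "app f x = h x" if "x \<in> insert \<alpha> (ext \<alpha>)" for x
      unfolding f_def using that aD by (intro app_lam[OF h]) simp_all
    have fG: "app f x = G x" if "x \<in> ext \<alpha>" for x
    proof -
      have "x \<noteq> \<alpha>" using Ord_irrefl[OF a] that by blast
      then show ?thesis using f[of x] that unfolding h_def by simp
    qed
    have "app f \<beta> = F (mk (app f ` ext \<beta>))" if b: "\<beta> \<in> insert \<alpha> (ext \<alpha>)" for \<beta>
    proof -
      have "ext \<beta> \<subseteq> ext \<alpha>" using Ord_trans[OF a] b by blast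
      then have img: "app f ` ext \<beta> = G ` ext \<beta>" using fG by (intro image_cong) blast+
      show ?thesis
      proof (cases "\<beta> = \<alpha>")
        case True
        have "h \<alpha> = F (mk (G ` ext \<alpha>))" by (simp add: h_def)
        then show ?thesis using f[of \<alpha>] img True by simp
      next
        case False
        then have ba: "\<beta> \<in> ext \<alpha>" using b by blast
        then obtain f' where f': "f' \<in> D" "attempt F f' \<beta>" using IH by blast
        have ob: "Ord \<beta>" using Ord_elem[OF a ba] .
        have "G ` ext \<beta> = app f' ` ext \<beta>"
          using G_eq[OF Ord_elem[OF ob] f'(1) attempt_mono[OF ob _ f'(2)]] by (intro image_cong) blast+
        moreover have "app f' \<beta> = F (mk (app f' ` ext \<beta>))" using f'(2) unfolding attempt_def by blast
        ultimately show ?thesis using fG[OF ba] G_eq[OF ob f'] img by simp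
      qed
    qed
    then have "attempt F f \<alpha>" unfolding attempt_def by blast
    then show "\<exists>f\<in>D. attempt F f \<alpha>" unfolding f_def by (rule bexI) simp
  qed
  have "G \<alpha> = F (mk (G ` ext \<alpha>))" if a: "Ord \<alpha>" for \<alpha>
  proof -
    obtain f where f: "f \<in> D" "attempt F f \<alpha>" using ex[OF a] by blast
    have "G ` ext \<alpha> = app f ` ext \<alpha>"
      using G_eq[OF Ord_elem[OF a] f(1) attempt_mono[OF a _ f(2)]] by (intro image_cong) blast+
    moreover have "app f \<alpha> = F (mk (app f ` ext \<alpha>))" using f(2) unfolding attempt_def by blast
    ultimately show ?thesis using G_eq[OF a f] by simp
  qed
  then show ?thesis using G by blast
qed

lemma dfun_inverse:
  assumes "dfun1 h" "a \<in> D" "inj_on h (ext a)"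
  shows "\<exists>k. dfun1 k \<and> (\<forall>x\<in>ext a. k (h x) = x)"
proof -
  define k where "k y = dTHE (\<lambda>x. x \<in> ext a \<and> h x = y)" for y
  have "dfun1 k" unfolding dfun1_def k_def using assms(2) by (intro dfn dfun1D[OF assms(1)])
  moreover have "k (h x) = x" if "x \<in> ext a" for x
    unfolding k_def using that inj_onD[OF assms(3)] by (intro dTHE_eq) (blast intro: ext_D)+
  ultimately show ?thesis by blast
qed

text \<open>The axiom speaks of disjoint families. Tagging every \<open>y\<close> in
  \<open>A\<close> with \<open>A\<close> itself makes the family of nonempty subsets of
  \<open>b\<close> disjoint.\<close>

lemma choice:
  assumes b: "b \<in> D"
  shows "\<exists>c. dfun1 c \<and> (\<forall>A\<in>D. ext A \<subseteq> ext b \<longrightarrow> ext A \<noteq> {} \<longrightarrow> c A \<in> ext A)"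
proof -
  define pr where "pr A = mk ((\<lambda>y. opair A y) ` ext A)" for A
  have pr: "dfun1 pr" unfolding dfun1_def pr_def by (intro dfn)
  have ext_pr: "ext (pr A) = (\<lambda>y. opair A y) ` ext A" if "A \<in> D" for A
  proof -
    have "dfun1 (\<lambda>y. opair A y)" unfolding dfun1_def using that by (intro dfn)
    then show ?thesis unfolding pr_def by (intro ext_mk isset_image isset_ext that)
  qed
  define N where "N = {A \<in> {A \<in> D. ext A \<subseteq> ext b}. ext A \<noteq> {}}"
  have N: "isset N" unfolding N_def using b by (intro isset_Collect isset_Pow isset_ext dfn)
  have ND: "A \<in> D" "ext A \<noteq> {}" if "A \<in> N" for A using that by (simp_all add: N_def)
  have prN: "ext (mk (pr ` N)) = pr ` N" by (intro ext_mk isset_image N pr)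
  have "\<exists>c\<in>D. \<forall>x\<in>ext (mk (pr ` N)). \<exists>!z. z \<in> ext x \<inter> ext c"
  proof (rule zfc_choice[rule_format], simp, intro conjI ballI impI)
    fix x assume "x \<in> ext (mk (pr ` N))"
    then obtain A where "A \<in> N" "x = pr A" unfolding prN by blast
    then show "ext x \<noteq> {}" using ext_pr ND by simp
  next
    fix x y assume "x \<in> ext (mk (pr ` N))" "y \<in> ext (mk (pr ` N))" and ne: "x \<noteq> y"
    then obtain A B where A: "A \<in> N" "x = pr A" and B: "B \<in> N" "y = pr B" unfolding prN by blast
    then have "A \<noteq> B" using ne by blast
    then have ne': "opair A u \<noteq> opair B v" if "u \<in> ext A" "v \<in> ext B" for u v
      using ND(1)[OF A(1)] ND(1)[OF B(1)] ext_D[OF that(1)] ext_D[OF that(2)] by simp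
    then show "ext x \<inter> ext y = {}"
      unfolding A(2) B(2) ext_pr[OF ND(1)[OF A(1)]] ext_pr[OF ND(1)[OF B(1)]] using ne' by blast
  qed
  then obtain c0 where c0: "c0 \<in> D" "\<And>A. A \<in> N \<Longrightarrow> \<exists>!z. z \<in> ext (pr A) \<inter> ext c0"
    unfolding prN by blast
  define c where "c A = dTHE (\<lambda>y. y \<in> ext A \<and> E (opair A y) c0)" for A
  have "dfun1 c" unfolding dfun1_def c_def using c0(1) by (intro dfn)
  moreover have "c A \<in> ext A" if A: "A \<in> N" for A
  proof -
    have AD: "A \<in> D" using ND A by blast
    have "\<exists>z. z \<in> ext (pr A) \<inter> ext c0"
      and u: "\<And>z z'. z \<in> ext (pr A) \<inter> ext c0 \<Longrightarrow> z' \<in> ext (pr A) \<inter> ext c0 \<Longrightarrow> z = z'"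
      using c0(2)[OF A] by blast+
    then obtain z where z: "z \<in> ext (pr A)" "z \<in> ext c0" by blast
    then obtain y where y: "y \<in> ext A" "z = opair A y" unfolding ext_pr[OF AD] by blast
    have "c A = y" unfolding c_def
    proof (rule dTHE_eq)
      show "y \<in> ext A \<and> E (opair A y) c0" using y z ext_E by blast
      fix w assume w: "w \<in> D" "w \<in> ext A \<and> E (opair A w) c0"
      then have "opair A w \<in> ext (pr A) \<inter> ext c0" unfolding ext_pr[OF AD] using ext_E by simp
      then have "opair A w = opair A y" using u z y by blast
      then show "w = y" using AD w y ext_D[OF y(1)] by simp
    qed (rule ext_D[OF y(1)])
    then show ?thesis using y by simp
  qed
  ultimately show ?thesis unfolding N_def by blast
qed

theorem well_ordering:
  assumes b: "b \<in> D"
  shows "\<exists>\<alpha> h. Ord \<alpha> \<and> dfun1 h \<and> bij_betw h (ext \<alpha>) (ext b)"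
proof -
  obtain c where c: "dfun1 c" "\<And>A. A \<in> D \<Longrightarrow> ext A \<subseteq> ext b \<Longrightarrow> ext A \<noteq> {} \<Longrightarrow> c A \<in> ext A"
    using choice[OF b] by blast
  \<comment> \<open>The value \<open>b\<close> is a filler for the time after \<open>b\<close> is
    exhausted; the enumeration is cut at the least ordinal whose values cover
    \<open>b\<close>.\<close>
  define F where "F z = (if ext b \<subseteq> ext z then b else c (mk (ext b - ext z)))" for z
  have F: "dfun1 F" unfolding dfun1_def F_def using b by (intro dfn dfun1D[OF c(1)])
  obtain G where G: "dfun1 G" and rec: "\<And>\<alpha>. Ord \<alpha> \<Longrightarrow> G \<alpha> = F (mk (G ` ext \<alpha>))"
    using recursion[OF F] by blast
  have img: "ext (mk (G ` ext \<alpha>)) = G ` ext \<alpha>" if "Ord \<alpha>" for \<alpha>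
    using that by (intro ext_mk isset_image G isset_ext) simp
  have new: "G \<alpha> \<in> ext b - G ` ext \<alpha>" if a: "Ord \<alpha>" and n: "\<not> ext b \<subseteq> G ` ext \<alpha>" for \<alpha>
  proof -
    have e: "ext (mk (ext b - G ` ext \<alpha>)) = ext b - G ` ext \<alpha>"
      using a b by (intro ext_mk isset_Diff isset_image isset_ext G) simp_all
    have "G \<alpha> = c (mk (ext b - G ` ext \<alpha>))" using rec[OF a] n unfolding F_def img[OF a] by simp
    also have "\<dots> \<in> ext (mk (ext b - G ` ext \<alpha>))"
    proof (rule c(2))
      show "ext (mk (ext b - G ` ext \<alpha>)) \<subseteq> ext b" unfolding e by blast
      show "ext (mk (ext b - G ` ext \<alpha>)) \<noteq> {}" unfolding e using n by blast
    qed simp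
    finally show ?thesis unfolding e .
  qed
  have inj: "inj_on G A" if A: "\<And>\<alpha>. \<alpha> \<in> A \<Longrightarrow> Ord \<alpha> \<and> \<not> ext b \<subseteq> G ` ext \<alpha>" for A
  proof (rule inj_onI)
    fix x y assume xy: "x \<in> A" "y \<in> A" "G x = G y"
    have "x \<notin> ext y" using new[of y] A[OF xy(2)] xy(3) imageI[of x "ext y" G] by auto
    moreover have "y \<notin> ext x" using new[of x] A[OF xy(1)] xy(3) imageI[of y "ext x" G] by auto
    ultimately show "x = y" using Ord_linear A xy by blast
  qed
  \<comment> \<open>Otherwise \<open>G\<close> would inject all ordinals into \<open>b\<close>, and
    Replacement along its inverse would collect the ordinals in a set.\<close>
  have "\<exists>\<alpha>. Ord \<alpha> \<and> ext b \<subseteq> G ` ext \<alpha>"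
  proof (rule ccontr)
    assume "\<not> ?thesis"
    then have n: "\<And>\<alpha>. Ord \<alpha> \<Longrightarrow> \<not> ext b \<subseteq> G ` ext \<alpha>" by blast
    have i: "inj_on G {\<alpha>. Ord \<alpha>}" using n by (intro inj) blast
    define k where "k y = dTHE (\<lambda>\<alpha>. Ord \<alpha> \<and> G \<alpha> = y)" for y
    have k: "dfun1 k" unfolding dfun1_def k_def by (intro dfn dfun1D[OF G])
    have kG: "k (G \<alpha>) = \<alpha>" if "Ord \<alpha>" for \<alpha>
      unfolding k_def using that inj_onD[OF i] by (intro dTHE_eq) simp_all
    have "isset (k ` ext b)" using b by (intro isset_image k isset_ext)
    then obtain \<alpha> where a: "Ord \<alpha>" "\<alpha> \<notin> k ` ext b" using Ord_unbounded by blast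
    have "G \<alpha> \<in> ext b" using new[OF a(1) n[OF a(1)]] by blast
    then show False using kG[OF a(1)] a(2) by force
  qed
  then obtain \<alpha>0 where a0: "Ord \<alpha>0" "ext b \<subseteq> G ` ext \<alpha>0" by blast
  have "definable (\<lambda>s. ext b \<subseteq> G ` ext (s 0))" using b by (intro dfn dfun1D[OF G])
  from Ord_least[of "\<lambda>\<alpha>. ext b \<subseteq> G ` ext \<alpha>", OF this a0] obtain \<alpha> where a: "Ord \<alpha>" "ext b \<subseteq> G ` ext \<alpha>"
    and min: "\<And>\<beta>. \<beta> \<in> ext \<alpha> \<Longrightarrow> \<not> ext b \<subseteq> G ` ext \<beta>"
    by blast
  have "inj_on G (ext \<alpha>)" using min Ord_elem[OF a(1)] by (intro inj) blast
  moreover have "G ` ext \<alpha> \<subseteq> ext b" using new[OF Ord_elem[OF a(1)]] min by blast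
  ultimately have "bij_betw G (ext \<alpha>) (ext b)" unfolding bij_betw_def using a(2) by blast
  then show ?thesis using a(1) G by blast
qed

section \<open>Comparison of cardinalities\<close>

lemma dfun1_comp: "dfun1 g \<Longrightarrow> dfun1 f \<Longrightarrow> dfun1 (\<lambda>x. g (f x))"
  unfolding dfun1_def using dfun1D by (metis dfun1_def)

lemma dfun1_id: "dfun1 (\<lambda>x. x)"
  unfolding dfun1_def by (intro dfn)

definition injects :: "'a \<Rightarrow> 'a \<Rightarrow> bool" where
  "injects a b \<longleftrightarrow> (\<exists>h. dfun1 h \<and> inj_on h (ext a) \<and> h ` ext a \<subseteq> ext b)"

lemma injectsI: "dfun1 h \<Longrightarrow> inj_on h (ext a) \<Longrightarrow> (\<And>x. x \<in> ext a \<Longrightarrow> h x \<in> ext b) \<Longrightarrow> injects a b"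
  unfolding injects_def by blast

lemma injects_subset: "ext a \<subseteq> ext b \<Longrightarrow> injects a b"
  by (rule injectsI[OF dfun1_id]) auto

lemma injects_trans:
  assumes "injects a b" "injects b c" shows "injects a c"
proof -
  obtain f g where f: "dfun1 f" "inj_on f (ext a)" "f ` ext a \<subseteq> ext b"
    and g: "dfun1 g" "inj_on g (ext b)" "g ` ext b \<subseteq> ext c"
    using assms unfolding injects_def by blast
  show ?thesis
  proof (rule injectsI[OF dfun1_comp[OF g(1) f(1)]])
    show "inj_on (\<lambda>x. g (f x)) (ext a)"
      using comp_inj_on[OF f(2) inj_on_subset[OF g(2) f(3)]] by (simp add: comp_def)
    show "g (f x) \<in> ext c" if "x \<in> ext a" for x using that f(3) g(3) by blast
  qed
qed

lemma bij_injects: "dfun1 h \<Longrightarrow> bij_betw h (ext a) (ext b) \<Longrightarrow> injects a b"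
  unfolding injects_def bij_betw_def by blast

lemma bij_inverse:
  assumes "dfun1 h" "a \<in> D" "bij_betw h (ext a) (ext b)"
  shows "\<exists>k. dfun1 k \<and> bij_betw k (ext b) (ext a) \<and> (\<forall>x\<in>ext a. k (h x) = x) \<and> (\<forall>y\<in>ext b. h (k y) = y)"
proof -
  have img: "h ` ext a = ext b" using assms(3) by (rule bij_betw_imp_surj_on)
  obtain k where k: "dfun1 k" "\<And>x. x \<in> ext a \<Longrightarrow> k (h x) = x"
    using dfun_inverse[OF assms(1,2) bij_betw_imp_inj_on[OF assms(3)]] by blast
  have hk: "h (k y) = y \<and> k y \<in> ext a" if y: "y \<in> ext b" for y
  proof -
    have "y \<in> h ` ext a" using y unfolding img .
    then obtain x where "x \<in> ext a" "y = h x" by (rule imageE)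
    then show ?thesis using k(2) by simp
  qed
  have "bij_betw k (ext b) (ext a)"
    unfolding bij_betw_def
  proof (intro conjI equalityI subsetI)
    show "inj_on k (ext b)" using hk by (metis inj_onI)
    show "x \<in> ext a" if "x \<in> k ` ext b" for x using that hk by blast
    show "x \<in> k ` ext b" if x: "x \<in> ext a" for x
    proof (rule image_eqI)
      show "x = k (h x)" using k(2)[OF x] by simp
      show "h x \<in> ext b" using x img by blast
    qed
  qed
  then show ?thesis using k hk by blast
qed

text \<open>Knaster-Tarski: \<open>S\<close> is the greatest fixed point of the monotone operator
  \<open>\<Phi>\<close>, obtained as the union of all sets contained in their image. The bijection
  is \<open>f\<close> on \<open>S\<close> and the inverse of \<open>g\<close> off
  \<open>S\<close>.\<close>

theorem schroeder_bernstein: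
  assumes aD: "a \<in> D" and bD: "b \<in> D" and "injects a b" "injects b a"
  shows "\<exists>h. dfun1 h \<and> bij_betw h (ext a) (ext b)"
proof -
  obtain f g where f: "dfun1 f" "inj_on f (ext a)" "f ` ext a \<subseteq> ext b"
    and g: "dfun1 g" "inj_on g (ext b)" "g ` ext b \<subseteq> ext a"
    using assms unfolding injects_def by blast
  define \<Phi> where "\<Phi> X = ext a - g ` (ext b - f ` X)" for X
  have mono: "\<Phi> X \<subseteq> \<Phi> Y" if "X \<subseteq> Y" for X Y using that unfolding \<Phi>_def by blast
  define T where "T = {A \<in> {A \<in> D. ext A \<subseteq> ext a}. ext A \<subseteq> \<Phi> (ext A)}"
  have T: "isset T" unfolding T_def \<Phi>_def
    using aD bD by (intro isset_Collect isset_Pow isset_ext dfn dfun1D[OF f(1)] dfun1D[OF g(1)])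
  define S where "S = (\<Union>A\<in>T. ext A)"
  have S: "isset S" unfolding S_def by (rule isset_Union[OF T])
  have S1: "S \<subseteq> \<Phi> S"
  proof
    fix x assume "x \<in> S"
    then obtain A where A: "A \<in> T" "x \<in> ext A" unfolding S_def by blast
    then have "x \<in> \<Phi> (ext A)" unfolding T_def by blast
    moreover have "ext A \<subseteq> S" using A(1) unfolding S_def by blast
    ultimately show "x \<in> \<Phi> S" using mono by blast
  qed
  have S2: "\<Phi> S \<subseteq> S"
  proof -
    have i: "isset (\<Phi> S)" unfolding \<Phi>_def
      using aD bD by (intro isset_Diff isset_image isset_ext f(1) g(1) S)
    have "\<Phi> S \<subseteq> ext a" unfolding \<Phi>_def by blast
    then have "mk (\<Phi> S) \<in> T" unfolding T_def using ext_mk[OF i] mono[OF S1] by simp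
    then have "ext (mk (\<Phi> S)) \<subseteq> S" unfolding S_def by blast
    then show ?thesis using ext_mk[OF i] by simp
  qed
  have S_eq: "x \<in> S \<longleftrightarrow> x \<in> ext a \<and> x \<notin> g ` (ext b - f ` S)" for x
    using S1 S2 unfolding \<Phi>_def by blast
  obtain k where k: "dfun1 k" "\<And>x. x \<in> ext b \<Longrightarrow> k (g x) = x"
    using dfun_inverse[OF g(1) bD g(2)] by blast
  define h where "h x = (if x \<in> S then f x else k x)" for x
  have h: "dfun1 h" unfolding dfun1_def h_def
    by (intro dfn dclass_isset[OF S] dfun1D[OF f(1)] dfun1D[OF k(1)])
  have out: "\<exists>y. y \<in> ext b \<and> y \<notin> f ` S \<and> x = g y \<and> h x = y" if "x \<in> ext a" "x \<notin> S" for x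
  proof -
    have "x \<in> g ` (ext b - f ` S)" using that S_eq by blast
    then obtain y where "y \<in> ext b" "y \<notin> f ` S" "x = g y" by blast
    then show ?thesis using k(2) that unfolding h_def by simp
  qed
  have inS: "h x = f x" if "x \<in> S" for x using that unfolding h_def by simp
  have Sa: "S \<subseteq> ext a" using S_eq by blast
  have "inj_on h (ext a)"
  proof (rule inj_onI)
    fix x y assume xy: "x \<in> ext a" "y \<in> ext a" "h x = h y"
    consider "x \<in> S" "y \<in> S" | "x \<in> S" "y \<notin> S" | "x \<notin> S" "y \<in> S" | "x \<notin> S" "y \<notin> S" by blast
    then show "x = y"
    proof cases
      case 1 then show ?thesis using inS xy inj_onD[OF f(2)] by metis
    next
      case 2 then show ?thesis using inS xy out[of y] by (metis imageI)
    next
      case 3 then show ?thesis using inS xy out[of x] by (metis imageI)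
    next
      case 4 then show ?thesis using xy out[of x] out[of y] by metis
    qed
  qed
  moreover have "h ` ext a = ext b"
  proof (intro equalityI subsetI)
    fix z assume "z \<in> h ` ext a"
    then obtain x where x: "x \<in> ext a" "z = h x" by blast
    show "z \<in> ext b"
    proof (cases "x \<in> S")
      case True then show ?thesis using inS x f(3) by auto
    next
      case False then show ?thesis using out[OF x(1)] x(2) by metis
    qed
  next
    fix z assume z: "z \<in> ext b"
    show "z \<in> h ` ext a"
    proof (cases "z \<in> f ` S")
      case True
      then obtain x where "x \<in> S" "z = f x" by blast
      then show ?thesis using inS Sa by (metis image_eqI subsetD)
    next
      case False
      then have "g z \<in> g ` (ext b - f ` S)" using z by blast
      then have "g z \<notin> S" using S_eq by blast
      then have "h (g z) = z" using k(2)[OF z] unfolding h_def by simp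
      moreover have "g z \<in> ext a" using g(3) z by blast
      ultimately show ?thesis by (metis image_eqI)
    qed
  qed
  ultimately show ?thesis using h unfolding bij_betw_def by blast
qed

lemma equipotent_injects: "a \<in> D \<Longrightarrow> equipotent a b \<Longrightarrow> injects a b"
  using equipotent_iff bij_injects by blast

lemma equipotent_sym:
  assumes "a \<in> D" "b \<in> D" "equipotent a b" shows "equipotent b a"
  using assms equipotent_iff bij_inverse by metis

lemma injects_equipotent: "a \<in> D \<Longrightarrow> b \<in> D \<Longrightarrow> injects a b \<Longrightarrow> injects b a \<Longrightarrow> equipotent a b"
  using schroeder_bernstein equipotent_iff by metis

lemma equipotent_trans:
  assumes "a \<in> D" "b \<in> D" "c \<in> D" "equipotent a b" "equipotent b c" shows "equipotent a c"
  using assms by (meson equipotent_injects equipotent_sym injects_equipotent injects_trans)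

lemma cardinality:
  assumes "x \<in> D" shows "\<exists>\<mu>. Ord \<mu> \<and> cardinal \<mu> \<and> equipotent x \<mu>"
proof -
  obtain \<alpha> h where a: "Ord \<alpha>" "dfun1 h" "bij_betw h (ext \<alpha>) (ext x)" using well_ordering[OF assms] by blast
  then have e: "equipotent x \<alpha>" using assms equipotent_iff equipotent_sym Ord_in by metis
  have "definable (\<lambda>s. equipotent x (s 0))" using assms by (intro dfn)
  from Ord_least[of "equipotent x", OF this a(1) e] obtain \<mu> where
    m: "Ord \<mu>" "equipotent x \<mu>" "\<And>\<gamma>. \<gamma> \<in> ext \<mu> \<Longrightarrow> \<not> equipotent x \<gamma>" by blast
  have "\<not> equipotent \<gamma> \<mu>" if g: "\<gamma> \<in> ext \<mu>" for \<gamma>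
    using equipotent_trans[OF assms Ord_in[OF m(1)] ext_D[OF g] m(2)] m(3)[OF g]
      equipotent_sym[OF ext_D[OF g] Ord_in[OF m(1)]] by blast
  then have "cardinal \<mu>" using m(1) unfolding cardinal_def Ord_def by blast
  then show ?thesis using m by blast
qed

text \<open>Lets any ordinal below \<open>k\<close> witness smallness in place of the exact
  cardinality: if that cardinality were not below \<open>k\<close>, then \<open>k\<close> would
  inject into a smaller ordinal.\<close>

lemma card_less_iff:
  assumes k: "Ord k" "cardinal k" and x: "x \<in> D"
  shows "card_less x k \<longleftrightarrow> (\<exists>\<alpha>\<in>ext k. injects x \<alpha>)"
proof
  assume "card_less x k"
  then show "\<exists>\<alpha>\<in>ext k. injects x \<alpha>" unfolding card_less_def using equipotent_injects x by blast
next
  assume "\<exists>\<alpha>\<in>ext k. injects x \<alpha>"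
  then obtain \<alpha> where a: "\<alpha> \<in> ext k" "injects x \<alpha>" by blast
  obtain \<mu> where m: "Ord \<mu>" "cardinal \<mu>" "equipotent x \<mu>" using cardinality[OF x] by blast
  have "\<mu> \<in> ext k"
  proof (rule ccontr)
    assume "\<mu> \<notin> ext k"
    then have "injects k \<mu>" using Ord_not_mem m k by (intro injects_subset) blast
    moreover have "injects \<mu> x"
      using m(3) equipotent_sym[OF x Ord_in[OF m(1)]] equipotent_injects[OF Ord_in[OF m(1)]] by blast
    ultimately have "injects k \<alpha>" using a(2) injects_trans by blast
    moreover have "injects \<alpha> k" using Ord_trans[OF k(1) a(1)] by (intro injects_subset) blast
    ultimately have "equipotent \<alpha> k" using injects_equipotent ext_D[OF a(1)] Ord_in[OF k(1)] by blast
    then show False using k(2) a(1) unfolding cardinal_def by blast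
  qed
  then show "card_less x k" unfolding card_less_def using m by blast
qed

lemma injects_image_Ord:
  assumes "dfun1 f" "Ord \<mu>" shows "injects (mk (f ` ext \<mu>)) \<mu>"
proof -
  have e: "ext (mk (f ` ext \<mu>)) = f ` ext \<mu>" using assms by (intro ext_mk isset_image isset_ext) simp_all
  have "drel2 (\<lambda>y x. x \<in> ext \<mu> \<and> f x = y)"
    unfolding drel2_def by (intro dfn dfun1D[OF assms(1)] Ord_in[OF assms(2)])
  from least_ordinal_function[OF this] obtain k where k1: "dfun1 k"
    and k2: "\<And>y x. y \<in> D \<Longrightarrow> Ord x \<Longrightarrow> x \<in> ext \<mu> \<and> f x = y \<Longrightarrow> k y \<in> ext \<mu> \<and> f (k y) = y" by blast
  have k: "k y \<in> ext \<mu> \<and> f (k y) = y" if "y \<in> f ` ext \<mu>" for y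
  proof -
    from that obtain x where x: "x \<in> ext \<mu>" "f x = y" by blast
    then show ?thesis using k2[OF _ Ord_elem[OF assms(2) x(1)]] dfun1_in[OF assms(1) ext_D[OF x(1)]] by blast
  qed
  have "inj_on k (f ` ext \<mu>)" using k by (metis inj_onI)
  then show ?thesis unfolding injects_def e using k k1 by blast
qed

text \<open>A well-ordering of \<open>a\<close> reduces this to an ordinal domain, where least
  preimages give the injection.\<close>

lemma injects_image:
  assumes "dfun1 f" "a \<in> D" shows "injects (mk (f ` ext a)) a"
proof -
  obtain \<mu> h where m: "Ord \<mu>" "dfun1 h" "bij_betw h (ext \<mu>) (ext a)" using well_ordering[OF assms(2)] by blast
  have "f ` ext a = (\<lambda>x. f (h x)) ` ext \<mu>"
    using bij_betw_imp_surj_on[OF m(3)] by (metis image_image)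
  then have "injects (mk (f ` ext a)) \<mu>"
    using injects_image_Ord[OF dfun1_comp[OF assms(1) m(2)] m(1)] by simp
  then show ?thesis using bij_injects[OF m(2,3)] injects_trans by blast
qed

lemma Cantor:
  assumes "a \<in> D" shows "\<not> injects (mk {y \<in> D. ext y \<subseteq> ext a}) a"
proof
  have e: "ext (mk {y \<in> D. ext y \<subseteq> ext a}) = {y \<in> D. ext y \<subseteq> ext a}"
    using assms by (intro ext_mk isset_Pow isset_ext)
  assume "injects (mk {y \<in> D. ext y \<subseteq> ext a}) a"
  then obtain h where h: "dfun1 h" "inj_on h {y \<in> D. ext y \<subseteq> ext a}" "\<And>y. y \<in> D \<Longrightarrow> ext y \<subseteq> ext a \<Longrightarrow> h y \<in> ext a"
    unfolding injects_def e by blast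
  define R where "R = {z \<in> ext a. \<exists>y\<in>{y \<in> D. ext y \<subseteq> ext a}. h y = z \<and> z \<notin> ext y}"
  have "isset R" unfolding R_def using assms by (intro isset_Collect isset_ext dfn dfun1D[OF h(1)])
  then have r: "mk R \<in> D" "ext (mk R) = R" by simp_all
  have Ra: "R \<subseteq> ext a" unfolding R_def by blast
  show False
  proof (cases "h (mk R) \<in> R")
    case True
    then obtain y where y: "y \<in> D" "ext y \<subseteq> ext a" "h y = h (mk R)" "h (mk R) \<notin> ext y" unfolding R_def by blast
    then have "y = mk R" using inj_onD[OF h(2) y(3)] r Ra by simp
    then show False using y True r by simp
  next
    case False
    then show False using r Ra h(3)[OF r(1)] unfolding R_def by blast
  qed
qed

text \<open>\<open>injects\<close> quantifies over functions of HOL and is not first-order as it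
  stands; quantifying over sets \<open>f\<close> of the model instead makes it definable.\<close>

definition is_inj :: "'a \<Rightarrow> 'a \<Rightarrow> 'a \<Rightarrow> bool" where
  "is_inj f a b \<longleftrightarrow> (\<forall>x\<in>ext a. app f x \<in> ext b \<and> (\<forall>y\<in>ext a. app f x = app f y \<longrightarrow> x = y))"

lemma drel3_is_inj: "drel3 is_inj"
  unfolding drel3_def is_inj_def by (intro dfn)

lemmas [dfn] = drel3D[OF drel3_is_inj]

lemma injects_iff:
  assumes a: "a \<in> D" shows "injects a b \<longleftrightarrow> (\<exists>f\<in>D. is_inj f a b)"
proof
  assume "injects a b"
  then obtain h where h: "dfun1 h" "inj_on h (ext a)" "\<And>x. x \<in> ext a \<Longrightarrow> h x \<in> ext b"
    unfolding injects_def by blast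
  have "app (lam a h) x = h x" if "x \<in> ext a" for x using that a h(1) by simp
  then have "is_inj (lam a h) a b" unfolding is_inj_def using h(3) inj_onD[OF h(2)] by simp
  then show "\<exists>f\<in>D. is_inj f a b" by (rule bexI) simp
next
  assume "\<exists>f\<in>D. is_inj f a b"
  then obtain f where f: "f \<in> D" "is_inj f a b" by blast
  show "injects a b"
    using f(2) unfolding is_inj_def by (intro injectsI[OF dfun1_app[OF f(1)]] inj_onI) blast+
qed

lemma drel2_injects: "drel2 injects"
proof -
  have "definable (\<lambda>s. \<exists>f\<in>D. is_inj f (s 0) (s (Suc 0)))" by (intro dfn)
  then show ?thesis unfolding drel2_def by (rule definable_cong) (simp add: injects_iff)
qed

lemmas [dfn] = drel2D[OF drel2_injects]

text \<open>A well-ordering of the power set of \<open>b\<close> has a length that cannot inject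
  into \<open>b\<close>, by Cantor; then the least such ordinal is taken.\<close>

lemma Hartogs:
  assumes "b \<in> D" shows "\<exists>\<delta>. Ord \<delta> \<and> \<not> injects \<delta> b \<and> (\<forall>\<beta>\<in>ext \<delta>. injects \<beta> b)"
proof -
  define p where "p = mk {y \<in> D. ext y \<subseteq> ext b}"
  have "p \<in> D" unfolding p_def by simp
  then obtain \<beta> h where b: "Ord \<beta>" "dfun1 h" "bij_betw h (ext \<beta>) (ext p)" using well_ordering by blast
  have "injects p \<beta>" using bij_inverse[OF b(2) _ b(3)] b(1) bij_injects by (meson Ord_in)
  then have n: "\<not> injects \<beta> b" using Cantor[OF assms] injects_trans unfolding p_def by blast
  have "definable (\<lambda>s. \<not> injects (s 0) b)" using assms by (intro dfn)
  from Ord_least[of "\<lambda>\<gamma>. \<not> injects \<gamma> b", OF this b(1) n] show ?thesis by blast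
qed

section \<open>The cumulative hierarchy and regular cardinals\<close>

lemma dfun1_osucc: "dfun1 osucc"
  unfolding dfun1_def osucc_def by (intro dfn)

lemmas defterm_osucc [dfn] = dfun1D[OF dfun1_osucc]

definition Lim :: "'a \<Rightarrow> bool" where
  "Lim \<theta> \<longleftrightarrow> Ord \<theta> \<and> mk {} \<in> ext \<theta> \<and> (\<forall>x\<in>ext \<theta>. osucc x \<in> ext \<theta>)"

lemma drel1_Lim: "drel1 Lim"
  unfolding drel1_def Lim_def by (intro dfn) simp

lemmas [dfn] = drel1D[OF drel1_Lim]

lemma Ord_empty_mem: "Ord \<alpha> \<Longrightarrow> ext \<alpha> \<noteq> {} \<Longrightarrow> mk {} \<in> ext \<alpha>"
  using Ord_linear[OF Ord_empty, of \<alpha>] by auto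

lemma osucc_mem:
  assumes "Ord \<alpha>" "x \<in> ext \<alpha>" shows "osucc x \<in> ext \<alpha> \<or> osucc x = \<alpha>"
proof -
  have x: "Ord x" using Ord_elem[OF assms] .
  have "ext (osucc x) \<subseteq> ext \<alpha>" using x assms(2) Ord_trans[OF assms] by auto
  then show ?thesis using Ord_subset_iff[OF Ord_osucc[OF x] assms(1)] by blast
qed

text \<open>The least ordinal outside an inductive set is a limit: were the successor of one of its
  members equal to it, it would be in the inductive set.\<close>

lemma Lim_exists: "\<exists>\<theta>. Lim \<theta>"
proof -
  obtain w e where w: "w \<in> D" and e: "e \<in> ext w" "ext e = {}"
    and s: "\<And>x. x \<in> ext w \<Longrightarrow> \<exists>y\<in>ext w. ext y = insert x (ext x)"
    using zfc_infinity by blast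
  have e': "mk {} \<in> ext w" using e mk_ext[OF ext_D[OF e(1)]] by simp
  have s': "osucc x \<in> ext w" if x: "x \<in> ext w" for x
  proof -
    obtain y where y: "y \<in> ext w" "ext y = insert x (ext x)" using s[OF x] by blast
    then show ?thesis using mk_ext[OF ext_D[OF y(1)]] unfolding osucc_def by simp
  qed
  obtain \<alpha>0 where a0: "Ord \<alpha>0" "\<alpha>0 \<notin> ext w" using Ord_unbounded[OF isset_ext[OF w]] by blast
  have "definable (\<lambda>s. s 0 \<notin> ext w)" using w by (intro dfn)
  from Ord_least[of "\<lambda>\<alpha>. \<alpha> \<notin> ext w", OF this a0] obtain \<alpha> where
    a: "Ord \<alpha>" "\<alpha> \<notin> ext w" and min: "\<And>\<beta>. \<beta> \<in> ext \<alpha> \<Longrightarrow> \<beta> \<in> ext w" by blast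
  have "ext \<alpha> \<noteq> {}" using a e' mk_ext[OF Ord_in[OF a(1)]] by metis
  moreover have "osucc x \<in> ext \<alpha>" if x: "x \<in> ext \<alpha>" for x
    using osucc_mem[OF a(1) x] s'[OF min[OF x]] a(2) by metis
  ultimately show ?thesis unfolding Lim_def using Ord_empty_mem[OF a(1)] a(1) by blast
qed

text \<open>Iterates along any limit ordinal \<open>\<theta>\<close>: an element of stage
  \<open>\<theta>\<close> already occurs at an earlier stage, and everything that \<open>H\<close>
  assigns to elements of earlier stages is in stage \<open>\<theta>\<close>.\<close>

theorem closure_exists:
  assumes H: "dfun1 H" and a: "a \<in> D"
  shows "\<exists>T\<in>D. ext a \<subseteq> ext T \<and> (\<forall>t\<in>ext T. ext (H t) \<subseteq> ext T)"
proof -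
  define K where "K g = mk (\<Union>t\<in>ext g. ext (H t))" for g
  have K: "dfun1 K" unfolding dfun1_def K_def by (intro dfn dfun1D[OF H])
  have eK: "ext (K g) = (\<Union>t\<in>ext g. ext (H t))" if "g \<in> D" for g
    unfolding K_def using that by (intro ext_mk isset_UN H isset_ext)
  define F where "F z = mk (ext a \<union> (\<Union>g\<in>ext z. ext (K g)))" for z
  have F: "dfun1 F" unfolding dfun1_def F_def using a by (intro dfn dfun1D[OF K])
  have eF: "ext (F z) = ext a \<union> (\<Union>g\<in>ext z. ext (K g))" if "z \<in> D" for z
    unfolding F_def using that a by (intro ext_mk isset_Un isset_UN K isset_ext)
  obtain G where G: "dfun1 G" and rec: "\<And>\<alpha>. Ord \<alpha> \<Longrightarrow> G \<alpha> = F (mk (G ` ext \<alpha>))"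
    using recursion[OF F] by blast
  have eG: "ext (G \<alpha>) = ext a \<union> (\<Union>\<beta>\<in>ext \<alpha>. \<Union>t\<in>ext (G \<beta>). ext (H t))" if o: "Ord \<alpha>" for \<alpha>
  proof -
    have "ext (mk (G ` ext \<alpha>)) = G ` ext \<alpha>"
      using o by (intro ext_mk isset_image G isset_ext) simp
    then have "ext (G \<alpha>) = ext a \<union> (\<Union>\<beta>\<in>ext \<alpha>. ext (K (G \<beta>)))" using eF[of "mk (G ` ext \<alpha>)"] rec[OF o] by simp
    moreover have "ext (K (G \<beta>)) = (\<Union>t\<in>ext (G \<beta>). ext (H t))" if "\<beta> \<in> ext \<alpha>" for \<beta>
      using eK[OF dfun1_in[OF G ext_D[OF that]]] .
    ultimately show ?thesis by simp
  qed
  obtain \<theta> where "Lim \<theta>" using Lim_exists by blast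
  then have t: "Ord \<theta>" "mk {} \<in> ext \<theta>" "\<And>x. x \<in> ext \<theta> \<Longrightarrow> osucc x \<in> ext \<theta>" unfolding Lim_def by blast+
  have step: "ext (H t) \<subseteq> ext (G \<theta>)" if "\<beta> \<in> ext \<theta>" "t \<in> ext (G \<beta>)" for \<beta> t
    using eG[OF t(1)] that by blast
  have "ext (H t) \<subseteq> ext (G \<theta>)" if tt: "t \<in> ext (G \<theta>)" for t
  proof -
    consider "t \<in> ext a" | \<beta> u where "\<beta> \<in> ext \<theta>" "u \<in> ext (G \<beta>)" "t \<in> ext (H u)"
      using tt unfolding eG[OF t(1)] by blast
    then show ?thesis
    proof cases
      case 1
      then have "t \<in> ext (G (mk {}))" using eG[OF Ord_empty] by blast
      then show ?thesis using step[OF t(2)] by blast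
    next
      case (2 \<beta> u)
      have b: "Ord \<beta>" using Ord_elem[OF t(1) 2(1)] .
      have "\<beta> \<in> ext (osucc \<beta>)" using b by simp
      then have "t \<in> ext (G (osucc \<beta>))" using eG[OF Ord_osucc[OF b]] 2 by blast
      then show ?thesis using step[OF t(3)[OF 2(1)]] by blast
    qed
  qed
  moreover have "ext a \<subseteq> ext (G \<theta>)" using eG[OF t(1)] by blast
  ultimately show ?thesis using dfun1_in[OF G Ord_in[OF t(1)]] by blast
qed

text \<open>If some \<open>x\<close> escaped, take a transitive set around it and an
  \<open>E\<close>-minimal member \<open>t\<close> that escapes. All members of \<open>t\<close> lie
  in the hierarchy, the supremum of their least levels exists by Replacement, and \<open>t\<close>
  appears one level later.\<close>

theorem hierarchy:
  shows "\<exists>V. dfun1 V \<and> (\<forall>x\<in>D. \<exists>\<alpha>. Ord \<alpha> \<and> x \<in> ext (V \<alpha>)) \<and>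
    (\<forall>\<alpha> \<beta>. Ord \<alpha> \<longrightarrow> Ord \<beta> \<longrightarrow> ext \<alpha> \<subseteq> ext \<beta> \<longrightarrow> ext (V \<alpha>) \<subseteq> ext (V \<beta>))"
proof -
  define K where "K g = mk {y \<in> D. ext y \<subseteq> ext g}" for g
  have K: "dfun1 K" unfolding dfun1_def K_def by (intro dfn)
  have eK: "ext (K g) = {y \<in> D. ext y \<subseteq> ext g}" if "g \<in> D" for g
    unfolding K_def using that by (intro ext_mk isset_Pow isset_ext)
  define F where "F z = mk (\<Union>g\<in>ext z. ext (K g))" for z
  have F: "dfun1 F" unfolding dfun1_def F_def by (intro dfn dfun1D[OF K])
  have eF: "ext (F z) = (\<Union>g\<in>ext z. ext (K g))" if "z \<in> D" for z
    unfolding F_def using that by (intro ext_mk isset_UN K isset_ext)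
  obtain V where V: "dfun1 V" and rec: "\<And>\<alpha>. Ord \<alpha> \<Longrightarrow> V \<alpha> = F (mk (V ` ext \<alpha>))"
    using recursion[OF F] by blast
  have eV: "ext (V \<alpha>) = (\<Union>\<beta>\<in>ext \<alpha>. {y \<in> D. ext y \<subseteq> ext (V \<beta>)})" if o: "Ord \<alpha>" for \<alpha>
  proof -
    have "ext (mk (V ` ext \<alpha>)) = V ` ext \<alpha>"
      using o by (intro ext_mk isset_image V isset_ext) simp
    then have "ext (V \<alpha>) = (\<Union>\<beta>\<in>ext \<alpha>. ext (K (V \<beta>)))" using eF[of "mk (V ` ext \<alpha>)"] rec[OF o] by simp
    moreover have "ext (K (V \<beta>)) = {y \<in> D. ext y \<subseteq> ext (V \<beta>)}" if "\<beta> \<in> ext \<alpha>" for \<beta>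
      using eK[OF dfun1_in[OF V ext_D[OF that]]] .
    ultimately show ?thesis by simp
  qed
  have mono: "ext (V \<alpha>) \<subseteq> ext (V \<beta>)" if "Ord \<alpha>" "Ord \<beta>" "ext \<alpha> \<subseteq> ext \<beta>" for \<alpha> \<beta>
    using eV[OF that(1)] eV[OF that(2)] that(3) by blast
  have "\<exists>\<alpha>. Ord \<alpha> \<and> x \<in> ext (V \<alpha>)" if x: "x \<in> D" for x
  proof (rule ccontr)
    assume bad: "\<not> ?thesis"
    have "isset {x}" using x by simp
    then have ex: "ext (mk {x}) = {x}" by simp
    obtain T where T: "T \<in> D" "x \<in> ext T" "\<And>t. t \<in> ext T \<Longrightarrow> ext t \<subseteq> ext T"
      using closure_exists[OF dfun1_id, of "mk {x}"] unfolding ex by auto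
    define B where "B = {t \<in> ext T. \<not> (\<exists>\<alpha>\<in>D. Ord \<alpha> \<and> t \<in> ext (V \<alpha>))}"
    have B: "isset B" unfolding B_def by (intro isset_Collect isset_ext T dfn dfun1D[OF V])
    have "x \<in> B" unfolding B_def using T(2) bad by blast
    then have "B \<noteq> {}" by blast
    from foundation[OF B this] obtain t where t: "t \<in> B" "\<And>z. z \<in> B \<Longrightarrow> \<not> E z t" by blast
    have tT: "t \<in> ext T" and tbad: "\<And>\<alpha>. Ord \<alpha> \<Longrightarrow> t \<notin> ext (V \<alpha>)" using t(1) unfolding B_def by auto
    have good: "\<exists>\<alpha>. Ord \<alpha> \<and> u \<in> ext (V \<alpha>)" if u: "u \<in> ext t" for u
    proof -
      have "u \<notin> B" using t(2)[of u] u ext_E by blast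
      moreover have "u \<in> ext T" using T(3)[OF tT] u by blast
      ultimately show ?thesis unfolding B_def by blast
    qed
    have "drel2 (\<lambda>u \<alpha>. u \<in> ext (V \<alpha>))" unfolding drel2_def by (intro dfn dfun1D[OF V])
    from least_ordinal_function[OF this] obtain r where r: "dfun1 r"
      and r': "\<And>u \<alpha>. u \<in> D \<Longrightarrow> Ord \<alpha> \<Longrightarrow> u \<in> ext (V \<alpha>) \<Longrightarrow> Ord (r u) \<and> u \<in> ext (V (r u))" by blast
    have ru: "Ord (r u) \<and> u \<in> ext (V (r u))" if u: "u \<in> ext t" for u
      using good[OF u] r'[OF ext_D[OF u]] by blast
    have R: "isset (r ` ext t)" by (intro isset_image r isset_ext ext_D[OF tT])
    define \<sigma> where "\<sigma> = mk (\<Union>x\<in>r ` ext t. ext x)"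
    have os: "Ord \<sigma>" unfolding \<sigma>_def using ru by (intro Ord_Sup[OF R]) blast
    have es: "ext \<sigma> = (\<Union>x\<in>r ` ext t. ext x)" unfolding \<sigma>_def using isset_Union[OF R] by simp
    have "ext t \<subseteq> ext (V \<sigma>)"
    proof
      fix u assume u: "u \<in> ext t"
      have "ext (r u) \<subseteq> ext \<sigma>" unfolding es using u by blast
      then show "u \<in> ext (V \<sigma>)" using mono[OF _ os] ru[OF u] by blast
    qed
    moreover have "\<sigma> \<in> ext (osucc \<sigma>)" using os by simp
    ultimately have "t \<in> ext (V (osucc \<sigma>))" using eV[OF Ord_osucc[OF os]] ext_D[OF tT] by blast
    then show False using tbad[OF Ord_osucc[OF os]] by blast
  qed
  then show ?thesis using V mono by blast
qed

text \<open>No set bounding the witnesses is given in advance. The least levels of the hierarchy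
  that contain witnesses have a supremum, and a choice function for subsets of that level selects
  among them.\<close>

theorem collection_choice:
  assumes R: "drel2 R" and A: "isset A" and tot: "\<And>u. u \<in> A \<Longrightarrow> \<exists>y\<in>D. R u y"
  shows "\<exists>e. dfun1 e \<and> (\<forall>u\<in>A. R u (e u))"
proof -
  obtain V where V: "dfun1 V" and ex: "\<And>x. x \<in> D \<Longrightarrow> \<exists>\<alpha>. Ord \<alpha> \<and> x \<in> ext (V \<alpha>)" and
    mono: "\<And>\<alpha> \<beta>. Ord \<alpha> \<Longrightarrow> Ord \<beta> \<Longrightarrow> ext \<alpha> \<subseteq> ext \<beta> \<Longrightarrow> ext (V \<alpha>) \<subseteq> ext (V \<beta>)"
    using hierarchy by blast
  define Q where "Q u \<alpha> \<longleftrightarrow> (\<exists>y\<in>ext (V \<alpha>). R u y)" for u \<alpha>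
  have Q: "drel2 Q" unfolding drel2_def Q_def by (intro dfn dfun1D[OF V] drel2D[OF R])
  from least_ordinal_function[OF Q] obtain r where r: "dfun1 r"
    and r': "\<And>u \<alpha>. u \<in> D \<Longrightarrow> Ord \<alpha> \<Longrightarrow> Q u \<alpha> \<Longrightarrow> Ord (r u) \<and> Q u (r u)" by blast
  have ru: "Ord (r u) \<and> Q u (r u)" if u: "u \<in> A" for u
  proof -
    obtain y where y: "y \<in> D" "R u y" using tot[OF u] by blast
    obtain \<alpha> where "Ord \<alpha>" "y \<in> ext (V \<alpha>)" using ex[OF y(1)] by blast
    then show ?thesis using r'[OF isset_in[OF A u]] y(2) unfolding Q_def by blast
  qed
  have I: "isset (r ` A)" by (intro isset_image r A)
  define \<sigma> where "\<sigma> = mk (\<Union>x\<in>r ` A. ext x)"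
  have os: "Ord \<sigma>" unfolding \<sigma>_def using ru by (intro Ord_Sup[OF I]) blast
  have es: "ext \<sigma> = (\<Union>x\<in>r ` A. ext x)" unfolding \<sigma>_def using isset_Union[OF I] by simp
  have VD: "V \<sigma> \<in> D" using dfun1_in[OF V Ord_in[OF os]] .
  obtain c where c: "dfun1 c" "\<And>B. B \<in> D \<Longrightarrow> ext B \<subseteq> ext (V \<sigma>) \<Longrightarrow> ext B \<noteq> {} \<Longrightarrow> c B \<in> ext B"
    using choice[OF VD] by blast
  define e where "e u = c (mk {y \<in> ext (V \<sigma>). R u y})" for u
  have e: "dfun1 e" unfolding dfun1_def e_def by (intro dfn dfun1D[OF c(1)] VD drel2D[OF R])
  have "R u (e u)" if u: "u \<in> A" for u
  proof -
    have uD: "u \<in> D" using isset_in[OF A u] .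
    have s: "ext (mk {y \<in> ext (V \<sigma>). R u y}) = {y \<in> ext (V \<sigma>). R u y}"
      by (intro ext_mk isset_Collect isset_ext VD dfn drel2D[OF R] uD)
    have "ext (r u) \<subseteq> ext \<sigma>" unfolding es using u by blast
    then have "ext (V (r u)) \<subseteq> ext (V \<sigma>)" using mono[OF _ os] ru[OF u] by blast
    then have "{y \<in> ext (V \<sigma>). R u y} \<noteq> {}" using ru[OF u] unfolding Q_def by blast
    then have "e u \<in> {y \<in> ext (V \<sigma>). R u y}" unfolding e_def using c(2)[of "mk {y \<in> ext (V \<sigma>). R u y}"] s by auto
    then show ?thesis by blast
  qed
  then show ?thesis using e by blast
qed

section \<open>Cofinal maps and the existence of large regular cardinals\<close>

lemma cofinal_mapI:
  assumes "dfun1 h" "\<beta> \<in> D" "\<And>u. u \<in> ext \<beta> \<Longrightarrow> h u \<in> ext \<alpha>"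
    "\<And>x. x \<in> ext \<alpha> \<Longrightarrow> \<exists>u\<in>ext \<beta>. x = h u \<or> x \<in> ext (h u)"
  shows "\<exists>f\<in>D. cofinal_map f \<beta> \<alpha>"
proof -
  have "is_function (lam \<beta> h) \<beta> \<alpha>" using assms by (intro is_function_lam) blast+
  moreover have "\<exists>u\<in>ext \<beta>. \<exists>v\<in>ext \<alpha>. maps_to (lam \<beta> h) u v \<and> (x = v \<or> E x v)" if "x \<in> ext \<alpha>" for x
  proof -
    obtain u where u: "u \<in> ext \<beta>" "x = h u \<or> x \<in> ext (h u)" using assms(4)[OF \<open>x \<in> ext \<alpha>\<close>] by blast
    have "maps_to (lam \<beta> h) u (h u)"
      using u(1) ext_D[OF u(1)] assms(2) dfun1_in[OF assms(1)] by (simp add: maps_to_lam[OF assms(1)])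
    then show ?thesis using u assms(3)[OF u(1)] ext_E by blast
  qed
  ultimately have "cofinal_map (lam \<beta> h) \<beta> \<alpha>" unfolding cofinal_map_def by blast
  then show ?thesis by (rule bexI) simp
qed

lemma cofinal_mapD:
  assumes "cofinal_map f \<beta> \<alpha>"
  shows "u \<in> ext \<beta> \<Longrightarrow> app f u \<in> ext \<alpha>"
    "x \<in> ext \<alpha> \<Longrightarrow> \<exists>u\<in>ext \<beta>. x = app f u \<or> x \<in> ext (app f u)"
proof -
  have f: "is_function f \<beta> \<alpha>" using assms unfolding cofinal_map_def by blast
  show "u \<in> ext \<beta> \<Longrightarrow> app f u \<in> ext \<alpha>" using is_function_app[OF f] .
  assume x: "x \<in> ext \<alpha>"
  then obtain u v where uv: "u \<in> ext \<beta>" "v \<in> ext \<alpha>" "maps_to f u v" "x = v \<or> E x v"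
    using assms unfolding cofinal_map_def by blast
  have "v = app f u" using uv is_function_maps_to[OF f ext_D[OF uv(1)] ext_D[OF uv(2)]] by blast
  then show "\<exists>u\<in>ext \<beta>. x = app f u \<or> x \<in> ext (app f u)" using uv(1,4) ext_D[OF x] ext_E by blast
qed

text \<open>The Hartogs ordinal of a set that absorbs pairs is regular. Here \<open>T\<close>
  includes \<open>a\<close> and is closed under two tagging maps with disjoint ranges, so two
  subsets of \<open>T\<close> are coded by one, and \<open>B\<close> is the power set of
  \<open>T\<close>.\<close>

theorem regular_cardinal_exists:
  assumes aD: "a \<in> D"
  shows "\<exists>\<delta>. Ord \<delta> \<and> regular_cardinal \<delta> \<and> injects a \<delta> \<and> \<not> injects \<delta> a"
proof -
  \<comment> \<open>\<open>z\<close> and \<open>o1\<close> are the ordinals 0 and 1, used as tags.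
    Putting \<open>z\<close> into \<open>T\<close> also makes \<open>o1\<close>, whose only element
    it is, a member of \<open>B\<close>.\<close>
  define z where "z = mk {}"
  define o1 where "o1 = mk {z}"
  have zD: "z \<in> D" and oD: "o1 \<in> D" unfolding z_def o1_def by simp_all
  have ez: "ext z = {}" unfolding z_def by simp
  have "isset {z}" using zD by simp
  then have eo: "ext o1 = {z}" unfolding o1_def by simp
  have zo: "z \<noteq> o1" using ez eo by auto
  define H where "H t = mk {opair z t, opair o1 t}" for t
  have H: "dfun1 H" unfolding dfun1_def H_def by (intro dfn zD oD)
  have eH: "ext (H t) = {opair z t, opair o1 t}" for t
    unfolding H_def by (intro ext_mk isset_pair) simp_all
  obtain T where T: "T \<in> D" "insert z (ext a) \<subseteq> ext T" "\<And>t. t \<in> ext T \<Longrightarrow> opair z t \<in> ext T \<and> opair o1 t \<in> ext T"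
    using closure_exists[OF H mk_in, of "insert z (ext a)"] unfolding eH using zD aD by auto
  define B where "B = mk {y \<in> D. ext y \<subseteq> ext T}"
  have BD: "B \<in> D" unfolding B_def by simp
  have eB: "ext B = {y \<in> D. ext y \<subseteq> ext T}" unfolding B_def by (intro ext_mk isset_Pow isset_ext T(1))
  define code where "code x y = mk (opair z ` ext x \<union> opair o1 ` ext y)" for x y
  have code: "dfun2 code" unfolding dfun2_def code_def by (intro dfn zD oD)
  have ecode: "ext (code x y) = opair z ` ext x \<union> opair o1 ` ext y" if "x \<in> D" "y \<in> D" for x y
  proof -
    have "dfun1 (opair z)" "dfun1 (opair o1)" unfolding dfun1_def by (intro dfn zD oD)+
    then show ?thesis unfolding code_def using that by (intro ext_mk isset_Un isset_image isset_ext)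
  qed
  have codeB: "code x y \<in> ext B" if "x \<in> ext B" "y \<in> ext B" for x y
  proof -
    have "ext x \<subseteq> ext T" "ext y \<subseteq> ext T" "x \<in> D" "y \<in> D" using that unfolding eB by blast+
    moreover have "code x y \<in> D" unfolding code_def by simp
    ultimately show ?thesis unfolding eB using ecode T(3) by auto
  qed
  have code_inj: "x = x' \<and> y = y'" if D: "x \<in> D" "y \<in> D" "x' \<in> D" "y' \<in> D" and eq: "code x y = code x' y'"
    for x y x' y'
  proof -
    have e: "opair z ` ext x \<union> opair o1 ` ext y = opair z ` ext x' \<union> opair o1 ` ext y'"
      using ecode[OF D(1,2)] ecode[OF D(3,4)] eq by simp
    have 1: "opair z t \<in> opair z ` ext x \<union> opair o1 ` ext y \<longleftrightarrow> t \<in> ext x"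
      "opair o1 t \<in> opair z ` ext x \<union> opair o1 ` ext y \<longleftrightarrow> t \<in> ext y" if "t \<in> D" for t x y
      using that zD oD zo by (auto simp: image_iff)
    have "t \<in> ext x \<longleftrightarrow> t \<in> ext x'" "t \<in> ext y \<longleftrightarrow> t \<in> ext y'" if "t \<in> D" for t
      using 1[OF that, of x y] 1[OF that, of x' y'] unfolding e by blast+
    then have "ext x = ext x'" "ext y = ext y'" using ext_D by blast+
    then show ?thesis using D extensionality by blast
  qed
  have zB: "z \<in> ext B" unfolding eB using zD ez by simp
  have oB: "o1 \<in> ext B" unfolding eB using oD eo T(2) by simp
  obtain \<delta> where d: "Ord \<delta>" "\<not> injects \<delta> B" "\<And>\<beta>. \<beta> \<in> ext \<delta> \<Longrightarrow> injects \<beta> B" using Hartogs[OF BD] by blast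
  have dD: "\<delta> \<in> D" using d(1) by simp
  \<comment> \<open>If \<open>\<delta>\<close> were the successor of \<open>x\<close>, an injection
    of \<open>x\<close> into \<open>B\<close> would extend to \<open>\<delta>\<close>: old values
    get second coordinate \<open>z\<close>, and the new point gets second coordinate
    \<open>o1\<close>.\<close>
  have succ: "osucc x \<in> ext \<delta>" if x: "x \<in> ext \<delta>" for x
  proof (rule ccontr)
    assume "osucc x \<notin> ext \<delta>"
    then have dx: "\<delta> = osucc x" using osucc_mem[OF d(1) x] by blast
    have xD: "x \<in> D" using ext_D[OF x] .
    obtain h where h: "dfun1 h" "inj_on h (ext x)" "\<And>y. y \<in> ext x \<Longrightarrow> h y \<in> ext B"
      using d(3)[OF x] unfolding injects_def by blast
    define k where "k y = (if y = x then code z o1 else code (h y) z)" for y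
    have k: "dfun1 k" unfolding dfun1_def k_def by (intro dfn dfun1D[OF h(1)] dfun2D[OF code] zD oD xD)
    have xx: "x \<notin> ext x" using Ord_irrefl[OF Ord_elem[OF d(1) x]] .
    have ne: "code z o1 \<noteq> code (h y) z" if "y \<in> ext x" for y
      using code_inj[OF zD oD dfun1_in[OF h(1) ext_D[OF that]] zD] zo by blast
    have inj: "y = y'" if "y \<in> ext x" "y' \<in> ext x" "code (h y) z = code (h y') z" for y y'
      using code_inj[OF dfun1_in[OF h(1) ext_D[OF that(1)]] zD dfun1_in[OF h(1) ext_D[OF that(2)]] zD that(3)]
        inj_onD[OF h(2) _ that(1,2)] by blast
    have kx: "k x = code z o1" unfolding k_def by simp
    have ky: "k y = code (h y) z" if "y \<in> ext x" for y unfolding k_def using that xx by auto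
    have "injects \<delta> B"
    proof (rule injectsI[OF k])
      show "inj_on k (ext \<delta>)"
        unfolding dx ext_osucc[OF xD]
      proof (rule inj_onI)
        fix y y' assume y: "y \<in> insert x (ext x)" "y' \<in> insert x (ext x)" "k y = k y'"
        consider "y = x" "y' = x" | "y = x" "y' \<in> ext x" | "y \<in> ext x" "y' = x" | "y \<in> ext x" "y' \<in> ext x"
          using y by blast
        then show "y = y'"
        proof cases
          case 2 then show ?thesis using y(3) kx ky ne by metis
        next
          case 3 then show ?thesis using y(3) kx ky ne by metis
        next
          case 4 then show ?thesis using y(3) ky inj by metis
        qed simp
      qed
      show "k y \<in> ext B" if "y \<in> ext \<delta>" for y
      proof (cases "y = x")
        case True then show ?thesis using kx codeB[OF zB oB] by simp
      next
        case False
        then have "y \<in> ext x" using that unfolding dx ext_osucc[OF xD] by blast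
        then show ?thesis using ky codeB[OF h(3) zB] by simp
      qed
    qed
    then show False using d(2) by blast
  qed
  \<comment> \<open>Along a cofinal map \<open>f\<close> from \<open>\<gamma>\<close>, each
    \<open>x\<close> is coded by an index \<open>m x\<close> whose initial segment contains
    \<open>x\<close>, together with its image under a chosen injection \<open>e (m x)\<close> of
    that segment into \<open>B\<close>; so \<open>\<delta>\<close> would inject into
    \<open>B\<close>.\<close>
  have no_cof: "\<not> (\<exists>f\<in>D. cofinal_map f \<gamma> \<delta>)" if g: "\<gamma> \<in> ext \<delta>" for \<gamma>
  proof
    assume "\<exists>f\<in>D. cofinal_map f \<gamma> \<delta>"
    then obtain f where f: "f \<in> D" "cofinal_map f \<gamma> \<delta>" by blast
    have gD: "\<gamma> \<in> D" using ext_D[OF g] .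
    have "drel2 (\<lambda>u y. is_inj y (osucc (app f u)) B)" unfolding drel2_def by (intro dfn f(1) BD)
    moreover have "\<exists>y\<in>D. is_inj y (osucc (app f u)) B" if "u \<in> ext \<gamma>" for u
      using d(3)[OF succ[OF cofinal_mapD(1)[OF f(2) that]]] injects_iff[OF osucc_in] by blast
    ultimately obtain e where e: "dfun1 e" "\<And>u. u \<in> ext \<gamma> \<Longrightarrow> is_inj (e u) (osucc (app f u)) B"
      using collection_choice[of "\<lambda>u y. is_inj y (osucc (app f u)) B" "ext \<gamma>"] gD by auto
    have "drel2 (\<lambda>x u. u \<in> ext \<gamma> \<and> x \<in> ext (osucc (app f u)))" unfolding drel2_def by (intro dfn f(1) gD)
    moreover have "\<exists>u\<in>D. u \<in> ext \<gamma> \<and> x \<in> ext (osucc (app f u))" if "x \<in> ext \<delta>" for x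
      using cofinal_mapD(2)[OF f(2) that] ext_osucc[OF app_in] ext_D by auto
    ultimately obtain m where m: "dfun1 m" "\<And>x. x \<in> ext \<delta> \<Longrightarrow> m x \<in> ext \<gamma> \<and> x \<in> ext (osucc (app f (m x)))"
      using collection_choice[of "\<lambda>x u. u \<in> ext \<gamma> \<and> x \<in> ext (osucc (app f u))" "ext \<delta>"] dD by auto
    obtain g where g: "dfun1 g" "inj_on g (ext \<gamma>)" "\<And>y. y \<in> ext \<gamma> \<Longrightarrow> g y \<in> ext B"
      using d(3)[OF g] unfolding injects_def by blast
    define k where "k x = code (g (m x)) (app (e (m x)) x)" for x
    have k: "dfun1 k" unfolding dfun1_def k_def
      by (intro dfn dfun1D[OF g(1)] dfun1D[OF m(1)] dfun1D[OF e(1)] dfun2D[OF code])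
    have "injects \<delta> B"
    proof (rule injectsI[OF k])
      fix x assume x: "x \<in> ext \<delta>"
      show "k x \<in> ext B" unfolding k_def
        using codeB g(3) m(2)[OF x] e(2) unfolding is_inj_def by blast
    next
      show "inj_on k (ext \<delta>)"
      proof (rule inj_onI)
        fix x y assume xy: "x \<in> ext \<delta>" "y \<in> ext \<delta>" "k x = k y"
        have mx: "m x \<in> ext \<gamma>" "x \<in> ext (osucc (app f (m x)))"
          and my: "m y \<in> ext \<gamma>" "y \<in> ext (osucc (app f (m y)))" using m(2) xy by blast+
        have c: "g (m x) = g (m y)" "app (e (m x)) x = app (e (m y)) y"
          using code_inj[OF dfun1_in[OF g(1) ext_D[OF mx(1)]] app_in dfun1_in[OF g(1) ext_D[OF my(1)]] app_in
              xy(3)[unfolded k_def]] by blast+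
        have mm: "m x = m y" using inj_onD[OF g(2) c(1) mx(1) my(1)] .
        then show "x = y" using e(2)[OF mx(1)] c(2) mx(2) my(2) unfolding is_inj_def by metis
      qed
    qed
    then show False using d(2) by blast
  qed
  have lim: "\<exists>y\<in>ext \<delta>. E x y" if x: "x \<in> ext \<delta>" for x
  proof (rule bexI[OF _ succ[OF x]])
    have "x \<in> ext (osucc x)" using ext_D[OF x] by simp
    then show "E x (osucc x)" using ext_E by blast
  qed
  have ne: "ext \<delta> \<noteq> {}"
  proof
    assume "ext \<delta> = {}"
    then have "injects \<delta> B" by (intro injects_subset) simp
    then show False using d(2) by blast
  qed
  have card: "cardinal \<delta>" unfolding cardinal_def
  proof (intro conjI ballI)
    show "ordinal \<delta>" using d(1) unfolding Ord_def by blast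
    fix \<beta> assume b: "\<beta> \<in> ext \<delta>"
    show "\<not> equipotent \<beta> \<delta>"
    proof
      assume "equipotent \<beta> \<delta>"
      then have "injects \<delta> \<beta>" using equipotent_sym[OF ext_D[OF b] dD] equipotent_injects[OF dD] by blast
      then show False using d(2) d(3)[OF b] injects_trans by blast
    qed
  qed
  have idc: "\<exists>f\<in>D. cofinal_map f \<delta> \<delta>"
    by (rule cofinal_mapI[OF dfun1_id dD]) blast+
  have reg: "regular_cardinal \<delta>" unfolding regular_cardinal_def is_cof_def
    using card ne lim idc no_cof d(1) unfolding Ord_def by blast
  have inj: "injects a \<delta> \<and> \<not> injects \<delta> a"
  proof -
    obtain \<alpha> h where al: "Ord \<alpha>" "dfun1 h" "bij_betw h (ext \<alpha>) (ext a)" using well_ordering[OF aD] by blast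
    define s where "s t = mk {t}" for t
    have s: "dfun1 s" unfolding dfun1_def s_def by (intro dfn)
    have es: "ext (s t) = {t}" if "t \<in> D" for t unfolding s_def using that by simp
    have "injects a B"
    proof (rule injectsI[OF s])
      show "inj_on s (ext a)" using es ext_D by (metis inj_onI singleton_inject)
      show "s x \<in> ext B" if "x \<in> ext a" for x
        unfolding eB using es[OF ext_D[OF that]] dfun1_in[OF s ext_D[OF that]] that T(2) by auto
    qed
    then have na: "\<not> injects \<delta> a" and aB: "injects \<alpha> B" using bij_injects[OF al(2,3)] injects_trans d(2) by blast+
    have "\<alpha> \<in> ext \<delta>"
    proof (rule ccontr)
      assume "\<alpha> \<notin> ext \<delta>"
      then have "injects \<delta> \<alpha>" using Ord_not_mem[OF al(1) d(1)] by (intro injects_subset) blast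
      then show False using aB d(2) injects_trans by blast
    qed
    then have "injects \<alpha> \<delta>" using Ord_trans[OF d(1)] by (intro injects_subset) blast
    moreover have "injects a \<alpha>" using bij_inverse[OF al(2) Ord_in[OF al(1)] al(3)] bij_injects by blast
    ultimately show ?thesis using injects_trans na by blast
  qed
  show ?thesis using d(1) reg inj by blast
qed

section \<open>Complete ultrafilters and strong compactness\<close>

text \<open>If \<open>Q\<close> is not definable, the separated part of \<open>X\<close> may fail to
  be a set and \<open>mk\<close> falls back to the empty set; this is why most rules for
  \<open>ae\<close> carry definability premises.\<close>

definition ae :: "'a \<Rightarrow> 'a \<Rightarrow> ('a \<Rightarrow> bool) \<Rightarrow> bool" where
  "ae U X Q \<longleftrightarrow> mk {x \<in> ext X. Q x} \<in> ext U"

lemma ae_cong: "(\<And>x. x \<in> ext X \<Longrightarrow> Q x \<longleftrightarrow> R x) \<Longrightarrow> ae U X Q \<longleftrightarrow> ae U X R"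
  unfolding ae_def by (metis (mono_tags, lifting) Collect_cong)

lemma ext_sep: "X \<in> D \<Longrightarrow> definable (\<lambda>s. Q (s 0)) \<Longrightarrow> ext (mk {x \<in> ext X. Q x}) = {x \<in> ext X. Q x}"
  by (intro ext_mk isset_Collect isset_ext)

lemma cardinal_not_injects:
  assumes "Ord k" "cardinal k" "\<alpha> \<in> ext k" shows "\<not> injects k \<alpha>"
proof
  assume i: "injects k \<alpha>"
  have "injects \<alpha> k" using Ord_trans[OF assms(1,3)] by (intro injects_subset) blast
  then have "equipotent \<alpha> k" using injects_equipotent[OF ext_D[OF assms(3)] Ord_in[OF assms(1)]] i by blast
  then show False using assms(2,3) unfolding cardinal_def by blast
qed

lemma card_less_injects:
  assumes "Ord k" "cardinal k" "x \<in> D" "y \<in> D" "injects x y" "card_less y k" shows "card_less x k"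
  using assms card_less_iff injects_trans by meson

lemma card_less_subset:
  "Ord k \<Longrightarrow> cardinal k \<Longrightarrow> x \<in> D \<Longrightarrow> y \<in> D \<Longrightarrow> ext x \<subseteq> ext y \<Longrightarrow> card_less y k \<Longrightarrow> card_less x k"
  using card_less_injects injects_subset by blast

lemma card_less_image:
  "Ord k \<Longrightarrow> cardinal k \<Longrightarrow> x \<in> D \<Longrightarrow> dfun1 f \<Longrightarrow> card_less x k \<Longrightarrow> card_less (mk (f ` ext x)) k"
  using card_less_injects[OF _ _ mk_in _ injects_image] by blast

lemma card_less_elem:
  assumes "Ord k" "cardinal k" "\<alpha> \<in> ext k" shows "card_less \<alpha> k"
  using card_less_iff[OF assms(1,2) ext_D[OF assms(3)]] assms(3) injects_subset by blast

lemma card_less_not_subset: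
  assumes "Ord k" "cardinal k" "\<sigma> \<in> D" "card_less \<sigma> k" shows "\<not> ext k \<subseteq> ext \<sigma>"
proof
  assume "ext k \<subseteq> ext \<sigma>"
  moreover obtain \<mu> where "\<mu> \<in> ext k" "injects \<sigma> \<mu>" using card_less_iff[OF assms(1-3)] assms(4) by blast
  ultimately show False using injects_subset injects_trans cardinal_not_injects[OF assms(1,2)] by blast
qed

context
  fixes k U X
  assumes k: "Ord k" "cardinal k" and UX: "U \<in> D" "X \<in> D" and cuf: "complete_ultrafilter_over k U X"
begin

lemma uf: "ultrafilter_over U X"
  using cuf unfolding complete_ultrafilter_over_def by blast

lemma uf_subset: "A \<in> ext U \<Longrightarrow> ext A \<subseteq> ext X"
  using uf[unfolded ultrafilter_over_def, THEN conjunct1] by blast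

lemma uf_top: "X \<in> ext U"
  using uf[unfolded ultrafilter_over_def, THEN conjunct2, THEN conjunct1] by blast

lemma uf_nonempty: "A \<in> ext U \<Longrightarrow> ext A \<noteq> {}"
  using uf[unfolded ultrafilter_over_def, THEN conjunct2, THEN conjunct2, THEN conjunct1] by blast

lemma uf_up: "A \<in> ext U \<Longrightarrow> B \<in> D \<Longrightarrow> ext A \<subseteq> ext B \<Longrightarrow> ext B \<subseteq> ext X \<Longrightarrow> B \<in> ext U"
  using uf[unfolded ultrafilter_over_def, THEN conjunct2, THEN conjunct2, THEN conjunct2, THEN conjunct1] by blast

lemma uf_int: "A \<in> ext U \<Longrightarrow> B \<in> ext U \<Longrightarrow> \<exists>C\<in>ext U. ext C = ext A \<inter> ext B"
  using uf[unfolded ultrafilter_over_def, THEN conjunct2, THEN conjunct2, THEN conjunct2, THEN conjunct2, THEN conjunct1] by blast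

lemma uf_ultra: "A \<in> D \<Longrightarrow> ext A \<subseteq> ext X \<Longrightarrow> A \<in> ext U \<or> (\<exists>B\<in>ext U. ext B = ext X - ext A)"
  using uf[unfolded ultrafilter_over_def, THEN conjunct2, THEN conjunct2, THEN conjunct2, THEN conjunct2, THEN conjunct2] by blast

lemma ae_ex:
  assumes "definable (\<lambda>s. Q (s 0))" "ae U X Q" shows "\<exists>x\<in>ext X. Q x"
  using uf_nonempty[OF assms(2)[unfolded ae_def]] unfolding ext_sep[OF UX(2) assms(1)] by blast

lemma ae_mono:
  assumes "definable (\<lambda>s. Q (s 0))" "definable (\<lambda>s. R (s 0))" "ae U X Q"
    "\<And>x. x \<in> ext X \<Longrightarrow> Q x \<Longrightarrow> R x"
  shows "ae U X R"
  unfolding ae_def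
  by (rule uf_up[OF assms(3)[unfolded ae_def] mk_in])
    (use assms(4) in \<open>auto simp: ext_sep[OF UX(2) assms(1)] ext_sep[OF UX(2) assms(2)]\<close>)

lemma ae_True: "(\<And>x. x \<in> ext X \<Longrightarrow> Q x) \<Longrightarrow> ae U X Q"
proof -
  assume "\<And>x. x \<in> ext X \<Longrightarrow> Q x"
  then have "{x \<in> ext X. Q x} = ext X" by blast
  then show ?thesis unfolding ae_def using uf_top UX by simp
qed

lemma ae_conj:
  assumes "definable (\<lambda>s. Q (s 0))" "definable (\<lambda>s. R (s 0))" "ae U X Q" "ae U X R"
  shows "ae U X (\<lambda>x. Q x \<and> R x)"
proof -
  obtain C where C: "C \<in> ext U" "ext C = {x \<in> ext X. Q x} \<inter> {x \<in> ext X. R x}"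
    using uf_int[OF assms(3)[unfolded ae_def] assms(4)[unfolded ae_def]]
    unfolding ext_sep[OF UX(2) assms(1)] ext_sep[OF UX(2) assms(2)] by blast
  have "{x \<in> ext X. Q x \<and> R x} = ext C" unfolding C(2) by blast
  then show ?thesis unfolding ae_def using C(1) mk_ext[OF ext_D[OF C(1)]] by simp
qed

lemma ae_not:
  assumes "definable (\<lambda>s. Q (s 0))" shows "ae U X (\<lambda>x. \<not> Q x) \<longleftrightarrow> \<not> ae U X Q"
proof
  assume n: "ae U X (\<lambda>x. \<not> Q x)"
  show "\<not> ae U X Q"
  proof
    assume "ae U X Q"
    from ae_conj[OF assms definable_neg[OF assms] this n] have "ae U X (\<lambda>x. Q x \<and> \<not> Q x)" .
    moreover have "definable (\<lambda>s. Q (s 0) \<and> \<not> Q (s 0))" by (intro definable_conj definable_neg assms)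
    ultimately show False using ae_ex[of "\<lambda>x. Q x \<and> \<not> Q x"] by blast
  qed
next
  assume n: "\<not> ae U X Q"
  have e: "ext (mk {x \<in> ext X. Q x}) = {x \<in> ext X. Q x}" by (rule ext_sep[OF UX(2) assms])
  then obtain B where B: "B \<in> ext U" "ext B = ext X - {x \<in> ext X. Q x}"
    using uf_ultra[of "mk {x \<in> ext X. Q x}"] n unfolding ae_def by auto
  have "{x \<in> ext X. \<not> Q x} = ext B" unfolding B(2) by blast
  then show "ae U X (\<lambda>x. \<not> Q x)" unfolding ae_def using B(1) mk_ext[OF ext_D[OF B(1)]] by simp
qed

text \<open>Completeness as a rule for bounded quantifiers: Replacement collects the sets
  \<open>g i\<close> into a family of cardinality less than \<open>k\<close>. An empty index set is
  treated apart because completeness is defined for nonempty families.\<close>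

lemma ae_ball:
  assumes R: "drel2 R" and a: "a \<in> D" "card_less a k" and all: "\<And>i. i \<in> ext a \<Longrightarrow> ae U X (R i)"
  shows "ae U X (\<lambda>x. \<forall>i\<in>ext a. R i x)"
proof (cases "ext a = {}")
  case True then show ?thesis by (intro ae_True) simp
next
  case False
  define g where "g i = mk {x \<in> ext X. R i x}" for i
  have g: "dfun1 g" unfolding dfun1_def g_def by (intro dfn UX drel2D[OF R])
  have eg: "ext (g i) = {x \<in> ext X. R i x}" if "i \<in> ext a" for i
    unfolding g_def by (intro ext_sep UX dfn drel2D[OF R] ext_D[OF that])
  have eF: "ext (mk (g ` ext a)) = g ` ext a" by (intro ext_mk isset_image g isset_ext a(1))
  have F: "ext (mk (g ` ext a)) \<noteq> {} \<and> ext (mk (g ` ext a)) \<subseteq> ext U \<and> card_less (mk (g ` ext a)) k"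
  proof (intro conjI card_less_image k a g)
    show "ext (mk (g ` ext a)) \<subseteq> ext U" unfolding eF using all unfolding ae_def g_def by blast
    show "ext (mk (g ` ext a)) \<noteq> {}" unfolding eF using False by simp
  qed
  have "\<forall>F\<in>D. ext F \<noteq> {} \<and> ext F \<subseteq> ext U \<and> card_less F k \<longrightarrow> (\<exists>B\<in>ext U. ext B = (\<Inter>A\<in>ext F. ext A))"
    using cuf unfolding complete_ultrafilter_over_def by blast
  from bspec[OF this mk_in, THEN mp, OF F] obtain B where
    B: "B \<in> ext U" "ext B = (\<Inter>A\<in>ext (mk (g ` ext a)). ext A)" by blast
  have "{x \<in> ext X. \<forall>i\<in>ext a. R i x} = ext B" unfolding B(2) eF using eg False by auto
  then show ?thesis unfolding ae_def using B(1) mk_ext[OF ext_D[OF B(1)]] by simp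
qed

section \<open>Images of ultrafilters under maps (Rudin-Keisler projections)\<close>

context
  fixes f Y
  assumes f: "dfun1 f" and Y: "Y \<in> D" and fXY: "\<And>x. x \<in> ext X \<Longrightarrow> f x \<in> ext Y"
begin

definition push :: 'a where
  "push = mk {B \<in> {B \<in> D. ext B \<subseteq> ext Y}. ae U X (\<lambda>x. f x \<in> ext B)}"

lemma ext_push: "ext push = {B \<in> {B \<in> D. ext B \<subseteq> ext Y}. ae U X (\<lambda>x. f x \<in> ext B)}"
  unfolding push_def ae_def by (intro ext_mk isset_Collect isset_Pow isset_ext Y dfn dfun1D[OF f] UX)

lemma push_mem: "B \<in> ext push \<longleftrightarrow> B \<in> D \<and> ext B \<subseteq> ext Y \<and> ae U X (\<lambda>x. f x \<in> ext B)"
  unfolding ext_push by blast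

lemma push_in: "push \<in> D"
  unfolding push_def by simp

lemma ae_push:
  assumes "definable (\<lambda>s. Q (s 0))" shows "ae push Y Q \<longleftrightarrow> ae U X (\<lambda>x. Q (f x))"
proof -
  have e: "ext (mk {y \<in> ext Y. Q y}) = {y \<in> ext Y. Q y}" by (rule ext_sep[OF Y assms])
  have "ae push Y Q \<longleftrightarrow> ae U X (\<lambda>x. f x \<in> {y \<in> ext Y. Q y})"
    unfolding ae_def[of push] push_mem e by auto
  also have "\<dots> \<longleftrightarrow> ae U X (\<lambda>x. Q (f x))" using fXY by (intro ae_cong) blast
  finally show ?thesis .
qed

lemma dfn_push_mem: "B \<in> D \<Longrightarrow> definable (\<lambda>s. f (s 0) \<in> ext B)"
  by (intro dfn dfun1D[OF f])

lemma push_complete: "complete_ultrafilter_over k push Y"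
  unfolding complete_ultrafilter_over_def ultrafilter_over_def
proof (intro conjI ballI impI)
  show "ext A \<subseteq> ext Y" if "A \<in> ext push" for A using that push_mem by blast
  show "Y \<in> ext push" unfolding push_mem using Y fXY by (auto intro: ae_True)
  show "ext A \<noteq> {}" if A: "A \<in> ext push" for A
    using ae_ex[OF dfn_push_mem] A unfolding push_mem by blast
  show "B \<in> ext push" if A: "A \<in> ext push" and B: "B \<in> D" "ext A \<subseteq> ext B \<and> ext B \<subseteq> ext Y" for A B
  proof -
    have A': "A \<in> D" "ae U X (\<lambda>x. f x \<in> ext A)" using A unfolding push_mem by blast+
    have "ae U X (\<lambda>x. f x \<in> ext B)"
      using B(2) by (intro ae_mono[OF dfn_push_mem[OF A'(1)] dfn_push_mem[OF B(1)] A'(2)]) blast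
    then show ?thesis unfolding push_mem using B by blast
  qed
  show "\<exists>C\<in>ext push. ext C = ext A \<inter> ext B" if A: "A \<in> ext push" and B: "B \<in> ext push" for A B
  proof -
    have A': "A \<in> D" "ae U X (\<lambda>x. f x \<in> ext A)" "ext A \<subseteq> ext Y" using A unfolding push_mem by blast+
    have B': "B \<in> D" "ae U X (\<lambda>x. f x \<in> ext B)" using B unfolding push_mem by blast+
    have e: "ext (mk (ext A \<inter> ext B)) = ext A \<inter> ext B" by (intro ext_mk isset_Int isset_ext A' B')
    have "ae U X (\<lambda>x. f x \<in> ext A \<and> f x \<in> ext B)"
      by (rule ae_conj[OF dfn_push_mem[OF A'(1)] dfn_push_mem[OF B'(1)] A'(2) B'(2)])
    then have "mk (ext A \<inter> ext B) \<in> ext push" unfolding push_mem e using A'(3) by auto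
    then show ?thesis using e by blast
  qed
  show "A \<in> ext push \<or> (\<exists>B\<in>ext push. ext B = ext Y - ext A)" if A: "A \<in> D" "ext A \<subseteq> ext Y" for A
  proof (cases "A \<in> ext push")
    case False
    then have "ae U X (\<lambda>x. f x \<notin> ext A)" unfolding push_mem using A ae_not[OF dfn_push_mem[OF A(1)]] by blast
    moreover have e: "ext (mk (ext Y - ext A)) = ext Y - ext A" by (intro ext_mk isset_Diff isset_ext A Y)
    ultimately have "ae U X (\<lambda>x. f x \<in> ext (mk (ext Y - ext A)))"
      unfolding e using fXY ae_cong[of X "\<lambda>x. f x \<notin> ext A" "\<lambda>x. f x \<in> ext Y - ext A"] by blast
    then have "mk (ext Y - ext A) \<in> ext push" unfolding push_mem e by auto
    then show ?thesis using e by blast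
  qed blast
  fix F assume F: "F \<in> D" and FF: "ext F \<noteq> {} \<and> ext F \<subseteq> ext push \<and> card_less F k"
  have "ae U X (\<lambda>x. \<forall>i\<in>ext F. f x \<in> ext i)"
  proof (rule ae_ball[of "\<lambda>i x. f x \<in> ext i", OF _ F])
    show "drel2 (\<lambda>i x. f x \<in> ext i)" unfolding drel2_def by (intro dfn dfun1D[OF f])
    show "card_less F k" using FF by blast
    show "ae U X (\<lambda>x. f x \<in> ext i)" if "i \<in> ext F" for i using that FF push_mem by blast
  qed
  moreover have i: "isset {y \<in> ext Y. \<forall>A\<in>ext F. y \<in> ext A}" by (intro isset_Collect isset_ext Y dfn F)
  moreover have e: "(\<Inter>A\<in>ext F. ext A) = {y \<in> ext Y. \<forall>A\<in>ext F. y \<in> ext A}"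
  proof -
    have "ext A \<subseteq> ext Y" if "A \<in> ext F" for A using that FF push_mem by blast
    moreover obtain A where "A \<in> ext F" using FF by blast
    ultimately show ?thesis by blast
  qed
  moreover have "ae U X (\<lambda>x. \<forall>i\<in>ext F. f x \<in> ext i) \<longleftrightarrow>
    ae U X (\<lambda>x. f x \<in> {y \<in> ext Y. \<forall>A\<in>ext F. y \<in> ext A})" using fXY by (intro ae_cong) blast
  ultimately have "mk {y \<in> ext Y. \<forall>A\<in>ext F. y \<in> ext A} \<in> ext push"
    unfolding push_mem ext_mk[OF i] by auto
  then show "\<exists>B\<in>ext push. ext B = (\<Inter>A\<in>ext F. ext A)" unfolding e using ext_mk[OF i] by blast
qed

lemma pushforward:
  "\<exists>W\<in>D. complete_ultrafilter_over k W Y \<and>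
    (\<forall>Q. definable (\<lambda>s. Q (s 0)) \<longrightarrow> ae W Y Q = ae U X (\<lambda>x. Q (f x)))"
  using push_in push_complete ae_push by blast

end

end

section \<open>Fine ultrafilters over sets of small subsets\<close>

definition Pk :: "'a \<Rightarrow> 'a \<Rightarrow> 'a" where
  "Pk k a = mk {\<sigma> \<in> {\<sigma> \<in> D. ext \<sigma> \<subseteq> ext a}. card_less \<sigma> k}"

lemma ext_Pk:
  assumes "k \<in> D" "a \<in> D" shows "ext (Pk k a) = {\<sigma> \<in> {\<sigma> \<in> D. ext \<sigma> \<subseteq> ext a}. card_less \<sigma> k}"
  unfolding Pk_def by (intro ext_mk isset_Collect isset_Pow isset_ext assms dfn)

lemma Pk_in [simp]: "Pk k a \<in> D"
  unfolding Pk_def by simp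

lemma is_Pk_iff: "k \<in> D \<Longrightarrow> a \<in> D \<Longrightarrow> X \<in> D \<Longrightarrow> is_Pk k a X \<longleftrightarrow> X = Pk k a"
  unfolding is_Pk_def using extensionality[of X "Pk k a"] ext_Pk[of k a] by auto

lemma fine_iff:
  assumes "X \<in> D"
  shows "fine l U X \<longleftrightarrow> (\<forall>\<alpha>\<in>ext l. ae U X (\<lambda>\<sigma>. E \<alpha> \<sigma>))"
proof -
  have "(\<exists>A\<in>ext U. ext A = {\<sigma> \<in> ext X. \<alpha> \<in> ext \<sigma>}) \<longleftrightarrow> ae U X (\<lambda>\<sigma>. E \<alpha> \<sigma>)" if a: "\<alpha> \<in> ext l" for \<alpha>
  proof -
    have "definable (\<lambda>s. E \<alpha> (s 0))" by (intro dfn ext_D[OF a])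
    then have e: "ext (mk {\<sigma> \<in> ext X. E \<alpha> \<sigma>}) = {\<sigma> \<in> ext X. E \<alpha> \<sigma>}" using ext_sep[OF assms] by blast
    have "{\<sigma> \<in> ext X. \<alpha> \<in> ext \<sigma>} = {\<sigma> \<in> ext X. E \<alpha> \<sigma>}" using ext_E ext_D[OF a] by blast
    then show ?thesis unfolding ae_def using e mk_ext ext_D by metis
  qed
  then show ?thesis unfolding fine_def by blast
qed

context
  fixes k
  assumes kD: "k \<in> D" and sc: "strongly_compact k"
begin

lemma sc_cardinal: "cardinal k"
  using sc unfolding strongly_compact_def by blast

lemma sc_Ord: "Ord k"
  using sc_cardinal kD unfolding cardinal_def Ord_def by blast

lemma sc_fine:
  assumes "l \<in> D" "cardinal l" "l = k \<or> k \<in> ext l"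
  shows "\<exists>U\<in>D. complete_ultrafilter_over k U (Pk k l) \<and> (\<forall>\<alpha>\<in>ext l. ae U (Pk k l) (\<lambda>\<sigma>. E \<alpha> \<sigma>))"
proof -
  have "l = k \<or> E k l" using assms(3) ext_E by blast
  then obtain X U where XU: "X \<in> D" "U \<in> D" "is_Pk k l X" "complete_ultrafilter_over k U X" "fine l U X"
    using sc assms unfolding strongly_compact_def by blast
  have "X = Pk k l" using XU is_Pk_iff kD assms(1) by blast
  then show ?thesis using XU fine_iff by blast
qed

text \<open>If \<open>k\<close> were a successor or a union of fewer than \<open>k\<close> smaller
  ordinals, fineness and completeness would put all of \<open>k\<close> into almost every
  \<open>\<sigma>\<close>, although \<open>\<sigma>\<close> has cardinality less than
  \<open>k\<close>.\<close>

lemma sc_structure: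
  shows sc_Lim: "Lim k"
    and sc_regular: "\<gamma> \<in> ext k \<Longrightarrow> dfun1 h \<Longrightarrow> (\<And>u. u \<in> ext \<gamma> \<Longrightarrow> h u \<in> ext k) \<Longrightarrow>
      \<exists>x\<in>ext k. \<forall>u\<in>ext \<gamma>. h u \<in> ext x"
proof -
  note k = sc_Ord sc_cardinal
  obtain U where U: "U \<in> D" "complete_ultrafilter_over k U (Pk k k)"
    and fine: "\<And>\<alpha>. \<alpha> \<in> ext k \<Longrightarrow> ae U (Pk k k) (\<lambda>\<sigma>. E \<alpha> \<sigma>)"
    using sc_fine[OF kD sc_cardinal] by blast
  note UP = k U(1) Pk_in U(2)
  have d1: "definable (\<lambda>s. \<forall>\<beta>\<in>ext \<alpha>. E \<beta> (s 0))" if "\<alpha> \<in> D" for \<alpha> by (intro dfn that)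
  have init: "ae U (Pk k k) (\<lambda>\<sigma>. \<forall>\<beta>\<in>ext \<alpha>. E \<beta> \<sigma>)" if a: "\<alpha> \<in> ext k" for \<alpha>
  proof (rule ae_ball[OF UP _ ext_D[OF a] card_less_elem[OF k a]])
    show "drel2 E" unfolding drel2_def by (intro dfn)
    show "ae U (Pk k k) (E i)" if "i \<in> ext \<alpha>" for i using fine Ord_trans[OF k(1) a that] by blast
  qed
  have no: "\<not> ae U (Pk k k) (\<lambda>\<sigma>. \<forall>\<beta>\<in>ext k. E \<beta> \<sigma>)"
  proof
    assume "ae U (Pk k k) (\<lambda>\<sigma>. \<forall>\<beta>\<in>ext k. E \<beta> \<sigma>)"
    from ae_ex[OF UP d1[OF kD] this] obtain \<sigma> where s: "\<sigma> \<in> ext (Pk k k)" "\<forall>\<beta>\<in>ext k. E \<beta> \<sigma>" by blast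
    then have "\<sigma> \<in> D" "card_less \<sigma> k" "ext k \<subseteq> ext \<sigma>" unfolding ext_Pk[OF kD kD] using ext_E ext_D by blast+
    then show False using card_less_not_subset[OF k] by blast
  qed
  \<comment> \<open>Excludes \<open>k = 0\<close>: the space \<open>Pk k k\<close> has a point, and
    the cardinality of that point is an element of \<open>k\<close>.\<close>
  have "definable (\<lambda>s. True)" by (intro dfn)
  from ae_ex[of _ _ _ "\<lambda>_. True", OF UP this ae_True[OF UP]] obtain \<sigma> where "\<sigma> \<in> ext (Pk k k)" by blast
  then have "card_less \<sigma> k" unfolding ext_Pk[OF kD kD] by blast
  then have "ext k \<noteq> {}" unfolding card_less_def by blast
  then have zero: "mk {} \<in> ext k" by (rule Ord_empty_mem[OF k(1)])
  have succ: "osucc x \<in> ext k" if x: "x \<in> ext k" for x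
  proof (rule ccontr)
    assume "osucc x \<notin> ext k"
    then have "k = osucc x" using osucc_mem[OF k(1) x] by blast
    then have ek: "ext k = insert x (ext x)" using ext_osucc[OF ext_D[OF x]] by simp
    have dx: "definable (\<lambda>s. E x (s 0))" by (intro dfn ext_D[OF x])
    have "ae U (Pk k k) (\<lambda>\<sigma>. E x \<sigma> \<and> (\<forall>\<beta>\<in>ext x. E \<beta> \<sigma>))"
      by (rule ae_conj[OF UP dx d1[OF ext_D[OF x]] fine[OF x] init[OF x]])
    then show False using no unfolding ek by simp
  qed
  show "Lim k" unfolding Lim_def using k zero succ by blast
  assume g: "\<gamma> \<in> ext k" and h: "dfun1 h" and hk: "\<And>u. u \<in> ext \<gamma> \<Longrightarrow> h u \<in> ext k"
  show "\<exists>x\<in>ext k. \<forall>u\<in>ext \<gamma>. h u \<in> ext x"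
  proof (rule ccontr)
    assume "\<not> ?thesis"
    then have unb: "\<And>x. x \<in> ext k \<Longrightarrow> \<exists>u\<in>ext \<gamma>. h u \<notin> ext x" by blast
    have r: "drel2 (\<lambda>u \<sigma>. \<forall>\<beta>\<in>ext (h u). E \<beta> \<sigma>)" unfolding drel2_def by (intro dfn dfun1D[OF h])
    have "ae U (Pk k k) (\<lambda>\<sigma>. \<forall>u\<in>ext \<gamma>. \<forall>\<beta>\<in>ext (h u). E \<beta> \<sigma>)"
      by (rule ae_ball[OF UP r ext_D[OF g] card_less_elem[OF k g]]) (rule init[OF hk])
    moreover have "definable (\<lambda>s. \<forall>u\<in>ext \<gamma>. \<forall>\<beta>\<in>ext (h u). E \<beta> (s 0))"
      by (intro dfn dfun1D[OF h] ext_D[OF g])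
    moreover have "\<exists>u\<in>ext \<gamma>. y \<in> ext (h u)" if y: "y \<in> ext k" for y
    proof -
      obtain u where u: "u \<in> ext \<gamma>" "h u \<notin> ext (osucc y)" using unb[OF succ[OF y]] by blast
      have "ext (osucc y) \<subseteq> ext (h u)"
        using Ord_not_mem[OF Ord_elem[OF k(1) hk[OF u(1)]] Ord_osucc[OF Ord_elem[OF k(1) y]]] u(2) by blast
      then show ?thesis using u(1) ext_osucc[OF ext_D[OF y]] by blast
    qed
    ultimately have "ae U (Pk k k) (\<lambda>\<sigma>. \<forall>\<beta>\<in>ext k. E \<beta> \<sigma>)"
      by (intro ae_mono[OF UP _ d1[OF kD], of "\<lambda>\<sigma>. \<forall>u\<in>ext \<gamma>. \<forall>\<beta>\<in>ext (h u). E \<beta> \<sigma>"]) blast+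
    then show False using no by blast
  qed
qed

text \<open>Strong compactness speaks of cardinals from \<open>k\<close> on. Adding \<open>k\<close>
  to \<open>a\<close> ensures a cardinality \<open>l\<close> of that kind, and taking preimages
  under an injection \<open>e\<close> into \<open>l\<close> carries the fine ultrafilter to
  \<open>Pk k a\<close>.\<close>

theorem fine_exists:
  assumes aD: "a \<in> D"
  shows "\<exists>U\<in>D. complete_ultrafilter_over k U (Pk k a) \<and> (\<forall>x\<in>ext a. ae U (Pk k a) (\<lambda>\<sigma>. E x \<sigma>))"
proof -
  note k = sc_Ord sc_cardinal
  define b where "b = mk (ext a \<union> ext k)"
  have bD: "b \<in> D" unfolding b_def by simp
  have eb: "ext b = ext a \<union> ext k" unfolding b_def by (intro ext_mk isset_Un isset_ext aD kD)
  obtain l where l: "Ord l" "cardinal l" "equipotent b l" using cardinality[OF bD] by blast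
  have lD: "l \<in> D" using l(1) by simp
  have "injects b l" using equipotent_injects[OF bD l(3)] .
  then have "injects k l" using injects_trans[OF injects_subset[of k b]] eb by blast
  then have "l \<notin> ext k" using cardinal_not_injects[OF k] by blast
  then have kl: "l = k \<or> k \<in> ext l" using Ord_linear[OF k(1) l(1)] by blast
  obtain U where U: "U \<in> D" "complete_ultrafilter_over k U (Pk k l)"
    and fine: "\<And>\<alpha>. \<alpha> \<in> ext l \<Longrightarrow> ae U (Pk k l) (\<lambda>\<sigma>. E \<alpha> \<sigma>)"
    using sc_fine[OF lD l(2) kl] by blast
  note UP = k U(1) Pk_in U(2)
  obtain e where e: "dfun1 e" "inj_on e (ext b)" "e ` ext b \<subseteq> ext l"
    using \<open>injects b l\<close> unfolding injects_def by blast
  define f where "f \<sigma> = mk {x \<in> ext a. e x \<in> ext \<sigma>}" for \<sigma>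
  have f: "dfun1 f" unfolding dfun1_def f_def by (intro dfn dfun1D[OF e(1)] aD)
  have ef: "ext (f \<sigma>) = {x \<in> ext a. e x \<in> ext \<sigma>}" if "\<sigma> \<in> D" for \<sigma>
    unfolding f_def by (intro ext_sep aD dfn dfun1D[OF e(1)] that)
  have fP: "f \<sigma> \<in> ext (Pk k a)" if s: "\<sigma> \<in> ext (Pk k l)" for \<sigma>
  proof -
    have sD: "\<sigma> \<in> D" and c: "card_less \<sigma> k" using s unfolding ext_Pk[OF kD lD] by blast+
    have "injects (f \<sigma>) \<sigma>"
    proof (rule injectsI[OF e(1)])
      show "inj_on e (ext (f \<sigma>))"
        by (rule inj_on_subset[OF e(2)]) (auto simp: ef[OF sD] eb)
      show "e x \<in> ext \<sigma>" if "x \<in> ext (f \<sigma>)" for x using that unfolding ef[OF sD] by blast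
    qed
    then have "card_less (f \<sigma>) k" using card_less_injects[OF k dfun1_in[OF f sD] sD _ c] by blast
    then show ?thesis unfolding ext_Pk[OF kD aD] using dfun1_in[OF f sD] ef[OF sD] by blast
  qed
  obtain W where W: "W \<in> D" "complete_ultrafilter_over k W (Pk k a)"
    and aeW: "\<And>Q. definable (\<lambda>s. Q (s 0)) \<Longrightarrow> ae W (Pk k a) Q = ae U (Pk k l) (\<lambda>x. Q (f x))"
    using pushforward[OF UP f Pk_in fP] by blast
  have "ae W (Pk k a) (\<lambda>\<sigma>. E x \<sigma>)" if x: "x \<in> ext a" for x
  proof -
    have xD: "x \<in> D" using ext_D[OF x] .
    have "e x \<in> ext l" using e(3) x eb by blast
    then have 1: "ae U (Pk k l) (\<lambda>\<sigma>. E (e x) \<sigma>)" by (rule fine)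
    have 2: "E (e x) \<sigma> \<longleftrightarrow> E x (f \<sigma>)" if "\<sigma> \<in> ext (Pk k l)" for \<sigma>
      using ef[OF ext_D[OF that]] x xD ext_E dfun1_in[OF e(1) xD] by blast
    have "ae U (Pk k l) (\<lambda>\<sigma>. E x (f \<sigma>))"
    proof -
      have "ae U (Pk k l) (\<lambda>\<sigma>. E (e x) \<sigma>) \<longleftrightarrow> ae U (Pk k l) (\<lambda>\<sigma>. E x (f \<sigma>))"
        by (rule ae_cong) (rule 2)
      then show ?thesis using 1 by blast
    qed
    moreover have "definable (\<lambda>s. E x (s 0))" by (intro dfn xD)
    ultimately show ?thesis using aeW[of "\<lambda>\<sigma>. E x \<sigma>"] by blast
  qed
  then show ?thesis using W by blast
qed

end

section \<open>A weakly normal ultrafilter\<close>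

text \<open>This is the model's own \<open>\<omega>\<close>, possibly nonstandard; induction along
  it is induction inside the model, and the last clause provides its zero and successor
  cases.\<close>

lemma Lim_least: "\<exists>\<omega>. Lim \<omega> \<and> (\<forall>\<theta>. Lim \<theta> \<longrightarrow> \<omega> = \<theta> \<or> \<omega> \<in> ext \<theta>) \<and>
  (\<forall>n\<in>ext \<omega>. n = mk {} \<or> (\<exists>m\<in>ext n. n = osucc m))"
proof -
  have d: "definable (\<lambda>s. Lim (s 0))" by (intro dfn)
  obtain \<theta>0 where t0: "Lim \<theta>0" using Lim_exists by blast
  then have "Ord \<theta>0" unfolding Lim_def by blast
  from Ord_least[OF d this t0] obtain \<omega> where w: "Ord \<omega>" "Lim \<omega>" "\<And>\<gamma>. \<gamma> \<in> ext \<omega> \<Longrightarrow> \<not> Lim \<gamma>" by blast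
  have "\<omega> = \<theta> \<or> \<omega> \<in> ext \<theta>" if "Lim \<theta>" for \<theta>
    using that w Ord_linear[of \<omega> \<theta>] unfolding Lim_def by blast
  moreover have "n = mk {} \<or> (\<exists>m\<in>ext n. n = osucc m)" if n: "n \<in> ext \<omega>" for n
  proof (cases "ext n = {}")
    case True
    then show ?thesis using mk_ext[OF ext_D[OF n]] by simp
  next
    case False
    have on: "Ord n" using Ord_elem[OF w(1) n] .
    then obtain m where "m \<in> ext n" "osucc m \<notin> ext n" using w(3)[OF n] Ord_empty_mem[OF on False] unfolding Lim_def by blast
    then show ?thesis using osucc_mem[OF on] by metis
  qed
  ultimately show ?thesis using w(2) by blast
qed

context
  fixes k \<delta>
  assumes kD: "k \<in> D" and sc: "strongly_compact k" and d: "Ord \<delta>" "ext \<delta> \<noteq> {}"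
    and cof: "\<And>\<gamma> f. \<gamma> \<in> ext k \<Longrightarrow> f \<in> D \<Longrightarrow> \<not> cofinal_map f \<gamma> \<delta>"
begin

lemma small_unbounded:
  assumes "\<sigma> \<in> D" "card_less \<sigma> k" "ext \<sigma> \<subseteq> ext \<xi>" "Ord \<xi>"
    "\<And>\<beta>. \<beta> \<in> ext \<xi> \<Longrightarrow> \<exists>\<gamma>\<in>ext \<sigma>. \<beta> = \<gamma> \<or> \<beta> \<in> ext \<gamma>"
  shows "\<exists>\<mu>\<in>ext k. \<exists>f\<in>D. cofinal_map f \<mu> \<xi>"
proof -
  obtain \<mu> where m: "\<mu> \<in> ext k" "equipotent \<sigma> \<mu>" using assms(2) unfolding card_less_def by blast
  have mD: "\<mu> \<in> D" using ext_D[OF m(1)] .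
  obtain h where h: "dfun1 h" "bij_betw h (ext \<mu>) (ext \<sigma>)"
    using equipotent_sym[OF assms(1) mD m(2)] equipotent_iff[OF mD] by blast
  have img: "h ` ext \<mu> = ext \<sigma>" using bij_betw_imp_surj_on[OF h(2)] .
  have "\<exists>f\<in>D. cofinal_map f \<mu> \<xi>"
  proof (rule cofinal_mapI[OF h(1) mD])
    show "h u \<in> ext \<xi>" if "u \<in> ext \<mu>" for u using that img assms(3) by blast
    show "\<exists>u\<in>ext \<mu>. x = h u \<or> x \<in> ext (h u)" if "x \<in> ext \<xi>" for x
      using assms(5)[OF that] unfolding img[symmetric] by blast
  qed
  then show ?thesis using m(1) by blast
qed

text \<open>An element of \<open>\<sigma>\<close> that is not below \<open>\<beta>\<close> is at
  least \<open>\<beta>\<close>, so a small set without strict bound would be cofinal and yield a map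
  that the cofinality assumption excludes.\<close>

lemma small_strict_bound:
  assumes "\<sigma> \<in> D" "card_less \<sigma> k" "ext \<sigma> \<subseteq> ext \<delta>"
  shows "\<exists>x\<in>ext \<delta>. ext \<sigma> \<subseteq> ext x"
proof (rule ccontr)
  assume n: "\<not> ?thesis"
  have "\<exists>\<gamma>\<in>ext \<sigma>. \<beta> = \<gamma> \<or> \<beta> \<in> ext \<gamma>" if b: "\<beta> \<in> ext \<delta>" for \<beta>
  proof -
    obtain \<gamma> where g: "\<gamma> \<in> ext \<sigma>" "\<gamma> \<notin> ext \<beta>" using n b by blast
    then show ?thesis using Ord_linear[OF Ord_elem[OF d(1) b] Ord_elem[OF d(1)]] assms(3) by blast
  qed
  then show False using small_unbounded[OF assms d(1)] cof by blast
qed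

text \<open>In ultrapower terms, \<open>g\<close> represents the supremum of the image of \<open>\<delta>\<close>; it exists because
  countable completeness makes the ultrapower well-founded.\<close>

lemma minimal_unbounded_function:
  assumes U: "U \<in> D" "complete_ultrafilter_over k U (Pk k \<delta>)"
    and fine: "\<And>x. x \<in> ext \<delta> \<Longrightarrow> ae U (Pk k \<delta>) (\<lambda>\<sigma>. E x \<sigma>)"
    and \<theta>: "\<theta> \<in> ext k" "Lim \<theta>"
  shows "\<exists>g. dfun1 g \<and> (\<forall>\<sigma>\<in>ext (Pk k \<delta>). g \<sigma> \<in> ext \<delta>) \<and>
    (\<forall>\<alpha>\<in>ext \<delta>. ae U (Pk k \<delta>) (\<lambda>\<sigma>. \<alpha> \<in> ext (g \<sigma>))) \<and>
    (\<forall>h. dfun1 h \<longrightarrow> (\<forall>\<sigma>\<in>ext (Pk k \<delta>). h \<sigma> \<in> ext \<delta>) \<longrightarrow> ae U (Pk k \<delta>) (\<lambda>\<sigma>. h \<sigma> \<in> ext (g \<sigma>)) \<longrightarrow>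
      (\<exists>\<alpha>\<in>ext \<delta>. ae U (Pk k \<delta>) (\<lambda>\<sigma>. \<alpha> \<notin> ext (h \<sigma>))))"
proof -
  define X where "X = Pk k \<delta>"
  have XD: "X \<in> D" unfolding X_def by simp
  have dD: "\<delta> \<in> D" using d(1) by simp
  note k = sc_Ord[OF kD sc] sc_cardinal[OF kD sc]
  note UX = k U(1) XD U(2)[folded X_def]
  note XU = XD U(1)
  have eX: "\<sigma> \<in> D \<and> ext \<sigma> \<subseteq> ext \<delta> \<and> card_less \<sigma> k" if "\<sigma> \<in> ext X" for \<sigma>
    using that unfolding X_def ext_Pk[OF kD dD] by blast
  \<comment> \<open>Completeness will be applied to families indexed by \<open>\<omega>\<close>; the
    limit ordinal \<open>\<theta>\<close> below \<open>k\<close> places \<open>\<omega>\<close>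
    below \<open>k\<close>.\<close>
  obtain \<omega> where w: "Lim \<omega>" "\<omega> = \<theta> \<or> \<omega> \<in> ext \<theta>"
    and fin: "\<And>n. n \<in> ext \<omega> \<Longrightarrow> n = mk {} \<or> (\<exists>m\<in>ext n. n = osucc m)"
    using Lim_least \<theta>(2) by blast
  have wk: "\<omega> \<in> ext k" using w(2) \<theta>(1) Ord_trans[OF k(1) \<theta>(1)] by blast
  have ow: "Ord \<omega>" and w0: "mk {} \<in> ext \<omega>" and ws: "\<And>n. n \<in> ext \<omega> \<Longrightarrow> osucc n \<in> ext \<omega>"
    using w(1) unfolding Lim_def by blast+
  have wD: "\<omega> \<in> D" using ow by simp
  \<comment> \<open>The union \<open>Q\<close> of these fibres is the product of \<open>X\<close>
    and \<open>\<delta>\<close>. It bounds the functions under consideration, so that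
    \<open>N\<close> is a set and choice applies to it.\<close>
  define pr where "pr x = mk ((\<lambda>y. opair x y) ` ext \<delta>)" for x
  have pr: "dfun1 pr" unfolding dfun1_def pr_def by (intro dfn dD)
  have epr: "ext (pr x) = (\<lambda>y. opair x y) ` ext \<delta>" if "x \<in> D" for x
  proof -
    have "dfun1 (\<lambda>y. opair x y)" unfolding dfun1_def using that by (intro dfn)
    then show ?thesis unfolding pr_def by (intro ext_mk isset_image isset_ext dD)
  qed
  define Q where "Q = (\<Union>x\<in>ext X. ext (pr x))"
  have Q: "isset Q" unfolding Q_def by (intro isset_UN isset_ext XD pr)
  \<comment> \<open>Up to \<open>U\<close>, these are the functions above all constants below
    \<open>\<delta>\<close>.\<close>
  define un where "un f \<longleftrightarrow> (\<forall>\<alpha>\<in>ext \<delta>. ae U X (\<lambda>\<sigma>. \<alpha> \<in> ext (app f \<sigma>)))" for f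
  have un: "drel1 un" unfolding drel1_def un_def ae_def by (intro dfn XU dD)
  define N where "N = {f \<in> {f \<in> D. ext f \<subseteq> Q}. (\<forall>x\<in>ext X. app f x \<in> ext \<delta>) \<and> un f}"
  have N: "isset N" unfolding N_def by (intro isset_Collect isset_Pow Q dfn XU dD drel1D[OF un])
  have ND: "f \<in> D" "\<And>x. x \<in> ext X \<Longrightarrow> app f x \<in> ext \<delta>" "un f" if "f \<in> N" for f
    using that unfolding N_def by blast+
  have lamN: "lam X h \<in> N" if h: "dfun1 h" "\<And>\<sigma>. \<sigma> \<in> ext X \<Longrightarrow> h \<sigma> \<in> ext \<delta>"
    "\<And>\<alpha>. \<alpha> \<in> ext \<delta> \<Longrightarrow> ae U X (\<lambda>\<sigma>. \<alpha> \<in> ext (h \<sigma>))" for h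
  proof -
    have a: "app (lam X h) \<sigma> = h \<sigma>" if "\<sigma> \<in> ext X" for \<sigma> using that h(1) XD by simp
    have "ext (lam X h) \<subseteq> Q"
    proof
      fix p assume "p \<in> ext (lam X h)"
      then obtain \<sigma> where s: "\<sigma> \<in> ext X" "p = opair \<sigma> (h \<sigma>)" unfolding ext_lam[OF h(1) XD] by blast
      then have "p \<in> ext (pr \<sigma>)" using epr[OF ext_D[OF s(1)]] h(2)[OF s(1)] by blast
      then show "p \<in> Q" unfolding Q_def using s(1) by blast
    qed
    moreover have "un (lam X h)" unfolding un_def
    proof
      fix \<alpha> assume "\<alpha> \<in> ext \<delta>"
      moreover have "ae U X (\<lambda>\<sigma>. \<alpha> \<in> ext (app (lam X h) \<sigma>)) \<longleftrightarrow> ae U X (\<lambda>\<sigma>. \<alpha> \<in> ext (h \<sigma>))"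
        by (rule ae_cong) (simp add: a)
      ultimately show "ae U X (\<lambda>\<sigma>. \<alpha> \<in> ext (app (lam X h) \<sigma>))" using h(3) by blast
    qed
    ultimately show ?thesis unfolding N_def using a h(2) by simp
  qed
  define lt where "lt f g \<longleftrightarrow> ae U X (\<lambda>\<sigma>. app f \<sigma> \<in> ext (app g \<sigma>))" for f g
  have lt: "drel2 lt" unfolding drel2_def lt_def ae_def by (intro dfn XU)
  have lt_d: "definable (\<lambda>s. app f (s 0) \<in> ext (app g (s 0)))" if "f \<in> D" "g \<in> D" for f g
    by (intro dfn that)
  have lt_trans: "lt f h" if fgh: "f \<in> N" "g \<in> N" "h \<in> N" "lt f g" "lt g h" for f g h
  proof -
    note D = ND(1)[OF fgh(1)] ND(1)[OF fgh(2)] ND(1)[OF fgh(3)]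
    have 1: "ae U X (\<lambda>\<sigma>. app f \<sigma> \<in> ext (app g \<sigma>) \<and> app g \<sigma> \<in> ext (app h \<sigma>))"
      by (rule ae_conj[OF UX lt_d[OF D(1,2)] lt_d[OF D(2,3)]]) (use fgh(4,5) in \<open>simp_all add: lt_def\<close>)
    have d1: "definable (\<lambda>s. app f (s 0) \<in> ext (app g (s 0)) \<and> app g (s 0) \<in> ext (app h (s 0)))"
      by (intro dfn D)
    show ?thesis unfolding lt_def
    proof (rule ae_mono[OF UX d1 lt_d[OF D(1,3)] 1])
      fix \<sigma> assume s: "\<sigma> \<in> ext X" "app f \<sigma> \<in> ext (app g \<sigma>) \<and> app g \<sigma> \<in> ext (app h \<sigma>)"
      show "app f \<sigma> \<in> ext (app h \<sigma>)"
        using Ord_trans[OF Ord_elem[OF d(1) ND(2)[OF fgh(3) s(1)]]] s(2) by blast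
    qed
  qed
  \<comment> \<open>Strict bounds of \<open>\<sigma>\<close> exceed every constant: by fineness
    almost every \<open>\<sigma>\<close> contains a given \<open>\<alpha>\<close>.\<close>
  have ne: "N \<noteq> {}"
  proof -
    have "drel2 (\<lambda>\<sigma> x. x \<in> ext \<delta> \<and> ext \<sigma> \<subseteq> ext x)" unfolding drel2_def by (intro dfn dD)
    moreover have "\<exists>x\<in>D. x \<in> ext \<delta> \<and> ext \<sigma> \<subseteq> ext x" if "\<sigma> \<in> ext X" for \<sigma>
      using small_strict_bound[of \<sigma>] eX[OF that] ext_D by blast
    ultimately obtain h where h: "dfun1 h" "\<And>\<sigma>. \<sigma> \<in> ext X \<Longrightarrow> h \<sigma> \<in> ext \<delta> \<and> ext \<sigma> \<subseteq> ext (h \<sigma>)"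
      using collection_choice[of "\<lambda>\<sigma> x. x \<in> ext \<delta> \<and> ext \<sigma> \<subseteq> ext x", OF _ isset_ext[OF XD]] by auto
    have "lam X h \<in> N"
    proof (rule lamN[OF h(1)])
      fix \<alpha> assume a: "\<alpha> \<in> ext \<delta>"
      have d1: "definable (\<lambda>s. E \<alpha> (s 0))" "definable (\<lambda>s. \<alpha> \<in> ext (h (s 0)))"
        by (intro dfn dfun1D[OF h(1)] ext_D[OF a])+
      show "ae U X (\<lambda>\<sigma>. \<alpha> \<in> ext (h \<sigma>))"
        by (rule ae_mono[OF UX d1 fine[OF a, folded X_def]]) (use h(2) ext_E ext_D[OF a] in blast)
    qed (use h(2) in blast)
    then show ?thesis by blast
  qed
  have "\<exists>g\<in>N. \<forall>f\<in>N. \<not> lt f g"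
  proof (rule ccontr)
    assume "\<not> ?thesis"
    then have desc: "\<And>g. g \<in> N \<Longrightarrow> \<exists>f\<in>N. lt f g" by blast
    have eN: "ext (mk N) = N" by (rule ext_mk[OF N])
    obtain c where c: "dfun1 c" "\<And>B. B \<in> D \<Longrightarrow> ext B \<subseteq> N \<Longrightarrow> ext B \<noteq> {} \<Longrightarrow> c B \<in> ext B"
      using choice[of "mk N"] unfolding eN by auto
    \<comment> \<open>Recursion sees only the set of earlier functions, so the new one is chosen
      below all of them. At a successor it suffices to go below the last one, by transitivity of
      \<open>lt\<close>.\<close>
    define F where "F z = c (mk {f \<in> ext (mk N). \<forall>x\<in>ext z. lt f x})" for z
    have F: "dfun1 F" unfolding dfun1_def F_def by (intro dfn dfun1D[OF c(1)] mk_in drel2D[OF lt])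
    obtain G where G: "dfun1 G" and rec: "\<And>\<alpha>. Ord \<alpha> \<Longrightarrow> G \<alpha> = F (mk (G ` ext \<alpha>))"
      using recursion[OF F] by blast
    have step: "G n \<in> N \<and> (\<forall>m\<in>ext n. lt (G n) (G m))" if n: "Ord n" and f: "f \<in> N" "\<And>m. m \<in> ext n \<Longrightarrow> lt f (G m)" for n f
    proof -
      have eG: "ext (mk (G ` ext n)) = G ` ext n" by (intro ext_mk isset_image G isset_ext Ord_in n)
      define B where "B = {f \<in> ext (mk N). \<forall>x\<in>ext (mk (G ` ext n)). lt f x}"
      have "isset B" unfolding B_def by (intro isset_Collect isset_ext mk_in dfn drel2D[OF lt])
      then have eB: "ext (mk B) = B" by simp
      have fB: "f \<in> B" unfolding B_def eG eN using f by blast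
      have BN: "B \<subseteq> N" unfolding B_def eN by blast
      have "c (mk B) \<in> ext (mk B)" by (rule c(2)) (use fB BN eB in auto)
      moreover have "G n = c (mk B)" using rec[OF n] unfolding F_def B_def .
      ultimately have "G n \<in> B" using eB by simp
      then show ?thesis unfolding B_def eG eN by simp
    qed
    have all: "n \<in> ext \<omega> \<longrightarrow> G n \<in> ext (mk N) \<and> (\<forall>m\<in>ext n. lt (G n) (G m))" if "Ord n" for n
    proof (rule Ord_induct[OF _ _ that])
      show "definable (\<lambda>s. s 0 \<in> ext \<omega> \<longrightarrow> G (s 0) \<in> ext (mk N) \<and> (\<forall>m\<in>ext (s 0). lt (G (s 0)) (G m)))"
        by (intro dfn mk_in wD dfun1D[OF G] drel2D[OF lt])
      fix n assume n: "Ord n" and IH: "\<And>m. m \<in> ext n \<Longrightarrow> m \<in> ext \<omega> \<longrightarrow> G m \<in> ext (mk N) \<and> (\<forall>l\<in>ext m. lt (G m) (G l))"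
      show "n \<in> ext \<omega> \<longrightarrow> G n \<in> ext (mk N) \<and> (\<forall>m\<in>ext n. lt (G n) (G m))"
        unfolding eN
      proof
        assume nw: "n \<in> ext \<omega>"
        consider "n = mk {}" | m where "m \<in> ext n" "n = osucc m" using fin[OF nw] by blast
        then show "G n \<in> N \<and> (\<forall>m\<in>ext n. lt (G n) (G m))"
        proof cases
          case 1
          obtain f where "f \<in> N" using ne by blast
          then show ?thesis by (rule step[OF n]) (simp add: 1)
        next
          case (2 m)
          have lw: "l \<in> ext \<omega>" if "l \<in> ext n" for l using Ord_trans[OF ow nw that] .
          have m: "G m \<in> N" "\<And>l. l \<in> ext m \<Longrightarrow> lt (G m) (G l)"
            using IH[OF 2(1)] lw[OF 2(1)] unfolding eN by blast+
          obtain f where f: "f \<in> N" "lt f (G m)" using desc[OF m(1)] by blast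
          have en: "ext n = insert m (ext m)" using 2 ext_osucc[OF ext_D[OF 2(1)]] by simp
          show ?thesis
          proof (rule step[OF n f(1)])
            fix l assume l: "l \<in> ext n"
            have "G l \<in> N" using IH[OF l] lw[OF l] unfolding eN by blast
            then show "lt f (G l)" using l f m lt_trans[OF f(1) m(1)] unfolding en by blast
          qed
        qed
      qed
    qed
    have GN: "G n \<in> N" "lt (G (osucc n)) (G n)" if n: "n \<in> ext \<omega>" for n
    proof -
      show "G n \<in> N" using all[OF Ord_elem[OF ow n]] n unfolding eN by blast
      have "n \<in> ext (osucc n)" using ext_D[OF n] by simp
      then show "lt (G (osucc n)) (G n)" using all[OF Ord_elem[OF ow ws[OF n]]] ws[OF n] by blast
    qed
    \<comment> \<open>Completeness collects all the descents at one point \<open>\<sigma>\<close>;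
      the values there form a nonempty set without an \<open>E\<close>-minimal element, against
      Foundation.\<close>
    have "drel2 (\<lambda>n \<sigma>. app (G (osucc n)) \<sigma> \<in> ext (app (G n) \<sigma>))"
      unfolding drel2_def by (intro dfn dfun1D[OF G])
    then have "ae U X (\<lambda>\<sigma>. \<forall>n\<in>ext \<omega>. app (G (osucc n)) \<sigma> \<in> ext (app (G n) \<sigma>))"
      by (rule ae_ball[OF UX _ wD card_less_elem[OF k wk]]) (use GN(2) lt_def in blast)
    moreover have "definable (\<lambda>s. \<forall>n\<in>ext \<omega>. app (G (osucc n)) (s 0) \<in> ext (app (G n) (s 0)))"
      by (intro dfn dfun1D[OF G] wD)
    ultimately obtain \<sigma> where s: "\<sigma> \<in> ext X" "\<And>n. n \<in> ext \<omega> \<Longrightarrow> app (G (osucc n)) \<sigma> \<in> ext (app (G n) \<sigma>)"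
      using ae_ex[OF UX, of "\<lambda>\<sigma>. \<forall>n\<in>ext \<omega>. app (G (osucc n)) \<sigma> \<in> ext (app (G n) \<sigma>)"] by blast
    have "dfun1 (\<lambda>n. app (G n) \<sigma>)" unfolding dfun1_def by (intro dfn dfun1D[OF G] ext_D[OF s(1)])
    then have i: "isset ((\<lambda>n. app (G n) \<sigma>) ` ext \<omega>)" by (intro isset_image isset_ext wD)
    have "(\<lambda>n. app (G n) \<sigma>) ` ext \<omega> \<noteq> {}" using w0 by blast
    from foundation[OF i this] obtain y where y: "y \<in> (\<lambda>n. app (G n) \<sigma>) ` ext \<omega>" "\<And>z. z \<in> (\<lambda>n. app (G n) \<sigma>) ` ext \<omega> \<Longrightarrow> \<not> E z y"
      by blast
    from y(1) obtain n where n: "n \<in> ext \<omega>" "y = app (G n) \<sigma>" by blast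
    have "app (G (osucc n)) \<sigma> \<in> (\<lambda>n. app (G n) \<sigma>) ` ext \<omega>" using ws[OF n(1)] by blast
    then show False using y(2) s(2)[OF n(1)] n(2) ext_E by blast
  qed
  then obtain g where g: "g \<in> N" "\<And>f. f \<in> N \<Longrightarrow> \<not> lt f g" by blast
  have gf: "dfun1 (app g)" by (rule dfun1_app[OF ND(1)[OF g(1)]])
  \<comment> \<open>A function below \<open>g\<close> that exceeded every constant would belong to
    \<open>N\<close>, against the minimality of \<open>g\<close>.\<close>
  have "\<exists>\<alpha>\<in>ext \<delta>. ae U X (\<lambda>\<sigma>. \<alpha> \<notin> ext (h \<sigma>))"
    if h: "dfun1 h" "\<forall>\<sigma>\<in>ext X. h \<sigma> \<in> ext \<delta>" "ae U X (\<lambda>\<sigma>. h \<sigma> \<in> ext (app g \<sigma>))" for h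
  proof (rule ccontr)
    assume n: "\<not> ?thesis"
    have "lam X h \<in> N"
    proof (rule lamN[OF h(1)])
      fix \<alpha> assume a: "\<alpha> \<in> ext \<delta>"
      have "definable (\<lambda>s. \<alpha> \<in> ext (h (s 0)))" by (intro dfn dfun1D[OF h(1)] ext_D[OF a])
      from ae_not[OF UX this] show "ae U X (\<lambda>\<sigma>. \<alpha> \<in> ext (h \<sigma>))" using n a by blast
    qed (use h(2) in blast)
    moreover have "lt (lam X h) g \<longleftrightarrow> ae U X (\<lambda>\<sigma>. h \<sigma> \<in> ext (app g \<sigma>))" unfolding lt_def
      by (rule ae_cong) (simp add: h(1) XD)
    ultimately show False using g(2) h(3) by blast
  qed
  moreover have "\<forall>\<sigma>\<in>ext X. app g \<sigma> \<in> ext \<delta>" using ND(2)[OF g(1)] by blast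
  moreover have "\<forall>\<alpha>\<in>ext \<delta>. ae U X (\<lambda>\<sigma>. \<alpha> \<in> ext (app g \<sigma>))" using ND(3)[OF g(1)] unfolding un_def .
  ultimately show ?thesis using gf unfolding X_def[symmetric] by blast
qed

text \<open>\<open>W\<close> is the image of a fine ultrafilter under a minimal function
  \<open>g\<close> above all constants. Weak normality is minimality of \<open>g\<close> applied to
  \<open>f\<close> after \<open>g\<close>, and the last clause holds because almost every
  \<open>\<sigma>\<close> is unbounded in \<open>g \<sigma>\<close>.\<close>

theorem weakly_normal_ultrafilter:
  assumes \<theta>: "\<theta> \<in> ext k" "Lim \<theta>"
  shows "\<exists>W\<in>D. complete_ultrafilter_over k W \<delta> \<and> (\<forall>\<alpha>\<in>ext \<delta>. ae W \<delta> (\<lambda>\<xi>. E \<alpha> \<xi>)) \<and>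
    (\<forall>f. dfun1 f \<longrightarrow> (\<forall>\<xi>\<in>ext \<delta>. f \<xi> \<in> ext \<delta>) \<longrightarrow> ae W \<delta> (\<lambda>\<xi>. f \<xi> \<in> ext \<xi>) \<longrightarrow>
      (\<exists>\<alpha>\<in>ext \<delta>. ae W \<delta> (\<lambda>\<xi>. \<alpha> \<notin> ext (f \<xi>)))) \<and>
    ae W \<delta> (\<lambda>\<xi>. \<exists>\<mu>\<in>ext k. \<exists>f\<in>D. cofinal_map f \<mu> \<xi>)"
proof -
  have dD: "\<delta> \<in> D" using d(1) by simp
  define X where "X = Pk k \<delta>"
  have XD: "X \<in> D" unfolding X_def by simp
  note k = sc_Ord[OF kD sc] sc_cardinal[OF kD sc]
  have eX: "\<sigma> \<in> D \<and> ext \<sigma> \<subseteq> ext \<delta> \<and> card_less \<sigma> k" if "\<sigma> \<in> ext X" for \<sigma>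
    using that unfolding X_def ext_Pk[OF kD dD] by blast
  obtain U where U: "U \<in> D" "complete_ultrafilter_over k U X"
    and fine: "\<And>x. x \<in> ext \<delta> \<Longrightarrow> ae U X (\<lambda>\<sigma>. E x \<sigma>)"
    using fine_exists[OF kD sc dD] unfolding X_def by blast
  note UX = k U(1) XD U(2)
  from minimal_unbounded_function[OF U(1) _ _ \<theta>, folded X_def, OF U(2) fine]
  obtain g where g: "dfun1 g" "\<And>\<sigma>. \<sigma> \<in> ext X \<Longrightarrow> g \<sigma> \<in> ext \<delta>"
    and unb: "\<And>\<alpha>. \<alpha> \<in> ext \<delta> \<Longrightarrow> ae U X (\<lambda>\<sigma>. \<alpha> \<in> ext (g \<sigma>))"
    and min: "\<And>h. dfun1 h \<Longrightarrow> (\<And>\<sigma>. \<sigma> \<in> ext X \<Longrightarrow> h \<sigma> \<in> ext \<delta>) \<Longrightarrow> ae U X (\<lambda>\<sigma>. h \<sigma> \<in> ext (g \<sigma>)) \<Longrightarrow>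
      \<exists>\<alpha>\<in>ext \<delta>. ae U X (\<lambda>\<sigma>. \<alpha> \<notin> ext (h \<sigma>))"
    by blast
  obtain W where W: "W \<in> D" "complete_ultrafilter_over k W \<delta>"
    and aeW: "\<And>Q. definable (\<lambda>s. Q (s 0)) \<Longrightarrow> ae W \<delta> Q = ae U X (\<lambda>x. Q (g x))"
    using pushforward[OF UX g(1) dD] g(2) by blast
  have 1: "ae W \<delta> (\<lambda>\<xi>. E \<alpha> \<xi>)" if a: "\<alpha> \<in> ext \<delta>" for \<alpha>
  proof -
    have "definable (\<lambda>s. E \<alpha> (s 0))" by (intro dfn ext_D[OF a])
    moreover have "ae U X (\<lambda>\<sigma>. \<alpha> \<in> ext (g \<sigma>)) \<longleftrightarrow> ae U X (\<lambda>\<sigma>. E \<alpha> (g \<sigma>))"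
      by (rule ae_cong) (use ext_E ext_D[OF a] in blast)
    ultimately show ?thesis using aeW unb[OF a] by blast
  qed
  have 2: "\<exists>\<alpha>\<in>ext \<delta>. ae W \<delta> (\<lambda>\<xi>. \<alpha> \<notin> ext (f \<xi>))"
    if f: "dfun1 f" "\<forall>\<xi>\<in>ext \<delta>. f \<xi> \<in> ext \<delta>" "ae W \<delta> (\<lambda>\<xi>. f \<xi> \<in> ext \<xi>)" for f
  proof -
    have "definable (\<lambda>s. f (s 0) \<in> ext (s 0))" by (intro dfn dfun1D[OF f(1)])
    from aeW[of "\<lambda>\<xi>. f \<xi> \<in> ext \<xi>", OF this] have "ae U X (\<lambda>\<sigma>. f (g \<sigma>) \<in> ext (g \<sigma>))" using f(3) by blast
    from min[OF dfun1_comp[OF f(1) g(1)] _ this] obtain \<alpha> where a: "\<alpha> \<in> ext \<delta>" "ae U X (\<lambda>\<sigma>. \<alpha> \<notin> ext (f (g \<sigma>)))"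
      using f(2) g(2) by blast
    have "definable (\<lambda>s. \<alpha> \<notin> ext (f (s 0)))" by (intro dfn dfun1D[OF f(1)] ext_D[OF a(1)])
    from aeW[of "\<lambda>\<xi>. \<alpha> \<notin> ext (f \<xi>)", OF this] show ?thesis using a by blast
  qed
  \<comment> \<open>\<open>\<beta>\<close> is a strict bound for the part of \<open>\<sigma>\<close>
    below \<open>g \<sigma>\<close>. The aim is that for almost all \<open>\<sigma>\<close> no such
    bound exists below \<open>g \<sigma>\<close>.\<close>
  define P where "P \<sigma> \<beta> \<longleftrightarrow> (\<forall>\<gamma>\<in>ext \<sigma>. \<gamma> \<in> ext (g \<sigma>) \<longrightarrow> \<gamma> \<in> ext \<beta>)" for \<sigma> \<beta>
  have P: "drel2 P" unfolding drel2_def P_def by (intro dfn dfun1D[OF g(1)])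
  define B where "B \<sigma> \<longleftrightarrow> (\<exists>\<beta>\<in>ext (g \<sigma>). P \<sigma> \<beta>)" for \<sigma>
  have B: "drel1 B" unfolding drel1_def B_def by (intro dfn dfun1D[OF g(1)] drel2D[OF P])
  have Bd: "definable (\<lambda>s. B (s 0))" by (intro drel1D[OF B] defterm_var)
  have nB: "\<not> ae U X B"
  proof
    assume aB: "ae U X B"
    \<comment> \<open>A choice \<open>h\<close> of bounds would lie below \<open>g\<close> almost
      everywhere, hence by minimality fail to exceed some constant \<open>\<alpha>\<close>. Yet
      almost every \<open>\<sigma>\<close> contains \<open>\<alpha>\<close> and has
      \<open>\<alpha>\<close> below \<open>g \<sigma>\<close>, which puts \<open>\<alpha>\<close>
      below \<open>h \<sigma>\<close>. Where no bound exists any element of \<open>\<delta>\<close>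
      serves as value.\<close>
    define R where "R \<sigma> \<beta> \<longleftrightarrow> \<beta> \<in> ext \<delta> \<and> (B \<sigma> \<longrightarrow> \<beta> \<in> ext (g \<sigma>) \<and> P \<sigma> \<beta>)" for \<sigma> \<beta>
    have R: "drel2 R" unfolding drel2_def R_def by (intro dfn dfun1D[OF g(1)] drel2D[OF P] drel1D[OF B] dD)
    have "\<exists>\<beta>\<in>D. R \<sigma> \<beta>" if s: "\<sigma> \<in> ext X" for \<sigma>
    proof (cases "B \<sigma>")
      case True
      then obtain \<beta> where "\<beta> \<in> ext (g \<sigma>)" "P \<sigma> \<beta>" unfolding B_def by blast
      then show ?thesis unfolding R_def using Ord_trans[OF d(1) g(2)[OF s]] ext_D by blast
    next
      case False
      then show ?thesis unfolding R_def using d(2) ext_D by blast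
    qed
    from collection_choice[OF R isset_ext[OF XD] this]
    obtain h where h: "dfun1 h" "\<And>\<sigma>. \<sigma> \<in> ext X \<Longrightarrow> R \<sigma> (h \<sigma>)" by blast
    have hd: "definable (\<lambda>s. h (s 0) \<in> ext (g (s 0)))" by (intro dfn dfun1D[OF g(1)] dfun1D[OF h(1)])
    have "ae U X (\<lambda>\<sigma>. h \<sigma> \<in> ext (g \<sigma>))"
      by (rule ae_mono[OF UX Bd hd aB]) (use h(2) R_def in blast)
    from min[OF h(1) _ this] obtain \<alpha> where a: "\<alpha> \<in> ext \<delta>" "ae U X (\<lambda>\<sigma>. \<alpha> \<notin> ext (h \<sigma>))"
      using h(2) R_def by blast
    have aD: "\<alpha> \<in> D" using ext_D[OF a(1)] .
    have ds: "definable (\<lambda>s. E \<alpha> (s 0))" "definable (\<lambda>s. \<alpha> \<in> ext (g (s 0)))" "definable (\<lambda>s. \<alpha> \<notin> ext (h (s 0)))"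
      "definable (\<lambda>s. B (s 0) \<and> E \<alpha> (s 0))" "definable (\<lambda>s. \<alpha> \<in> ext (g (s 0)) \<and> \<alpha> \<notin> ext (h (s 0)))"
      "definable (\<lambda>s. (B (s 0) \<and> E \<alpha> (s 0)) \<and> \<alpha> \<in> ext (g (s 0)) \<and> \<alpha> \<notin> ext (h (s 0)))"
      by (intro dfn dfun1D[OF g(1)] dfun1D[OF h(1)] drel1D[OF B] aD)+
    have "ae U X (\<lambda>\<sigma>. (B \<sigma> \<and> E \<alpha> \<sigma>) \<and> \<alpha> \<in> ext (g \<sigma>) \<and> \<alpha> \<notin> ext (h \<sigma>))"
      by (rule ae_conj[OF UX ds(4,5) ae_conj[OF UX Bd ds(1) aB fine[OF a(1)]]
            ae_conj[OF UX ds(2,3) unb[OF a(1)] a(2)]])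
    from ae_ex[OF UX ds(6) this] obtain \<sigma> where s: "\<sigma> \<in> ext X" "B \<sigma>" "E \<alpha> \<sigma>" "\<alpha> \<in> ext (g \<sigma>)" "\<alpha> \<notin> ext (h \<sigma>)" by blast
    then show False using h(2)[OF s(1)] ext_E aD unfolding R_def P_def by blast
  qed
  have 3: "ae W \<delta> (\<lambda>\<xi>. \<exists>\<mu>\<in>ext k. \<exists>f\<in>D. cofinal_map f \<mu> \<xi>)"
  proof -
    have dc: "definable (\<lambda>s. \<exists>\<mu>\<in>ext k. \<exists>f\<in>D. cofinal_map f \<mu> (s 0))"
      "definable (\<lambda>s. \<exists>\<mu>\<in>ext k. \<exists>f\<in>D. cofinal_map f \<mu> (g (s 0)))" by (intro dfn kD dfun1D[OF g(1)])+
    have "ae U X (\<lambda>\<sigma>. \<not> B \<sigma>)" using ae_not[OF UX Bd] nB by blast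
    then have "ae U X (\<lambda>\<sigma>. \<exists>\<mu>\<in>ext k. \<exists>f\<in>D. cofinal_map f \<mu> (g \<sigma>))"
    proof (rule ae_mono[OF UX definable_neg[OF Bd] dc(2)])
      fix \<sigma> assume s: "\<sigma> \<in> ext X" and nB: "\<not> B \<sigma>"
      have sD: "\<sigma> \<in> D" "card_less \<sigma> k" "ext \<sigma> \<subseteq> ext \<delta>" using eX[OF s] by blast+
      \<comment> \<open>Without such a bound the part of \<open>\<sigma>\<close> below
        \<open>g \<sigma>\<close> is cofinal in \<open>g \<sigma>\<close>, and it is small.\<close>
      define C where "C = mk (ext \<sigma> \<inter> ext (g \<sigma>))"
      have CD: "C \<in> D" unfolding C_def by simp
      have eC: "ext C = ext \<sigma> \<inter> ext (g \<sigma>)" unfolding C_def by (intro ext_mk isset_Int isset_ext sD dfun1_in[OF g(1)])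
      have "card_less C k" using card_less_subset[OF k CD sD(1) _ sD(2)] eC by blast
      moreover have "ext C \<subseteq> ext (g \<sigma>)" unfolding eC by blast
      moreover have og: "Ord (g \<sigma>)" using Ord_elem[OF d(1) g(2)[OF s]] .
      moreover have "\<exists>\<gamma>\<in>ext C. \<beta> = \<gamma> \<or> \<beta> \<in> ext \<gamma>" if b: "\<beta> \<in> ext (g \<sigma>)" for \<beta>
      proof -
        obtain \<gamma> where "\<gamma> \<in> ext \<sigma>" "\<gamma> \<in> ext (g \<sigma>)" "\<gamma> \<notin> ext \<beta>" using nB b unfolding B_def P_def by blast
        then show ?thesis using Ord_linear[OF Ord_elem[OF og b] Ord_elem[OF og]] unfolding eC by blast
      qed
      ultimately show "\<exists>\<mu>\<in>ext k. \<exists>f\<in>D. cofinal_map f \<mu> (g \<sigma>)" using small_unbounded[OF CD] by blast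
    qed
    then show ?thesis using aeW[of "\<lambda>\<xi>. \<exists>\<mu>\<in>ext k. \<exists>f\<in>D. cofinal_map f \<mu> \<xi>", OF dc(1)] by blast
  qed
  show ?thesis using W 1 2 3 by blast
qed

end

end

section \<open>Inner models\<close>

text \<open>In the source \<open>Cls\<close> is interpreted by the empty class and so becomes a
  false formula; in the target it denotes \<open>M\<close> and bounds the quantifiers.\<close>

primrec relativize :: "fm \<Rightarrow> fm" where
  "relativize (Mem i j) = Mem i j"
| "relativize (Eq i j) = Eq i j"
| "relativize (Cls i) = Neg (Eq i i)"
| "relativize (Neg \<phi>) = Neg (relativize \<phi>)"
| "relativize (Conj \<phi> \<psi>) = Conj (relativize \<phi>) (relativize \<psi>)"
| "relativize (All \<phi>) = All (Neg (Conj (Cls 0) (Neg (relativize \<phi>))))"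

lemma sat_relativize:
  "(\<And>i. s i \<in> M) \<Longrightarrow>
    set_structure.sat UNIV E M (relativize \<phi>) s \<longleftrightarrow> set_structure.sat M E {} \<phi> s"
proof (induction \<phi> arbitrary: s)
  case (All \<phi>)
  have "set_structure.sat UNIV E M (relativize \<phi>) (case_nat x s) \<longleftrightarrow> set_structure.sat M E {} \<phi> (case_nat x s)"
    if "x \<in> M" for x
    using that All.prems by (intro All.IH) (simp split: nat.split)
  then show ?case by (auto simp: set_structure.sat.simps)
qed (simp_all add: set_structure.sat.simps)

locale compact_inner_model =
  fixes E :: "'a \<Rightarrow> 'a \<Rightarrow> bool" and M :: "'a set" and \<kappa> :: 'a
  assumes V_zfc: "set_structure.zfc_with UNIV E M"
    and inner: "inner_model E M"
    and compact: "set_structure.strongly_compact UNIV E \<kappa>"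
begin

sublocale V: zf_class UNIV E M
  by unfold_locales (rule V_zfc)

sublocale I: zf_class M E "{}"
  using inner unfolding inner_model_def set_structure.zfc_def by unfold_locales blast

lemma M_trans: "x \<in> M \<Longrightarrow> y \<in> V.ext x \<Longrightarrow> y \<in> M"
  using inner unfolding inner_model_def V.ext_E by blast

lemma I_ext [simp]: "x \<in> M \<Longrightarrow> I.ext x = V.ext x"
  unfolding I.ext_def V.ext_def using M_trans[unfolded V.ext_def] by blast

lemma Ord_M: "V.Ord \<alpha> \<Longrightarrow> \<alpha> \<in> M"
  using inner unfolding inner_model_def V.Ord_def by blast

lemma I_ordinal:
  assumes x: "x \<in> M" shows "I.ordinal x \<longleftrightarrow> V.ordinal x"
proof -
  have "(\<forall>y\<in>V.ext x. I.ext y \<subseteq> V.ext x) \<longleftrightarrow> (\<forall>y\<in>V.ext x. V.ext y \<subseteq> V.ext x)"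
    by (intro ball_cong refl) (simp add: M_trans[OF x])
  then show ?thesis unfolding I.ordinal_def V.ordinal_def I_ext[OF x] by blast
qed

lemma I_Ord [simp]: "I.Ord x \<longleftrightarrow> V.Ord x"
  using Ord_M I_ordinal unfolding I.Ord_def V.Ord_def by blast

lemma I_is_pair: "p \<in> M \<Longrightarrow> I.is_pair p x y \<longleftrightarrow> V.is_pair p x y"
proof -
  assume p: "p \<in> M"
  have "a \<in> M \<and> b \<in> M" if "V.ext p = {a, b}" for a b
    using M_trans[OF p] that by blast
  then show ?thesis unfolding I.is_pair_def V.is_pair_def using p by (metis I_ext UNIV_I)
qed

lemma I_maps_to: "f \<in> M \<Longrightarrow> I.maps_to f x y \<longleftrightarrow> V.maps_to f x y"
  unfolding I.maps_to_def V.maps_to_def using I_is_pair M_trans by (metis I_ext)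

lemma I_is_function:
  assumes "f \<in> M" "a \<in> M" "b \<in> M" shows "I.is_function f a b \<longleftrightarrow> V.is_function f a b"
proof -
  have "(\<forall>p\<in>V.ext f. \<exists>x\<in>V.ext a. \<exists>y\<in>V.ext b. I.is_pair p x y) \<longleftrightarrow>
    (\<forall>p\<in>V.ext f. \<exists>x\<in>V.ext a. \<exists>y\<in>V.ext b. V.is_pair p x y)"
    by (intro ball_cong bex_cong refl I_is_pair M_trans[OF assms(1)])
  then show ?thesis
    unfolding I.is_function_def V.is_function_def I_ext[OF assms(1)] I_ext[OF assms(2)] I_ext[OF assms(3)]
      I_maps_to[OF assms(1)] by blast
qed

lemma I_is_bijection:
  assumes "f \<in> M" "a \<in> M" "b \<in> M" shows "I.is_bijection f a b \<longleftrightarrow> V.is_bijection f a b"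
  unfolding I.is_bijection_def V.is_bijection_def I_ext[OF assms(2)] I_ext[OF assms(3)]
    I_maps_to[OF assms(1)] I_is_function[OF assms] ..

lemma I_cofinal_map:
  assumes "f \<in> M" "a \<in> M" "b \<in> M" shows "I.cofinal_map f a b \<longleftrightarrow> V.cofinal_map f a b"
  unfolding I.cofinal_map_def V.cofinal_map_def I_ext[OF assms(2)] I_ext[OF assms(3)]
    I_maps_to[OF assms(1)] I_is_function[OF assms] ..

lemma I_equipotent: "a \<in> M \<Longrightarrow> b \<in> M \<Longrightarrow> I.equipotent a b \<Longrightarrow> V.equipotent a b"
  unfolding I.equipotent_def V.equipotent_def using I_is_bijection by blast

lemma I_mk:
  assumes "I.isset A" shows "I.mk A \<in> M" "V.ext (I.mk A) = A" "V.mk A = I.mk A"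
proof -
  show 1: "I.mk A \<in> M" by simp
  show 2: "V.ext (I.mk A) = A" using I.ext_mk[OF assms] I_ext[OF 1] by simp
  show "V.mk A = I.mk A" using V.mk_ext[OF UNIV_I, of "I.mk A"] 2 by simp
qed

text \<open>On a set, a class function of \<open>M\<close> is given by an element of
  \<open>M\<close>; applying that element in the universe is a function definable there.\<close>

lemma fun_transfer:
  assumes h: "I.dfun1 h" and a: "a \<in> M"
  shows "\<exists>h'. V.dfun1 h' \<and> (\<forall>x\<in>V.ext a. h' x = h x)"
proof -
  define b where "b = I.mk (h ` I.ext a)"
  have bM: "b \<in> M" unfolding b_def by simp
  have eb: "I.ext b = h ` I.ext a" unfolding b_def by (intro I.ext_mk I.isset_image h I.isset_ext a)
  define f where "f = I.lam a h"
  have fM: "f \<in> M" unfolding f_def by simp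
  have fI: "I.is_function f a b" unfolding f_def using eb by (intro I.is_function_lam h a) simp
  then have fV: "V.is_function f a b" using I_is_function[OF fM a bM] by blast
  have "V.app f x = h x" if x: "x \<in> V.ext a" for x
  proof -
    have xM: "x \<in> M" using M_trans[OF a x] .
    have "I.maps_to f x (h x)" unfolding f_def
      using I.maps_to_lam[OF h a xM I.dfun1_in[OF h xM]] x a by simp
    then have "V.maps_to f x (h x)" using I_maps_to[OF fM] by blast
    then show ?thesis using V.is_function_maps_to[OF fV UNIV_I UNIV_I, of x "h x"] by simp
  qed
  then show ?thesis using V.dfun1_app[OF UNIV_I] by blast
qed

lemma I_injects:
  assumes "a \<in> M" "b \<in> M" "I.injects a b" shows "V.injects a b"
proof -
  obtain h where h: "I.dfun1 h" "inj_on h (V.ext a)" "h ` V.ext a \<subseteq> V.ext b"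
    using assms unfolding I.injects_def by auto
  obtain h' where h': "V.dfun1 h'" "\<And>x. x \<in> V.ext a \<Longrightarrow> h' x = h x"
    using fun_transfer[OF h(1) assms(1)] by blast
  show ?thesis
  proof (rule V.injectsI[OF h'(1)])
    show "inj_on h' (V.ext a)" using h(2) h'(2) inj_on_cong[of "V.ext a" h' h] by blast
    show "h' x \<in> V.ext b" if "x \<in> V.ext a" for x using h'(2)[OF that] h(3) that by auto
  qed
qed

text \<open>A relation on all of \<open>M\<close> need not be a set, so \<open>fun_transfer\<close>
  cannot move it to the universe; its formula is relativized instead, with the class predicate
  bounding the quantifiers.\<close>

lemma relativize_drel2:
  assumes "I.drel2 R" shows "V.drel2 (\<lambda>x y. x \<in> M \<and> y \<in> M \<and> R x y)"
proof -
  obtain u \<phi> where u: "\<And>i. u i \<in> M"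
    and \<phi>: "\<And>x y. x \<in> M \<Longrightarrow> y \<in> M \<Longrightarrow> R x y \<longleftrightarrow> I.sat {} \<phi> (case_nat x (case_nat y u))"
    using I.drel2_formula[OF assms] by blast
  define g where "g i = (case i of 0 \<Rightarrow> 0 | Suc j \<Rightarrow> (case j of 0 \<Rightarrow> 2 | Suc l \<Rightarrow> Suc (2 * l)))" for i :: nat
  have g: "case_nat (s 0) (case_nat (s (Suc 0)) u) i = merge s u (g i)" for s :: "nat \<Rightarrow> 'a" and i
    by (auto simp: g_def merge_def split: nat.split)
  have *: "case_nat (s 0) (case_nat (s (Suc 0)) u) = (\<lambda>i. merge s u (g i))" for s :: "nat \<Rightarrow> 'a"
    by (rule ext) (rule g)
  have "V.sat M (relativize \<phi>) (case_nat x (case_nat y u)) \<longleftrightarrow> R x y" if "x \<in> M" "y \<in> M" for x y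
    using sat_relativize[of "case_nat x (case_nat y u)" M E \<phi>] \<phi>[OF that] that u by (simp split: nat.split)
  moreover have "V.definable (\<lambda>s. V.sat M (relativize \<phi>) (case_nat (s 0) (case_nat (s (Suc 0)) u)))"
    unfolding V.definable_def
    by (rule exI[of _ "ren g (relativize \<phi>)"], rule exI[of _ u]) (simp add: V.env_def V.sat_ren *)
  then have "V.definable (\<lambda>s. s 0 \<in> M \<and> s (Suc 0) \<in> M \<and>
    V.sat M (relativize \<phi>) (case_nat (s 0) (case_nat (s (Suc 0)) u)))"
    by (intro V.definable_conj V.definable_Cls V.defterm_var)
  ultimately show ?thesis unfolding V.drel2_def by (elim V.definable_cong) blast
qed

text \<open>After relativization the levels \<open>H\<close> of the hierarchy of \<open>M\<close>
  are available as a class in the universe, so Replacement there bounds the ranks of the members of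
  \<open>\<sigma>\<close>. The bound \<open>S\<close> is an ordinal, hence in \<open>M\<close>, and
  so is its level.\<close>

lemma bounded_in_M:
  assumes "V.ext \<sigma> \<subseteq> M" shows "\<exists>a\<in>M. V.ext \<sigma> \<subseteq> V.ext a"
proof -
  obtain H where H: "I.dfun1 H" and ex: "\<And>x. x \<in> M \<Longrightarrow> \<exists>\<alpha>. I.Ord \<alpha> \<and> x \<in> I.ext (H \<alpha>)" and
    mono: "\<And>\<alpha> \<beta>. I.Ord \<alpha> \<Longrightarrow> I.Ord \<beta> \<Longrightarrow> I.ext \<alpha> \<subseteq> I.ext \<beta> \<Longrightarrow> I.ext (H \<alpha>) \<subseteq> I.ext (H \<beta>)"
    using I.hierarchy by blast
  have HM: "H \<alpha> \<in> M" if "V.Ord \<alpha>" for \<alpha> using I.dfun1_in[OF H Ord_M[OF that]] .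
  have "I.drel2 (\<lambda>x y. y = H x)" unfolding I.drel2_def by (intro I.definable_eq I.defterm_var I.dfun1D[OF H])
  note R = relativize_drel2[OF this]
  define R' where "R' u \<alpha> \<longleftrightarrow> V.Ord \<alpha> \<and> (\<exists>y\<in>UNIV. (\<alpha> \<in> M \<and> y \<in> M \<and> y = H \<alpha>) \<and> u \<in> V.ext y)" for u \<alpha>
  have R': "V.drel2 R'" unfolding V.drel2_def R'_def by (intro dfn V.drel2D[OF R])
  have R'_iff: "R' u \<alpha> \<longleftrightarrow> V.Ord \<alpha> \<and> u \<in> V.ext (H \<alpha>)" for u \<alpha>
    unfolding R'_def using Ord_M HM by blast
  have "\<exists>\<alpha>\<in>UNIV. R' u \<alpha>" if "u \<in> V.ext \<sigma>" for u
  proof -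
    have "u \<in> M" using assms that by blast
    from ex[OF this] obtain \<alpha> where "V.Ord \<alpha>" "u \<in> I.ext (H \<alpha>)" by auto
    then show ?thesis unfolding R'_iff using I_ext[OF HM[of \<alpha>]] by auto
  qed
  from V.collection_choice[OF R' V.isset_ext[OF UNIV_I] this]
  obtain e where e: "V.dfun1 e" "\<And>u. u \<in> V.ext \<sigma> \<Longrightarrow> V.Ord (e u) \<and> u \<in> V.ext (H (e u))"
    unfolding R'_iff by blast
  have eS: "V.isset (e ` V.ext \<sigma>)" by (intro V.isset_image e V.isset_ext UNIV_I)
  define S where "S = V.mk (\<Union>x\<in>e ` V.ext \<sigma>. V.ext x)"
  have S: "V.Ord S" unfolding S_def using e(2) by (intro V.Ord_Sup[OF eS]) blast
  have extS: "V.ext S = (\<Union>x\<in>e ` V.ext \<sigma>. V.ext x)" unfolding S_def by (rule V.ext_mk[OF V.isset_Union[OF eS]])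
  have "u \<in> V.ext (H S)" if u: "u \<in> V.ext \<sigma>" for u
  proof -
    have eu: "V.Ord (e u)" "u \<in> V.ext (H (e u))" using e(2)[OF u] by blast+
    have "V.ext (e u) \<subseteq> V.ext S" unfolding extS using u by blast
    then have "V.ext (H (e u)) \<subseteq> V.ext (H S)"
      using mono[of "e u" S] eu(1) S Ord_M[OF eu(1)] Ord_M[OF S] HM[OF eu(1)] HM[OF S] by simp
    then show ?thesis using eu by blast
  qed
  then show ?thesis using HM[OF S] by blast
qed

lemma k_Ord: "V.Ord \<kappa>" and k_card: "V.cardinal \<kappa>" and k_Lim: "V.Lim \<kappa>"
  using V.sc_Ord[OF UNIV_I compact] V.sc_cardinal[OF UNIV_I compact] V.sc_Lim[OF UNIV_I compact] .

lemma k_M: "\<kappa> \<in> M"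
  using Ord_M[OF k_Ord] .

lemma I_cardinal_k: "I.cardinal \<kappa>"
proof -
  have "\<not> I.equipotent \<alpha> \<kappa>" if "\<alpha> \<in> V.ext \<kappa>" for \<alpha>
    using k_card that I_equipotent[OF M_trans[OF k_M that] k_M] unfolding V.cardinal_def by blast
  then show ?thesis using k_Ord k_M I_ordinal unfolding I.cardinal_def V.Ord_def by simp
qed

text \<open>The cardinality \<open>\<mu>\<close> of \<open>x\<close> in \<open>M\<close> is merely
  an ordinal in the universe; but if it were not below \<open>\<kappa>\<close>, the universe would
  inject \<open>\<kappa>\<close> into a smaller ordinal.\<close>

lemma I_card_less:
  assumes x: "x \<in> M" shows "I.card_less x \<kappa> \<longleftrightarrow> V.card_less x \<kappa>"
proof
  assume "I.card_less x \<kappa>"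
  then obtain \<mu> where m: "\<mu> \<in> V.ext \<kappa>" "I.equipotent x \<mu>" unfolding I.card_less_def using k_M by auto
  then have "V.equipotent x \<mu>" using I_equipotent[OF x M_trans[OF k_M m(1)]] by blast
  then have "V.injects x \<mu>" by (rule V.equipotent_injects[OF UNIV_I])
  then show "V.card_less x \<kappa>" using V.card_less_iff[OF k_Ord k_card UNIV_I] m(1) by blast
next
  assume "V.card_less x \<kappa>"
  then obtain \<alpha> where a: "\<alpha> \<in> V.ext \<kappa>" "V.injects x \<alpha>" using V.card_less_iff[OF k_Ord k_card UNIV_I] by blast
  obtain \<mu> where m: "V.Ord \<mu>" "I.cardinal \<mu>" "I.equipotent x \<mu>" using I.cardinality[OF x] by auto
  have "V.equipotent \<mu> x" using V.equipotent_sym[OF UNIV_I UNIV_I I_equipotent[OF x Ord_M[OF m(1)] m(3)]] .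
  then have "V.injects \<mu> \<alpha>" using V.equipotent_injects[OF UNIV_I] V.injects_trans a(2) by blast
  have "\<mu> \<in> V.ext \<kappa>"
  proof (rule ccontr)
    assume "\<mu> \<notin> V.ext \<kappa>"
    then have "V.injects \<kappa> \<mu>" using V.Ord_not_mem[OF m(1) k_Ord] by (intro V.injects_subset) blast
    then show False
      using \<open>V.injects \<mu> \<alpha>\<close> V.injects_trans V.cardinal_not_injects[OF k_Ord k_card a(1)] by blast
  qed
  then show "I.card_less x \<kappa>" unfolding I.card_less_def using m k_M by auto
qed

section \<open>Ultrafilters of the universe and their traces on \<open>M\<close>\<close>

abbreviation PkM :: "'a \<Rightarrow> 'a" where
  "PkM a \<equiv> I.Pk \<kappa> a"

lemma ext_PkM:
  assumes "a \<in> M" shows "V.ext (PkM a) = {\<sigma> \<in> M. V.ext \<sigma> \<subseteq> V.ext a \<and> V.card_less \<sigma> \<kappa>}"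
proof -
  have "V.ext (PkM a) = {\<sigma> \<in> {\<sigma> \<in> M. I.ext \<sigma> \<subseteq> I.ext a}. I.card_less \<sigma> \<kappa>}"
    using I.ext_Pk[OF k_M assms] I_ext[OF I.Pk_in] by simp
  then show ?thesis using assms I_card_less by auto
qed

abbreviation kuf :: "'a \<Rightarrow> 'a \<Rightarrow> bool" where
  "kuf U X \<equiv> V.complete_ultrafilter_over \<kappa> U X"

lemmas kufD = k_Ord k_card UNIV_I UNIV_I

lemma mem_ultrafilter_iff:
  assumes "V.ext A \<subseteq> V.ext X" shows "A \<in> V.ext U \<longleftrightarrow> V.ae U X (\<lambda>x. x \<in> V.ext A)"
proof -
  have "{x \<in> V.ext X. x \<in> V.ext A} = V.ext A" using assms by blast
  then show ?thesis unfolding V.ae_def by simp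
qed

text \<open>Each set that the definition asks for lies in \<open>U\<close> by the properties of
  \<open>U\<close> in the universe and exists in \<open>M\<close> by the axioms there;
  extensionality identifies the two.\<close>

lemma restrict_ultrafilter:
  assumes X: "X \<in> M" and U: "kuf U X" and c: "c \<in> M" "V.ext c = V.ext U \<inter> M"
  shows "I.complete_ultrafilter_over \<kappa> c X"
  unfolding I.complete_ultrafilter_over_def I.ultrafilter_over_def I_ext[OF X] I_ext[OF c(1)] c(2)
proof (intro conjI ballI impI)
  show "I.ext A \<subseteq> V.ext X" if "A \<in> V.ext U \<inter> M" for A using that V.uf_subset[OF kufD U] by auto
  show "X \<in> V.ext U \<inter> M" using X V.uf_top[OF kufD U] by blast
  show "I.ext A \<noteq> {}" if "A \<in> V.ext U \<inter> M" for A using that V.uf_nonempty[OF kufD U] by auto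
  show "B \<in> V.ext U \<inter> M" if "A \<in> V.ext U \<inter> M" "B \<in> M" "I.ext A \<subseteq> I.ext B \<and> I.ext B \<subseteq> V.ext X" for A B
    using that V.uf_up[OF kufD U, of A B] by auto
  show "\<exists>C\<in>V.ext U \<inter> M. I.ext C = I.ext A \<inter> I.ext B" if AB: "A \<in> V.ext U \<inter> M" "B \<in> V.ext U \<inter> M" for A B
  proof -
    have i: "I.isset (I.ext A \<inter> I.ext B)" using AB by (intro I.isset_Int I.isset_ext) blast+
    obtain C where C: "C \<in> V.ext U" "V.ext C = V.ext A \<inter> V.ext B" using V.uf_int[OF kufD U, of A B] AB by blast
    have "C = I.mk (I.ext A \<inter> I.ext B)" using I_mk(3)[OF i] C(2) AB V.mk_ext[OF UNIV_I, of C] by simp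
    then show ?thesis using C(1) I_mk(1)[OF i] I.ext_mk[OF i] by blast
  qed
  show "A \<in> V.ext U \<inter> M \<or> (\<exists>B\<in>V.ext U \<inter> M. I.ext B = V.ext X - I.ext A)" if A: "A \<in> M" "I.ext A \<subseteq> V.ext X" for A
  proof (cases "A \<in> V.ext U")
    case False
    have i: "I.isset (I.ext X - I.ext A)" by (intro I.isset_Diff I.isset_ext A X)
    obtain B where B: "B \<in> V.ext U" "V.ext B = V.ext X - V.ext A"
      using V.uf_ultra[OF kufD U, of A] A False by auto
    have "B = I.mk (I.ext X - I.ext A)" using I_mk(3)[OF i] B(2) A X V.mk_ext[OF UNIV_I, of B] by simp
    then show ?thesis using B(1) I_mk(1)[OF i] I.ext_mk[OF i] X by auto
  qed (use A in blast)
  fix F assume F: "F \<in> M" and FU: "I.ext F \<noteq> {} \<and> I.ext F \<subseteq> V.ext U \<inter> M \<and> I.card_less F \<kappa>"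
  then have "V.ext F \<noteq> {} \<and> V.ext F \<subseteq> V.ext U \<and> V.card_less F \<kappa>" using I_card_less[OF F] by auto
  then obtain B where B: "B \<in> V.ext U" "V.ext B = (\<Inter>A\<in>V.ext F. V.ext A)"
    using U unfolding V.complete_ultrafilter_over_def by blast
  have i: "I.isset {y \<in> I.ext X. \<forall>A\<in>I.ext F. y \<in> I.ext A}" by (intro I.isset_Collect I.isset_ext X dfn F)
  have FM: "A \<in> M" if "A \<in> V.ext F" for A using M_trans[OF F that] .
  obtain A0 where "A0 \<in> V.ext F" "V.ext A0 \<subseteq> V.ext X"
    using FU F V.uf_subset[OF kufD U] by auto
  then have "{y \<in> I.ext X. \<forall>A\<in>I.ext F. y \<in> I.ext A} = V.ext B" unfolding B(2) using F X FM by auto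
  then have "B = I.mk {y \<in> I.ext X. \<forall>A\<in>I.ext F. y \<in> I.ext A}"
    using I_mk(3)[OF i] V.mk_ext[OF UNIV_I, of B] by simp
  then have "B \<in> V.ext U \<inter> M" using B(1) I_mk(1)[OF i] by blast
  moreover have "I.ext B = (\<Inter>A\<in>I.ext F. I.ext A)" using B(2) calculation F FM by simp
  ultimately show "\<exists>B\<in>V.ext U \<inter> M. I.ext B = (\<Inter>A\<in>I.ext F. I.ext A)" by blast
qed

lemma amenable:
  assumes ap: "approximation_property E \<kappa> M" shows "ultrafilters_amenable E \<kappa> M"
  unfolding ultrafilters_amenable_def
proof (intro ballI allI impI)
  fix X U assume X: "X \<in> M" and U: "kuf U X"
  have "V.isset {x \<in> V.ext U. x \<in> M}"
    by (intro V.isset_Collect V.isset_ext UNIV_I V.definable_Cls V.defterm_var)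
  from V.ext_mk[OF this] obtain A where A: "V.ext A = V.ext U \<inter> M" by blast
  have "\<exists>c\<in>M. V.ext c = V.ext A \<inter> V.ext \<sigma>" if s: "\<sigma> \<in> M" "V.card_less \<sigma> \<kappa>" for \<sigma>
  proof -
    \<comment> \<open>\<open>x\<close> answers correctly whether \<open>B\<close> is in
      \<open>U\<close>; the inclusion clause takes care of members of \<open>\<sigma>\<close> that
      are not subsets of \<open>X\<close>.\<close>
    define R where "R B x \<longleftrightarrow> (B \<in> V.ext U \<longleftrightarrow> x \<in> V.ext B \<and> V.ext B \<subseteq> V.ext X)" for B x
    have R: "V.drel2 R" unfolding V.drel2_def R_def by (intro dfn UNIV_I)
    have "V.ae U X (R B)" for B
    proof (cases "V.ext B \<subseteq> V.ext X")
      case True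
      have d: "V.definable (\<lambda>s. s 0 \<in> V.ext B)" by (intro dfn UNIV_I)
      show ?thesis
      proof (cases "B \<in> V.ext U")
        case inU: True
        then show ?thesis unfolding R_def using mem_ultrafilter_iff[OF True, of U] True by simp
      next
        case False
        then have "V.ae U X (\<lambda>x. x \<notin> V.ext B)"
          using V.ae_not[OF kufD U d] mem_ultrafilter_iff[OF True, of U] by blast
        then show ?thesis unfolding R_def using False True by simp
      qed
    next
      case False
      then have "B \<notin> V.ext U" using V.uf_subset[OF kufD U] by blast
      then show ?thesis unfolding R_def using False by (intro V.ae_True[OF kufD U]) blast
    qed
    then have "V.ae U X (\<lambda>x. \<forall>B\<in>V.ext \<sigma>. R B x)" by (intro V.ae_ball[OF kufD U R UNIV_I s(2)])
    moreover have "V.definable (\<lambda>s. \<forall>B\<in>V.ext \<sigma>. R B (s 0))" by (intro dfn UNIV_I V.drel2D[OF R])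
    ultimately obtain x where x: "x \<in> V.ext X" "\<forall>B\<in>V.ext \<sigma>. R B x"
      using V.ae_ex[OF kufD U, of "\<lambda>x. \<forall>B\<in>V.ext \<sigma>. R B x"] by blast
    have xM: "x \<in> M" using M_trans[OF X x(1)] .
    \<comment> \<open>The point \<open>x\<close> is in \<open>M\<close>, so \<open>M\<close> can
      collect the answers that \<open>x\<close> gives on \<open>\<sigma>\<close>.\<close>
    have i: "I.isset {B \<in> I.ext \<sigma>. x \<in> I.ext B \<and> I.ext B \<subseteq> I.ext X}"
      by (intro I.isset_Collect I.isset_ext s dfn X xM)
    have e: "{B \<in> I.ext \<sigma>. x \<in> I.ext B \<and> I.ext B \<subseteq> I.ext X} = V.ext A \<inter> V.ext \<sigma>"
      unfolding A using x(2) M_trans[OF s(1)] s(1) X unfolding R_def by auto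
    show ?thesis using trans[OF I_mk(2)[OF i] e] I_mk(1)[OF i] by blast
  qed
  then have "A \<in> M" using ap A unfolding approximation_property_def by blast
  then show "\<exists>c\<in>M. V.ext c = V.ext U \<inter> M" using A by blast
qed

text \<open>Serves twice: the trace of this ultrafilter on \<open>M\<close> yields strong
  compactness in \<open>M\<close>, and its image under intersection with \<open>A\<close> yields
  approximation.\<close>

lemma fine_on_PkM:
  assumes cov: "cover_property E \<kappa> M" and a: "a \<in> M"
  shows "\<exists>W. kuf W (PkM a) \<and> (\<forall>x\<in>V.ext a. V.ae W (PkM a) (\<lambda>\<sigma>. E x \<sigma>))"
proof -
  obtain U where U: "kuf U (V.Pk \<kappa> a)" and fine: "\<And>x. x \<in> V.ext a \<Longrightarrow> V.ae U (V.Pk \<kappa> a) (\<lambda>\<sigma>. E x \<sigma>)"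
    using V.fine_exists[OF UNIV_I compact UNIV_I] by blast
  define R where "R \<sigma> \<tau> \<longleftrightarrow> \<tau> \<in> V.ext (PkM a) \<and> V.ext \<sigma> \<subseteq> V.ext \<tau>" for \<sigma> \<tau>
  have R: "V.drel2 R" unfolding V.drel2_def R_def by (intro dfn UNIV_I)
  have "\<exists>\<tau>\<in>UNIV. R \<sigma> \<tau>" if s: "\<sigma> \<in> V.ext (V.Pk \<kappa> a)" for \<sigma>
  proof -
    have s': "V.ext \<sigma> \<subseteq> V.ext a" "V.card_less \<sigma> \<kappa>" using s unfolding V.ext_Pk[OF UNIV_I UNIV_I] by blast+
    then have "V.ext \<sigma> \<subseteq> M" using M_trans[OF a] by blast
    then obtain \<tau> where t: "\<tau> \<in> M" "V.ext \<sigma> \<subseteq> V.ext \<tau>" "V.card_less \<tau> \<kappa>"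
      using cov s'(2) unfolding cover_property_def by blast
    have i: "I.isset (I.ext \<tau> \<inter> I.ext a)" by (intro I.isset_Int I.isset_ext t a)
    define \<tau>' where "\<tau>' = I.mk (I.ext \<tau> \<inter> I.ext a)"
    have t': "\<tau>' \<in> M" "V.ext \<tau>' = V.ext \<tau> \<inter> V.ext a" unfolding \<tau>'_def using I_mk(1,2)[OF i] t(1) a by simp_all
    then have "V.card_less \<tau>' \<kappa>" using V.card_less_subset[OF kufD _ t(3)] by blast
    then have "R \<sigma> \<tau>'" unfolding R_def ext_PkM[OF a] using t' s'(1) t(2) by blast
    then show ?thesis by blast
  qed
  from V.collection_choice[OF R V.isset_ext[OF UNIV_I] this]
  obtain e where e: "V.dfun1 e" "\<And>\<sigma>. \<sigma> \<in> V.ext (V.Pk \<kappa> a) \<Longrightarrow> e \<sigma> \<in> V.ext (PkM a) \<and> V.ext \<sigma> \<subseteq> V.ext (e \<sigma>)"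
    unfolding R_def by blast
  obtain W where W: "kuf W (PkM a)"
    and aeW: "\<And>Q. V.definable (\<lambda>s. Q (s 0)) \<Longrightarrow> V.ae W (PkM a) Q = V.ae U (V.Pk \<kappa> a) (\<lambda>x. Q (e x))"
    using V.pushforward[OF kufD U e(1) UNIV_I, of "PkM a"] e(2) by blast
  have "V.ae W (PkM a) (\<lambda>\<sigma>. E x \<sigma>)" if x: "x \<in> V.ext a" for x
  proof -
    have d: "V.definable (\<lambda>s. E x (s 0))" "V.definable (\<lambda>s. E x (e (s 0)))"
      by (intro dfn UNIV_I V.dfun1D[OF e(1)])+
    have "V.ae U (V.Pk \<kappa> a) (\<lambda>\<sigma>. E x (e \<sigma>))"
      by (rule V.ae_mono[OF kufD U d fine[OF x]]) (use e(2) V.ext_E in blast)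
    then show ?thesis using aeW[OF d(1)] by blast
  qed
  then show ?thesis using W by blast
qed

lemma pseudoground_strongly_compact:
  assumes cov: "cover_property E \<kappa> M" and am: "ultrafilters_amenable E \<kappa> M"
  shows "I.strongly_compact \<kappa>"
  unfolding I.strongly_compact_def
proof (intro conjI ballI impI I_cardinal_k)
  fix l assume l: "l \<in> M"
  obtain W where W: "kuf W (PkM l)" and fine: "\<And>x. x \<in> V.ext l \<Longrightarrow> V.ae W (PkM l) (\<lambda>\<sigma>. E x \<sigma>)"
    using fine_on_PkM[OF cov l] by blast
  obtain c where c: "c \<in> M" "V.ext c = V.ext W \<inter> M" using am I.Pk_in W unfolding ultrafilters_amenable_def by blast
  have "I.ae c (PkM l) (\<lambda>\<sigma>. E x \<sigma>)" if x: "x \<in> I.ext l" for x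
  proof -
    have x': "x \<in> V.ext l" using x I_ext[OF l] by simp
    then have xM: "x \<in> M" using M_trans[OF l] by blast
    have i: "I.isset {\<sigma> \<in> I.ext (PkM l). E x \<sigma>}" by (intro I.isset_Collect I.isset_ext I.Pk_in dfn xM)
    have "V.mk {\<sigma> \<in> V.ext (PkM l). E x \<sigma>} \<in> V.ext W" using fine[OF x'] unfolding V.ae_def .
    then show ?thesis unfolding I.ae_def using I_mk(1,3)[OF i] c by simp
  qed
  then have "I.fine l c (PkM l)" using I.fine_iff[OF I.Pk_in] by blast
  moreover have "I.is_Pk \<kappa> l (PkM l)" using I.is_Pk_iff[OF k_M l I.Pk_in] by blast
  ultimately show "\<exists>X\<in>M. \<exists>U\<in>M. I.is_Pk \<kappa> l X \<and> I.complete_ultrafilter_over \<kappa> U X \<and> I.fine l U X"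
    using restrict_ultrafilter[OF I.Pk_in W c] c(1) I.Pk_in by blast
qed

lemma pseudoground_extend:
  assumes cov: "cover_property E \<kappa> M"
  shows "ultrafilters_extend E \<kappa> M"
  unfolding ultrafilters_extend_def
proof (intro ballI impI)
  fix W X assume W: "W \<in> M" and X: "X \<in> M" and WX: "I.complete_ultrafilter_over \<kappa> W X"
  have kI: "I.Ord \<kappa>" using k_Ord by simp
  note ufI = kI I_cardinal_k W X WX
  have WXs: "V.ext A \<subseteq> V.ext X" if "A \<in> V.ext W" for A
    using I.uf_subset[OF ufI, of A] that W X M_trans[OF W that] by simp
  obtain U where U: "kuf U (V.Pk \<kappa> W)" and fine: "\<And>x. x \<in> V.ext W \<Longrightarrow> V.ae U (V.Pk \<kappa> W) (\<lambda>\<sigma>. E x \<sigma>)"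
    using V.fine_exists[OF UNIV_I compact UNIV_I] by blast
  define R where "R \<sigma> x \<longleftrightarrow> x \<in> V.ext X \<and> (\<forall>A\<in>V.ext \<sigma>. x \<in> V.ext A)" for \<sigma> x
  have R: "V.drel2 R" unfolding V.drel2_def R_def by (intro dfn UNIV_I)
  \<comment> \<open>A subset of \<open>W\<close> that is small in the universe need not be in
    \<open>M\<close>, and \<open>W\<close> is complete only for families in \<open>M\<close>. A
    cover in \<open>M\<close>, cut down to \<open>W\<close>, is such a family and has a common
    point.\<close>
  have "\<exists>x\<in>UNIV. R \<sigma> x" if s: "\<sigma> \<in> V.ext (V.Pk \<kappa> W)" for \<sigma>
  proof -
    have s': "V.ext \<sigma> \<subseteq> V.ext W" "V.card_less \<sigma> \<kappa>" using s unfolding V.ext_Pk[OF UNIV_I UNIV_I] by blast+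
    then have "V.ext \<sigma> \<subseteq> M" using M_trans[OF W] by blast
    then obtain \<tau> where t: "\<tau> \<in> M" "V.ext \<sigma> \<subseteq> V.ext \<tau>" "V.card_less \<tau> \<kappa>"
      using cov s'(2) unfolding cover_property_def by blast
    have i: "I.isset (I.ext \<tau> \<inter> I.ext W)" by (intro I.isset_Int I.isset_ext t W)
    define \<tau>' where "\<tau>' = I.mk (I.ext \<tau> \<inter> I.ext W)"
    have t': "\<tau>' \<in> M" "V.ext \<tau>' = V.ext \<tau> \<inter> V.ext W" unfolding \<tau>'_def using I_mk(1,2)[OF i] t(1) W by simp_all
    then have "V.card_less \<tau>' \<kappa>" using V.card_less_subset[OF kufD _ t(3)] by blast
    then have c: "I.card_less \<tau>' \<kappa>" using I_card_less[OF t'(1)] by blast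
    have d: "I.drel2 (\<lambda>A x. x \<in> I.ext A)" unfolding I.drel2_def by (intro dfn)
    have "I.ae W X (\<lambda>x. \<forall>A\<in>I.ext \<tau>'. x \<in> I.ext A)"
    proof (rule I.ae_ball[OF ufI d t'(1) c])
      fix A assume "A \<in> I.ext \<tau>'"
      then have A: "A \<in> V.ext W" using t' by simp
      then have AM: "A \<in> M" using M_trans[OF W] by blast
      have e: "{x \<in> I.ext X. x \<in> I.ext A} = I.ext A" using WXs[OF A] X AM by auto
      show "I.ae W X (\<lambda>x. x \<in> I.ext A)" unfolding I.ae_def e I.mk_ext[OF AM] using A W by simp
    qed
    moreover have "I.definable (\<lambda>s. \<forall>A\<in>I.ext \<tau>'. s 0 \<in> I.ext A)" by (intro dfn t')
    ultimately obtain x where x: "x \<in> I.ext X" "\<forall>A\<in>I.ext \<tau>'. x \<in> I.ext A"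
      using I.ae_ex[OF ufI, of "\<lambda>x. \<forall>A\<in>I.ext \<tau>'. x \<in> I.ext A"] by blast
    have "x \<in> V.ext A" if A: "A \<in> V.ext \<sigma>" for A
    proof -
      have "A \<in> I.ext \<tau>'" "A \<in> M" using A t' t(2) s'(1) M_trans[OF W, of A] by auto
      then show ?thesis using x(2) I_ext[of A] by blast
    qed
    then have "R \<sigma> x" unfolding R_def using x(1) X by simp
    then show ?thesis by blast
  qed
  from V.collection_choice[OF R V.isset_ext[OF UNIV_I] this]
  obtain e where e: "V.dfun1 e"
    "\<And>\<sigma>. \<sigma> \<in> V.ext (V.Pk \<kappa> W) \<Longrightarrow> e \<sigma> \<in> V.ext X \<and> (\<forall>A\<in>V.ext \<sigma>. e \<sigma> \<in> V.ext A)"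
    unfolding R_def by blast
  obtain Z where Z: "kuf Z X"
    and aeZ: "\<And>Q. V.definable (\<lambda>s. Q (s 0)) \<Longrightarrow> V.ae Z X Q = V.ae U (V.Pk \<kappa> W) (\<lambda>x. Q (e x))"
    using V.pushforward[OF kufD U e(1) UNIV_I, of X] e(2) by blast
  have "A \<in> V.ext Z" if A: "A \<in> V.ext W" for A
  proof -
    have d: "V.definable (\<lambda>s. s 0 \<in> V.ext A)" "V.definable (\<lambda>s. E A (s 0))"
      "V.definable (\<lambda>s. e (s 0) \<in> V.ext A)"
      by (intro dfn UNIV_I V.dfun1D[OF e(1)])+
    have "V.ae U (V.Pk \<kappa> W) (\<lambda>\<sigma>. e \<sigma> \<in> V.ext A)"
      by (rule V.ae_mono[OF kufD U d(2,3) fine[OF A]]) (use e(2) V.ext_E in blast)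
    then show ?thesis using aeZ[OF d(1)] mem_ultrafilter_iff[OF WXs[OF A]] by blast
  qed
  then show "\<exists>U. kuf U X \<and> V.ext W \<subseteq> V.ext U" using Z by blast
qed

section \<open>Regular cardinals of \<open>M\<close> and their cofinality in the universe\<close>

lemma I_regular_Ord: "\<delta> \<in> M \<Longrightarrow> I.regular_cardinal \<delta> \<Longrightarrow> V.Ord \<delta>"
  using I_ordinal unfolding I.regular_cardinal_def I.cardinal_def V.Ord_def by blast

text \<open>An unbounded small set of \<open>M\<close> would be enumerated in \<open>M\<close> with
  a length below \<open>\<kappa>\<close>, against the regularity of \<open>\<delta>\<close> in
  \<open>M\<close>.\<close>

lemma small_bounded:
  assumes d: "\<delta> \<in> M" "I.regular_cardinal \<delta>" "E \<kappa> \<delta>" and t: "\<tau> \<in> M" "V.card_less \<tau> \<kappa>"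
  shows "\<exists>x\<in>V.ext \<delta>. \<forall>y\<in>V.ext \<tau> \<inter> V.ext \<delta>. y \<in> V.ext x"
proof (rule ccontr)
  assume "\<not> ?thesis"
  then have unb: "\<And>x. x \<in> V.ext \<delta> \<Longrightarrow> \<exists>y\<in>V.ext \<tau> \<inter> V.ext \<delta>. y \<notin> V.ext x" by blast
  have od: "V.Ord \<delta>" using I_regular_Ord[OF d(1,2)] .
  have i: "I.isset (I.ext \<tau> \<inter> I.ext \<delta>)" by (intro I.isset_Int I.isset_ext t d)
  define t' where "t' = I.mk (I.ext \<tau> \<inter> I.ext \<delta>)"
  have t': "t' \<in> M" "V.ext t' = V.ext \<tau> \<inter> V.ext \<delta>" unfolding t'_def using I_mk(1,2)[OF i] t(1) d(1) by simp_all
  have "V.card_less t' \<kappa>" using V.card_less_subset[OF kufD _ t(2)] t'(2) by blast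
  then have "I.card_less t' \<kappa>" using I_card_less[OF t'(1)] by blast
  then obtain \<mu> where m: "\<mu> \<in> V.ext \<kappa>" "I.equipotent t' \<mu>" unfolding I.card_less_def using k_M by auto
  have mM: "\<mu> \<in> M" using M_trans[OF k_M m(1)] .
  then have "I.equipotent \<mu> t'" using I.equipotent_sym[OF t'(1) mM m(2)] by blast
  then obtain h where h: "I.dfun1 h" "bij_betw h (V.ext \<mu>) (V.ext t')"
    using I.equipotent_iff[OF mM] mM t'(1) by auto
  have img: "h ` V.ext \<mu> = V.ext \<tau> \<inter> V.ext \<delta>" using bij_betw_imp_surj_on[OF h(2)] t'(2) by simp
  have "\<exists>f\<in>M. I.cofinal_map f \<mu> \<delta>"
  proof (rule I.cofinal_mapI[OF h(1) mM])
    show "h u \<in> I.ext \<delta>" if "u \<in> I.ext \<mu>" for u using that img mM d(1) by auto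
    fix x assume "x \<in> I.ext \<delta>"
    then have x: "x \<in> V.ext \<delta>" using d(1) by simp
    obtain y where y: "y \<in> h ` V.ext \<mu>" "y \<notin> V.ext x" "y \<in> V.ext \<delta>" using unb[OF x] unfolding img by blast
    then obtain u where u: "u \<in> V.ext \<mu>" "y = h u" by blast
    have "x = y \<or> x \<in> V.ext y" using V.Ord_linear[OF V.Ord_elem[OF od x] V.Ord_elem[OF od y(3)]] y(2) by blast
    then have "x = h u \<or> x \<in> I.ext (h u)" using u(2) I_ext[OF M_trans[OF d(1) y(3)]] by simp
    then show "\<exists>u\<in>I.ext \<mu>. x = h u \<or> x \<in> I.ext (h u)" using u(1) I_ext[OF mM] by blast
  qed
  moreover have "\<mu> \<in> I.ext \<delta>" using V.Ord_trans[OF od _ m(1)] d(1,3) V.ext_E by simp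
  ultimately show False using d(2) unfolding I.regular_cardinal_def I.is_cof_def by blast
qed

text \<open>Working form of the cofinality clause. The cofinality exists because the identity is
  cofinal and a least length can be taken.\<close>

lemma large_cofinality_iff:
  assumes od: "V.Ord \<delta>"
  shows "(\<exists>\<beta>. V.is_cof \<beta> \<delta> \<and> (\<beta> = \<kappa> \<or> E \<kappa> \<beta>)) \<longleftrightarrow> (\<forall>\<gamma>\<in>V.ext \<kappa>. \<not> (\<exists>f. V.cofinal_map f \<gamma> \<delta>))"
proof
  assume "\<exists>\<beta>. V.is_cof \<beta> \<delta> \<and> (\<beta> = \<kappa> \<or> E \<kappa> \<beta>)"
  then obtain \<beta> where b: "V.is_cof \<beta> \<delta>" "\<beta> = \<kappa> \<or> \<kappa> \<in> V.ext \<beta>" using V.ext_E by blast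
  then have "V.Ord \<beta>" unfolding V.is_cof_def V.Ord_def by blast
  then have "V.ext \<kappa> \<subseteq> V.ext \<beta>" using b(2) V.Ord_trans by blast
  then show "\<forall>\<gamma>\<in>V.ext \<kappa>. \<not> (\<exists>f. V.cofinal_map f \<gamma> \<delta>)" using b(1) unfolding V.is_cof_def by blast
next
  assume n: "\<forall>\<gamma>\<in>V.ext \<kappa>. \<not> (\<exists>f. V.cofinal_map f \<gamma> \<delta>)"
  have "\<exists>f\<in>UNIV. V.cofinal_map f \<delta> \<delta>" by (rule V.cofinal_mapI[OF V.dfun1_id UNIV_I]) blast+
  moreover have "V.definable (\<lambda>s. \<exists>f\<in>UNIV. V.cofinal_map f (s 0) \<delta>)" by (intro dfn UNIV_I)
  ultimately obtain \<beta> where b: "V.Ord \<beta>" "\<exists>f\<in>UNIV. V.cofinal_map f \<beta> \<delta>"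
    "\<forall>\<gamma>\<in>V.ext \<beta>. \<not> (\<exists>f\<in>UNIV. V.cofinal_map f \<gamma> \<delta>)"
    using V.Ord_least[of "\<lambda>\<beta>. \<exists>f\<in>UNIV. V.cofinal_map f \<beta> \<delta>", OF _ od] by blast
  then have "V.is_cof \<beta> \<delta>" unfolding V.is_cof_def V.Ord_def by blast
  moreover have "\<beta> \<notin> V.ext \<kappa>" using n b(2) by blast
  then have "\<beta> = \<kappa> \<or> E \<kappa> \<beta>" using V.Ord_linear[OF b(1) k_Ord] V.ext_E by blast
  ultimately show "\<exists>\<beta>. V.is_cof \<beta> \<delta> \<and> (\<beta> = \<kappa> \<or> E \<kappa> \<beta>)" by blast
qed

lemma not_cofinal:
  assumes d: "\<delta> \<in> M" "I.regular_cardinal \<delta>" "E \<kappa> \<delta>" and t: "\<tau> \<in> M" "V.card_less \<tau> \<kappa>"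
    and f: "V.cofinal_map f \<gamma> \<delta>" and sub: "\<And>u. u \<in> V.ext \<gamma> \<Longrightarrow> V.app f u \<in> V.ext \<tau>"
  shows False
proof -
  have od: "V.Ord \<delta>" using I_regular_Ord[OF d(1,2)] .
  obtain x where x: "x \<in> V.ext \<delta>" "\<forall>y\<in>V.ext \<tau> \<inter> V.ext \<delta>. y \<in> V.ext x" using small_bounded[OF d t] by blast
  obtain u where u: "u \<in> V.ext \<gamma>" "x = V.app f u \<or> x \<in> V.ext (V.app f u)" using V.cofinal_mapD(2)[OF f x(1)] by blast
  have "V.app f u \<in> V.ext x" using x(2) sub[OF u(1)] V.cofinal_mapD(1)[OF f u(1)] by blast
  then show False using u(2) V.Ord_irrefl V.Ord_asym V.Ord_elem[OF od x(1)] by metis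
qed

text \<open>The range of a short cofinal map is small, and a cover of it in \<open>M\<close> would
  be a small set of \<open>M\<close> unbounded in \<open>\<delta>\<close>.\<close>

lemma cover_large_cofinality:
  assumes cov: "cover_property E \<kappa> M" shows "regulars_have_large_cofinality E \<kappa> M"
  unfolding regulars_have_large_cofinality_def
proof (intro ballI impI, elim conjE)
  fix \<delta> assume d: "\<delta> \<in> M" "I.regular_cardinal \<delta>" "E \<kappa> \<delta>"
  have "\<not> V.cofinal_map f \<gamma> \<delta>" if g: "\<gamma> \<in> V.ext \<kappa>" for f \<gamma>
  proof
    assume f: "V.cofinal_map f \<gamma> \<delta>"
    define r where "r = V.mk (V.app f ` V.ext \<gamma>)"
    have er: "V.ext r = V.app f ` V.ext \<gamma>"
      unfolding r_def by (intro V.ext_mk V.isset_image V.dfun1_app V.isset_ext UNIV_I)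
    have "V.ext r \<subseteq> M" unfolding er using V.cofinal_mapD(1)[OF f] M_trans[OF d(1)] by blast
    moreover have "V.card_less r \<kappa>" unfolding r_def
      by (rule V.card_less_image[OF k_Ord k_card UNIV_I V.dfun1_app[OF UNIV_I] V.card_less_elem[OF k_Ord k_card g]])
    ultimately obtain \<tau> where t: "\<tau> \<in> M" "V.ext r \<subseteq> V.ext \<tau>" "V.card_less \<tau> \<kappa>"
      using cov unfolding cover_property_def by blast
    show False by (rule not_cofinal[OF d t(1,3) f]) (use t(2) er in blast)
  qed
  then show "\<exists>\<beta>. V.is_cof \<beta> \<delta> \<and> (\<beta> = \<kappa> \<or> E \<kappa> \<beta>)"
    using large_cofinality_iff[OF I_regular_Ord[OF d(1,2)]] by blast
qed

text \<open>A fine ultrafilter of \<open>M\<close> on small subsets of \<open>\<delta>\<close>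
  extends to the universe, where completeness puts all values of a short map into one
  \<open>\<sigma>\<close>. That \<open>\<sigma>\<close> is a small element of \<open>M\<close>,
  hence bounded in \<open>\<delta>\<close>.\<close>

lemma extend_large_cofinality:
  assumes sc: "I.strongly_compact \<kappa>" and ex: "ultrafilters_extend E \<kappa> M"
  shows "regulars_have_large_cofinality E \<kappa> M"
  unfolding regulars_have_large_cofinality_def
proof (intro ballI impI, elim conjE)
  fix \<delta> assume d: "\<delta> \<in> M" "I.regular_cardinal \<delta>" "E \<kappa> \<delta>"
  have "I.cardinal \<delta>" using d(2) unfolding I.regular_cardinal_def by blast
  moreover have "\<kappa> \<in> I.ext \<delta>" using d V.ext_E by simp
  ultimately obtain W where W: "W \<in> M" "I.complete_ultrafilter_over \<kappa> W (PkM \<delta>)"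
    and fine: "\<And>\<alpha>. \<alpha> \<in> I.ext \<delta> \<Longrightarrow> I.ae W (PkM \<delta>) (\<lambda>\<sigma>. E \<alpha> \<sigma>)"
    using I.sc_fine[OF k_M sc d(1)] by blast
  obtain U where U: "kuf U (PkM \<delta>)" "V.ext W \<subseteq> V.ext U" using ex W I.Pk_in unfolding ultrafilters_extend_def by blast
  have fineU: "V.ae U (PkM \<delta>) (\<lambda>\<sigma>. E \<alpha> \<sigma>)" if a: "\<alpha> \<in> V.ext \<delta>" for \<alpha>
  proof -
    have aM: "\<alpha> \<in> M" using M_trans[OF d(1) a] .
    have i: "I.isset {\<sigma> \<in> I.ext (PkM \<delta>). E \<alpha> \<sigma>}" by (intro I.isset_Collect I.isset_ext I.Pk_in dfn aM)
    have "I.mk {\<sigma> \<in> I.ext (PkM \<delta>). E \<alpha> \<sigma>} \<in> V.ext W" using fine[of \<alpha>] a d(1) W(1) unfolding I.ae_def by simp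
    then show ?thesis unfolding V.ae_def using U(2) I_mk(3)[OF i] by auto
  qed
  have "\<not> V.cofinal_map f \<gamma> \<delta>" if g: "\<gamma> \<in> V.ext \<kappa>" for f \<gamma>
  proof
    assume f: "V.cofinal_map f \<gamma> \<delta>"
    have dr: "V.drel2 (\<lambda>u \<sigma>. E (V.app f u) \<sigma>)" unfolding V.drel2_def by (intro dfn UNIV_I)
    have "V.ae U (PkM \<delta>) (\<lambda>\<sigma>. \<forall>u\<in>V.ext \<gamma>. E (V.app f u) \<sigma>)"
      by (rule V.ae_ball[OF kufD U(1) dr UNIV_I V.card_less_elem[OF k_Ord k_card g]])
        (rule fineU[OF V.cofinal_mapD(1)[OF f]])
    moreover have "V.definable (\<lambda>s. \<forall>u\<in>V.ext \<gamma>. E (V.app f u) (s 0))" by (intro dfn UNIV_I)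
    ultimately obtain \<sigma> where s: "\<sigma> \<in> V.ext (PkM \<delta>)" "\<forall>u\<in>V.ext \<gamma>. E (V.app f u) \<sigma>"
      using V.ae_ex[OF kufD U(1), of "\<lambda>\<sigma>. \<forall>u\<in>V.ext \<gamma>. E (V.app f u) \<sigma>"] by blast
    have s': "\<sigma> \<in> M" "V.card_less \<sigma> \<kappa>" using s(1) unfolding ext_PkM[OF d(1)] by blast+
    show False by (rule not_cofinal[OF d s' f]) (use s(2) V.ext_E in blast)
  qed
  then show "\<exists>\<beta>. V.is_cof \<beta> \<delta> \<and> (\<beta> = \<kappa> \<or> E \<kappa> \<beta>)"
    using large_cofinality_iff[OF I_regular_Ord[OF d(1,2)]] by blast
qed

lemma amenable_approximation:
  assumes cov: "cover_property E \<kappa> M" and am: "ultrafilters_amenable E \<kappa> M"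
  shows "approximation_property E \<kappa> M"
  unfolding approximation_property_def
proof (intro allI impI, elim conjE)
  fix A assume AM: "V.ext A \<subseteq> M"
    and approx: "\<forall>\<sigma>\<in>M. V.card_less \<sigma> \<kappa> \<longrightarrow> (\<exists>c\<in>M. V.ext c = V.ext A \<inter> V.ext \<sigma>)"
  obtain a where a: "a \<in> M" "V.ext A \<subseteq> V.ext a" using bounded_in_M[OF AM] by blast
  obtain W where W: "kuf W (PkM a)" and fine: "\<And>x. x \<in> V.ext a \<Longrightarrow> V.ae W (PkM a) (\<lambda>\<sigma>. E x \<sigma>)"
    using fine_on_PkM[OF cov a(1)] by blast
  define f where "f \<sigma> = V.mk (V.ext A \<inter> V.ext \<sigma>)" for \<sigma>
  have f: "V.dfun1 f" unfolding V.dfun1_def f_def by (intro dfn UNIV_I)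
  have ef: "V.ext (f \<sigma>) = V.ext A \<inter> V.ext \<sigma>" for \<sigma>
    unfolding f_def by (intro V.ext_mk V.isset_Int V.isset_ext UNIV_I)
  \<comment> \<open>The approximation hypothesis enters here: \<open>A \<inter> \<sigma>\<close> is
    an element of \<open>M\<close>, so the image ultrafilter lives on a set of \<open>M\<close> and
    amenability applies to it.\<close>
  have fP: "f \<sigma> \<in> V.ext (PkM a)" if s: "\<sigma> \<in> V.ext (PkM a)" for \<sigma>
  proof -
    have s': "\<sigma> \<in> M" "V.ext \<sigma> \<subseteq> V.ext a" "V.card_less \<sigma> \<kappa>" using s unfolding ext_PkM[OF a(1)] by blast+
    then obtain c where "c \<in> M" "V.ext c = V.ext A \<inter> V.ext \<sigma>" using approx by blast
    then have "f \<sigma> \<in> M" unfolding f_def using V.mk_ext[OF UNIV_I, of c] by simp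
    moreover have "V.card_less (f \<sigma>) \<kappa>" using V.card_less_subset[OF kufD _ s'(3), of "f \<sigma>"] ef by blast
    ultimately show ?thesis unfolding ext_PkM[OF a(1)] using ef s'(2) by blast
  qed
  obtain Z where Z: "kuf Z (PkM a)"
    and aeZ: "\<And>Q. V.definable (\<lambda>s. Q (s 0)) \<Longrightarrow> V.ae Z (PkM a) Q = V.ae W (PkM a) (\<lambda>x. Q (f x))"
    using V.pushforward[OF kufD W f UNIV_I, of "PkM a"] fP by blast
  obtain c where c: "c \<in> M" "V.ext c = V.ext Z \<inter> M"
    using am I.Pk_in Z unfolding ultrafilters_amenable_def by blast
  \<comment> \<open>\<open>S x\<close> is formed in \<open>M\<close>. It is large for the image
    ultrafilter exactly when \<open>x\<close> lies in \<open>A \<inter> \<sigma>\<close> for almost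
    all \<open>\<sigma>\<close>, and by fineness this singles out the elements of
    \<open>A\<close>.\<close>
  define S where "S x = I.mk {\<tau> \<in> I.ext (PkM a). E x \<tau>}" for x
  have iB: "I.isset {x \<in> I.ext a. S x \<in> I.ext c}"
    unfolding S_def by (intro I.isset_Collect I.isset_ext dfn I.Pk_in a c)
  have "x \<in> V.ext A \<longleftrightarrow> x \<in> I.ext a \<and> S x \<in> I.ext c" for x
  proof (cases "x \<in> V.ext a")
    case True
    have xM: "x \<in> M" using M_trans[OF a(1) True] .
    have i: "I.isset {\<tau> \<in> I.ext (PkM a). E x \<tau>}" by (intro I.isset_Collect I.isset_ext I.Pk_in dfn xM)
    have d: "V.definable (\<lambda>s. E x (s 0))" "V.definable (\<lambda>s. E x (f (s 0)))"
      by (intro dfn UNIV_I V.dfun1D[OF f])+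
    have "S x \<in> V.ext c \<longleftrightarrow> V.ae Z (PkM a) (\<lambda>\<tau>. E x \<tau>)"
      unfolding V.ae_def S_def c(2) using I_mk(1,3)[OF i] by simp
    also have "\<dots> \<longleftrightarrow> V.ae W (PkM a) (\<lambda>\<sigma>. E x (f \<sigma>))" using aeZ[OF d(1)] .
    also have "\<dots> \<longleftrightarrow> x \<in> V.ext A"
    proof
      assume "V.ae W (PkM a) (\<lambda>\<sigma>. E x (f \<sigma>))"
      then obtain \<sigma> where "E x (f \<sigma>)" using V.ae_ex[OF kufD W d(2)] by blast
      then show "x \<in> V.ext A" using ef V.ext_E by blast
    next
      assume x: "x \<in> V.ext A"
      show "V.ae W (PkM a) (\<lambda>\<sigma>. E x (f \<sigma>))"
        by (rule V.ae_mono[OF kufD W d fine[OF True]]) (use x ef V.ext_E in blast)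
    qed
    finally show ?thesis using True a(1) c(1) by simp
  next
    case False
    then show ?thesis using a by auto
  qed
  then have "V.ext A = {x \<in> I.ext a. S x \<in> I.ext c}" by blast
  then have "A = I.mk {x \<in> I.ext a. S x \<in> I.ext c}" using I_mk(3)[OF iB] V.mk_ext[OF UNIV_I, of A] by simp
  then show "A \<in> M" using I_mk(1)[OF iB] by simp
qed

section \<open>The cover property from large cofinalities\<close>

text \<open>The case that \<open>\<kappa>\<close> is the least limit ordinal: every ordinal below it
  is 0 or a successor, and small sets are built by adding one element at a time. The induction
  predicate mentions \<open>M\<close>, which the universe admits as a class.\<close>

lemma finite_sets_in_M:
  assumes noLim: "\<And>\<theta>. \<theta> \<in> V.ext \<kappa> \<Longrightarrow> \<not> V.Lim \<theta>" and s: "V.ext \<sigma> \<subseteq> M" "V.card_less \<sigma> \<kappa>"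
  shows "\<sigma> \<in> M"
proof -
  have main: "n \<in> V.ext \<kappa> \<longrightarrow> (\<forall>\<sigma>\<in>UNIV. (\<forall>y\<in>V.ext \<sigma>. y \<in> M) \<and> V.injects \<sigma> n \<longrightarrow> \<sigma> \<in> M)" if "V.Ord n" for n
  proof (rule V.Ord_induct[OF _ _ that])
    show "V.definable (\<lambda>s. s 0 \<in> V.ext \<kappa> \<longrightarrow> (\<forall>\<sigma>\<in>UNIV. (\<forall>y\<in>V.ext \<sigma>. y \<in> M) \<and> V.injects \<sigma> (s 0) \<longrightarrow> \<sigma> \<in> M))"
      by (intro dfn V.definable_Cls UNIV_I)
    fix n assume n: "V.Ord n" and IH: "\<And>m. m \<in> V.ext n \<Longrightarrow> m \<in> V.ext \<kappa> \<longrightarrow>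
      (\<forall>\<sigma>\<in>UNIV. (\<forall>y\<in>V.ext \<sigma>. y \<in> M) \<and> V.injects \<sigma> m \<longrightarrow> \<sigma> \<in> M)"
    show "n \<in> V.ext \<kappa> \<longrightarrow> (\<forall>\<sigma>\<in>UNIV. (\<forall>y\<in>V.ext \<sigma>. y \<in> M) \<and> V.injects \<sigma> n \<longrightarrow> \<sigma> \<in> M)"
    proof (intro impI ballI, elim conjE)
      fix \<sigma> assume nk: "n \<in> V.ext \<kappa>" and sM: "\<forall>y\<in>V.ext \<sigma>. y \<in> M" and inj: "V.injects \<sigma> n"
      then obtain h where h: "V.dfun1 h" "inj_on h (V.ext \<sigma>)" "h ` V.ext \<sigma> \<subseteq> V.ext n" unfolding V.injects_def by blast
      show "\<sigma> \<in> M"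
      proof (cases "V.ext n = {}")
        case True
        then have "V.ext \<sigma> = {}" using h(3) by blast
        then have "\<sigma> = I.mk {}" using I_mk(3)[OF I.isset_empty] V.mk_ext[OF UNIV_I, of \<sigma>] by simp
        then show ?thesis using I_mk(1)[OF I.isset_empty] by simp
      next
        case False
        then obtain m where m: "m \<in> V.ext n" "V.osucc m \<notin> V.ext n"
          using noLim[OF nk] n V.Ord_empty_mem[OF n] unfolding V.Lim_def by blast
        have en: "V.ext n = insert m (V.ext m)" using V.osucc_mem[OF n m(1)] m(2) V.ext_osucc[OF UNIV_I, of m] by metis
        have mk: "m \<in> V.ext \<kappa>" using V.Ord_trans[OF k_Ord nk m(1)] .
        have small: "\<rho> \<in> M" if "V.ext \<rho> \<subseteq> V.ext \<sigma>" "V.injects \<rho> m" for \<rho>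
          using IH[OF m(1)] mk that sM by blast
        show ?thesis
        proof (cases "m \<in> h ` V.ext \<sigma>")
          case False
          then have "V.injects \<sigma> m" using h(3) unfolding en by (intro V.injectsI[OF h(1,2)]) blast
          then show ?thesis using small by blast
        next
          case True
          then obtain x where x: "x \<in> V.ext \<sigma>" "m = h x" by blast
          define \<rho> where "\<rho> = V.mk (V.ext \<sigma> - {x})"
          have "V.isset {x}" by (intro V.isset_insert V.isset_empty UNIV_I)
          then have er: "V.ext \<rho> = V.ext \<sigma> - {x}" unfolding \<rho>_def by (intro V.ext_mk V.isset_Diff V.isset_ext UNIV_I)
          have "V.injects \<rho> m"
          proof (rule V.injectsI[OF h(1)])
            show "inj_on h (V.ext \<rho>)" by (rule inj_on_subset[OF h(2)]) (use er in blast)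
            fix y assume "y \<in> V.ext \<rho>"
            then have y: "y \<in> V.ext \<sigma>" "y \<noteq> x" unfolding er by blast+
            then have "h y \<noteq> m" using inj_onD[OF h(2) _ y(1) x(1)] x(2) by blast
            then show "h y \<in> V.ext m" using h(3) y(1) unfolding en by blast
          qed
          then have rM: "\<rho> \<in> M" using small er by blast
          have i: "I.isset (insert x (I.ext \<rho>))" using sM x(1) by (intro I.isset_insert I.isset_ext rM) blast
          have "insert x (I.ext \<rho>) = V.ext \<sigma>" using I_ext[OF rM] er x(1) by blast
          then have "\<sigma> = I.mk (insert x (I.ext \<rho>))" using I_mk(3)[OF i] V.mk_ext[OF UNIV_I, of \<sigma>] by simp
          then show ?thesis using I_mk(1)[OF i] by simp
        qed
      qed
    qed
  qed
  obtain \<alpha> where "\<alpha> \<in> V.ext \<kappa>" "V.injects \<sigma> \<alpha>" using s(2) V.card_less_iff[OF k_Ord k_card UNIV_I] by blast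
  then show ?thesis using main[OF V.Ord_elem[OF k_Ord]] s(1) by blast
qed

text \<open>Let \<open>\<mu>\<close> be the cofinality of \<open>\<xi>\<close> in \<open>M\<close>.
  If it were not below \<open>\<kappa>\<close>, it would be a regular cardinal of \<open>M\<close>,
  and the short cofinal map into \<open>\<xi>\<close> would induce a short cofinal map into
  \<open>\<mu>\<close> in the universe.\<close>

lemma small_cofinality_in_M:
  assumes reg: "regulars_have_large_cofinality E \<kappa> M"
    and x: "V.Ord \<xi>" and g: "\<gamma> \<in> V.ext \<kappa>" and f: "V.cofinal_map f \<gamma> \<xi>"
  shows "\<exists>\<mu>\<in>V.ext \<kappa>. \<exists>c\<in>M. I.cofinal_map c \<mu> \<xi>"
proof -
  have xM: "\<xi> \<in> M" using Ord_M[OF x] .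
  have k0: "V.mk {} \<in> V.ext \<kappa>" and ks: "\<And>x. x \<in> V.ext \<kappa> \<Longrightarrow> V.osucc x \<in> V.ext \<kappa>"
    using k_Lim unfolding V.Lim_def by blast+
  have ex: "\<exists>c\<in>M. I.cofinal_map c \<xi> \<xi>" by (rule I.cofinal_mapI[OF I.dfun1_id xM]) blast+
  have ox: "I.Ord \<xi>" using x by simp
  have "I.definable (\<lambda>s. \<exists>c\<in>M. I.cofinal_map c (s 0) \<xi>)" by (intro dfn xM)
  from I.Ord_least[of "\<lambda>\<mu>. \<exists>c\<in>M. I.cofinal_map c \<mu> \<xi>", OF this ox ex]
  obtain \<mu> where m': "I.Ord \<mu>" "\<exists>c\<in>M. I.cofinal_map c \<mu> \<xi>"
    and min': "\<forall>\<nu>\<in>I.ext \<mu>. \<not> (\<exists>c\<in>M. I.cofinal_map c \<nu> \<xi>)"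
    by blast
  have m: "V.Ord \<mu>" "\<exists>c\<in>M. I.cofinal_map c \<mu> \<xi>" using m' by simp_all
  have mM: "\<mu> \<in> M" using Ord_M[OF m(1)] .
  have min: "\<not> (\<exists>c\<in>M. I.cofinal_map c \<nu> \<xi>)" if "\<nu> \<in> V.ext \<mu>" for \<nu> using min' that I_ext[OF mM] by simp
  obtain c where c: "c \<in> M" "I.cofinal_map c \<mu> \<xi>" using m(2) by blast
  have cx: "I.app c u \<in> V.ext \<xi>" if "u \<in> V.ext \<mu>" for u
    using I.cofinal_mapD(1)[OF c(2), of u] that I_ext[OF mM] I_ext[OF xM] by simp
  have ccof: "\<exists>u\<in>V.ext \<mu>. y = I.app c u \<or> y \<in> V.ext (I.app c u)" if "y \<in> V.ext \<xi>" for y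
    using I.cofinal_mapD(2)[OF c(2), of y] that I_ext[OF mM] I_ext[OF xM] I_ext[OF I.app_in] by simp
  \<comment> \<open>Minimality of \<open>\<mu>\<close>: a function of \<open>M\<close> on a shorter
    length that were unbounded in \<open>\<xi>\<close> would be a cofinal map.\<close>
  have bounded: "\<exists>y\<in>V.ext \<xi>. \<forall>u\<in>V.ext \<nu>. h u \<in> V.ext y"
    if n: "\<nu> \<in> V.ext \<mu>" and h: "I.dfun1 h" "\<And>u. u \<in> V.ext \<nu> \<Longrightarrow> h u \<in> V.ext \<xi>" for \<nu> h
  proof (rule ccontr)
    assume nb: "\<not> ?thesis"
    have nM: "\<nu> \<in> M" using M_trans[OF mM n] .
    have "\<exists>f\<in>M. I.cofinal_map f \<nu> \<xi>"
    proof (rule I.cofinal_mapI[OF h(1) nM])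
      show "h u \<in> I.ext \<xi>" if "u \<in> I.ext \<nu>" for u using that h(2) I_ext[OF nM] I_ext[OF xM] by simp
      fix y assume "y \<in> I.ext \<xi>"
      then have y: "y \<in> V.ext \<xi>" using I_ext[OF xM] by simp
      obtain u where u: "u \<in> V.ext \<nu>" "h u \<notin> V.ext y" using nb y by blast
      have "y = h u \<or> y \<in> V.ext (h u)"
        using V.Ord_linear[OF V.Ord_elem[OF x y] V.Ord_elem[OF x h(2)[OF u(1)]]] u(2) by blast
      then have "y = h u \<or> y \<in> I.ext (h u)" using I_ext[OF M_trans[OF xM h(2)[OF u(1)]]] by simp
      then show "\<exists>u\<in>I.ext \<nu>. y = h u \<or> y \<in> I.ext (h u)" using u(1) I_ext[OF nM] by blast
    qed
    then show False using min[OF n] by blast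
  qed
  have "\<mu> \<in> V.ext \<kappa>"
  proof (rule ccontr)
    assume nk: "\<mu> \<notin> V.ext \<kappa>"
    then have km: "V.ext \<kappa> \<subseteq> V.ext \<mu>" using V.Ord_not_mem[OF m(1) k_Ord] by blast
    \<comment> \<open>\<open>z\<close> and \<open>o1\<close> are 0 and 1. Bounding functions with
      domain 1 shows that \<open>\<xi>\<close> has no largest element.\<close>
    define z where "z = V.mk {}"
    have z: "z \<in> V.ext \<mu>" "V.ext z = {}" using km k0 unfolding z_def by auto
    define o1 where "o1 = V.osucc z"
    have eo: "V.ext o1 = {z}" unfolding o1_def using V.ext_osucc[OF UNIV_I, of z] z(2) by simp
    have o1: "o1 \<in> V.ext \<mu>" unfolding o1_def using km ks[OF k0] unfolding z_def by blast
    have noMax: "\<exists>y'\<in>V.ext \<xi>. y \<in> V.ext y'" if y: "y \<in> V.ext \<xi>" for y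
      using bounded[OF o1, of "\<lambda>u. y"] y unfolding eo I.dfun1_def
      using I.defterm_const[OF M_trans[OF xM y]] by blast
    \<comment> \<open>If \<open>\<mu>\<close> had a last element \<open>u\<close>, the values of
      \<open>c\<close> before \<open>u\<close> and at \<open>u\<close> would have a common strict
      bound in \<open>\<xi>\<close>, against cofinality of \<open>c\<close>.\<close>
    have succ: "V.osucc u \<in> V.ext \<mu>" if u: "u \<in> V.ext \<mu>" for u
    proof (rule ccontr)
      assume "V.osucc u \<notin> V.ext \<mu>"
      then have "\<mu> = V.osucc u" using V.osucc_mem[OF m(1) u] by blast
      then have em: "V.ext \<mu> = insert u (V.ext u)" using V.ext_osucc[OF UNIV_I, of u] by simp
      have "v \<in> V.ext \<mu>" if "v \<in> V.ext u" for v using that em by blast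
      then obtain y0 where y0: "y0 \<in> V.ext \<xi>" "\<forall>v\<in>V.ext u. I.app c v \<in> V.ext y0"
        using bounded[OF u I.dfun1_app[OF c(1)]] cx by blast
      obtain y1 where y1: "y1 \<in> V.ext \<xi>" "I.app c u \<in> V.ext y1" using noMax[OF cx[OF u]] by blast
      obtain y where y: "y \<in> V.ext \<xi>" "V.ext y0 \<subseteq> V.ext y" "V.ext y1 \<subseteq> V.ext y"
      proof (cases "V.ext y0 \<subseteq> V.ext y1")
        case True then show ?thesis using that[OF y1(1)] by blast
      next
        case False
        then have "V.ext y1 \<subseteq> V.ext y0"
          using V.Ord_subset_iff V.Ord_not_mem V.Ord_elem[OF x y0(1)] V.Ord_elem[OF x y1(1)] by metis
        then show ?thesis using that[OF y0(1)] by blast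
      qed
      have all: "I.app c v \<in> V.ext y" if "v \<in> V.ext \<mu>" for v using that y0(2) y1(2) y(2,3) unfolding em by blast
      have oy: "V.Ord y" using V.Ord_elem[OF x y(1)] .
      obtain v where v: "v \<in> V.ext \<mu>" "y = I.app c v \<or> y \<in> V.ext (I.app c v)" using ccof[OF y(1)] by blast
      then show False using all[OF v(1)] V.Ord_irrefl[OF oy] V.Ord_asym[OF oy] by metis
    qed
    have lim: "\<exists>y\<in>V.ext \<mu>. E u y" if u: "u \<in> V.ext \<mu>" for u
    proof (rule bexI[OF _ succ[OF u]])
      have "u \<in> V.ext (V.osucc u)" using V.ext_osucc[OF UNIV_I, of u] by blast
      then show "E u (V.osucc u)" using V.ext_E by blast
    qed
    have nocof: "\<not> (\<exists>f\<in>M. I.cofinal_map f \<nu> \<mu>)" if n: "\<nu> \<in> V.ext \<mu>" for \<nu>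
    proof
      assume "\<exists>f\<in>M. I.cofinal_map f \<nu> \<mu>"
      then obtain h where h: "h \<in> M" "I.cofinal_map h \<nu> \<mu>" by blast
      have nM: "\<nu> \<in> M" using M_trans[OF mM n] .
      have hm: "I.app h w \<in> V.ext \<mu>" if "w \<in> V.ext \<nu>" for w
        using I.cofinal_mapD(1)[OF h(2), of w] that I_ext[OF nM] I_ext[OF mM] by simp
      \<comment> \<open>Bounds for \<open>c\<close> on the segments up to \<open>h w\<close> form a
        sequence of length \<open>\<nu>\<close>. Minimality of \<open>\<mu>\<close> bounds it in
        \<open>\<xi>\<close>, and since \<open>h\<close> is cofinal this bounds all of
        \<open>c\<close>.\<close>
      define R where "R w y \<longleftrightarrow> y \<in> I.ext \<xi> \<and> (\<forall>v\<in>I.ext (I.osucc (I.app h w)). I.app c v \<in> I.ext y)" for w y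
      have R: "I.drel2 R" unfolding I.drel2_def R_def by (intro dfn xM h(1) c(1))
      have eos: "I.ext (I.osucc (I.app h w)) = V.ext (V.osucc (I.app h w))" for w
        using I.ext_osucc[OF I.app_in] V.ext_osucc[OF UNIV_I] I_ext[OF I.app_in] by simp
      have "\<exists>y\<in>M. R w y" if w: "w \<in> I.ext \<nu>" for w
      proof -
        have s: "V.osucc (I.app h w) \<in> V.ext \<mu>" using succ[OF hm] w I_ext[OF nM] by simp
        obtain y where y: "y \<in> V.ext \<xi>" "\<forall>v\<in>V.ext (V.osucc (I.app h w)). I.app c v \<in> V.ext y"
          using bounded[OF s I.dfun1_app[OF c(1)]] cx V.Ord_trans[OF m(1) s] by blast
        have "y \<in> M" using M_trans[OF xM y(1)] .
        moreover have "R w y" unfolding R_def eos using y I_ext[OF xM] I_ext[OF \<open>y \<in> M\<close>] by simp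
        ultimately show ?thesis by blast
      qed
      from I.collection_choice[OF R I.isset_ext[OF nM] this]
      obtain e where e: "I.dfun1 e" "\<And>w. w \<in> V.ext \<nu> \<Longrightarrow> R w (e w)" using I_ext[OF nM] by auto
      have ex: "e w \<in> V.ext \<xi>" if "w \<in> V.ext \<nu>" for w using e(2)[OF that] I_ext[OF xM] unfolding R_def by simp
      obtain y where y: "y \<in> V.ext \<xi>" "\<forall>w\<in>V.ext \<nu>. e w \<in> V.ext y" using bounded[OF n e(1) ex] by blast
      have oy: "V.Ord y" using V.Ord_elem[OF x y(1)] .
      obtain v where v: "v \<in> V.ext \<mu>" "y = I.app c v \<or> y \<in> V.ext (I.app c v)" using ccof[OF y(1)] by blast
      obtain w where w: "w \<in> V.ext \<nu>" "v = I.app h w \<or> v \<in> V.ext (I.app h w)"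
        using I.cofinal_mapD(2)[OF h(2), of v] v(1) I_ext[OF nM] I_ext[OF mM] I_ext[OF I.app_in] by auto
      have "v \<in> I.ext (I.osucc (I.app h w))" unfolding eos V.ext_osucc[OF UNIV_I] using w(2) by blast
      then have "I.app c v \<in> I.ext (e w)" using e(2)[OF w(1)] unfolding R_def by blast
      then have "I.app c v \<in> V.ext (e w)" using I_ext[OF M_trans[OF xM ex[OF w(1)]]] by simp
      then have "I.app c v \<in> V.ext y" using V.Ord_trans[OF oy] y(2) w(1) by blast
      then show False using v(2) V.Ord_irrefl[OF oy] V.Ord_asym[OF oy] by metis
    qed
    have card: "I.cardinal \<mu>" unfolding I.cardinal_def
    proof (intro conjI ballI)
      show "I.ordinal \<mu>" using m(1) I_ordinal[OF mM] unfolding V.Ord_def by blast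
      fix \<nu> assume "\<nu> \<in> I.ext \<mu>"
      then have n: "\<nu> \<in> V.ext \<mu>" using I_ext[OF mM] by simp
      have nM: "\<nu> \<in> M" using M_trans[OF mM n] .
      show "\<not> I.equipotent \<nu> \<mu>"
      proof
        assume "I.equipotent \<nu> \<mu>"
        then obtain h where h: "I.dfun1 h" "bij_betw h (I.ext \<nu>) (I.ext \<mu>)" using I.equipotent_iff[OF nM] by blast
        have img: "h ` I.ext \<nu> = I.ext \<mu>" using bij_betw_imp_surj_on[OF h(2)] .
        have "\<exists>f\<in>M. I.cofinal_map f \<nu> \<mu>"
        proof (rule I.cofinal_mapI[OF h(1) nM])
          show "h u \<in> I.ext \<mu>" if "u \<in> I.ext \<nu>" for u using that img by blast
          show "\<exists>u\<in>I.ext \<nu>. y = h u \<or> y \<in> I.ext (h u)" if "y \<in> I.ext \<mu>" for y using that unfolding img[symmetric] by blast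
        qed
        then show False using nocof[OF n] by blast
      qed
    qed
    have idc: "\<exists>f\<in>M. I.cofinal_map f \<mu> \<mu>" by (rule I.cofinal_mapI[OF I.dfun1_id mM]) blast+
    have "I.regular_cardinal \<mu>"
      unfolding I.regular_cardinal_def I.is_cof_def I_ext[OF mM]
      using card idc nocof lim z(1) unfolding I.cardinal_def by blast
    have cV: "V.cofinal_map c \<mu> \<xi>" using c I_cofinal_map[OF c(1) mM xM] by blast
    \<comment> \<open>\<open>q u\<close> is an index at which \<open>c\<close> reaches
      \<open>f u\<close> or more. As the values of \<open>f\<close> are cofinal in
      \<open>\<xi>\<close>, these indices are cofinal in \<open>\<mu>\<close>.\<close>
    define Q where "Q u v \<longleftrightarrow> v \<in> V.ext \<mu> \<and> (V.app f u = V.app c v \<or> V.app f u \<in> V.ext (V.app c v))" for u v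
    have Q: "V.drel2 Q" unfolding V.drel2_def Q_def by (intro dfn UNIV_I)
    have "\<exists>v\<in>UNIV. Q u v" if u: "u \<in> V.ext \<gamma>" for u
      using V.cofinal_mapD(2)[OF cV V.cofinal_mapD(1)[OF f u]] unfolding Q_def by blast
    from V.collection_choice[OF Q V.isset_ext[OF UNIV_I] this]
    obtain q where q: "V.dfun1 q" "\<And>u. u \<in> V.ext \<gamma> \<Longrightarrow> Q u (q u)" by blast
    have qcof: "\<exists>f\<in>UNIV. V.cofinal_map f \<gamma> \<mu>"
    proof (rule V.cofinal_mapI[OF q(1) UNIV_I])
      show "q u \<in> V.ext \<mu>" if "u \<in> V.ext \<gamma>" for u using q(2)[OF that] unfolding Q_def by blast
      fix v assume v: "v \<in> V.ext \<mu>"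
      show "\<exists>u\<in>V.ext \<gamma>. v = q u \<or> v \<in> V.ext (q u)"
      proof (rule ccontr)
        assume nq: "\<not> ?thesis"
        have vm: "w \<in> V.ext \<mu>" if "w \<in> V.ext v" for w using V.Ord_trans[OF m(1) v that] .
        obtain y where y: "y \<in> V.ext \<xi>" "\<forall>w\<in>V.ext v. I.app c w \<in> V.ext y"
          using bounded[OF v I.dfun1_app[OF c(1)]] cx vm by blast
        have oy: "V.Ord y" using V.Ord_elem[OF x y(1)] .
        obtain u where u: "u \<in> V.ext \<gamma>" "y = V.app f u \<or> y \<in> V.ext (V.app f u)" using V.cofinal_mapD(2)[OF f y(1)] by blast
        have qu: "q u \<in> V.ext \<mu>" using q(2)[OF u(1)] unfolding Q_def by blast
        have qv: "q u \<in> V.ext v" using nq u(1) V.Ord_linear[OF V.Ord_elem[OF m(1) v] V.Ord_elem[OF m(1) qu]] by blast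
        have same: "V.app c (q u) = I.app c (q u)"
        proof -
          have fI: "I.is_function c \<mu> \<xi>" using c(2) unfolding I.cofinal_map_def by blast
          then have fV: "V.is_function c \<mu> \<xi>" using I_is_function[OF c(1) mM xM] by blast
          have "I.maps_to c (q u) (I.app c (q u))"
            using I.is_function_maps_to[OF fI M_trans[OF mM qu] I.app_in] qu I_ext[OF mM] by simp
          then have "V.maps_to c (q u) (I.app c (q u))" using I_maps_to[OF c(1)] by blast
          then show ?thesis using V.is_function_maps_to[OF fV UNIV_I UNIV_I, of "q u" "I.app c (q u)"] by simp
        qed
        have cy: "V.app c (q u) \<in> V.ext y" using y(2) qv same by simp
        have "V.app f u = V.app c (q u) \<or> V.app f u \<in> V.ext (V.app c (q u))" using q(2)[OF u(1)] unfolding Q_def by blast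
        then have "V.app f u \<in> V.ext y" using V.Ord_trans[OF oy cy] cy by metis
        then show False using u(2) V.Ord_irrefl[OF oy] V.Ord_asym[OF oy] by metis
      qed
    qed
    \<comment> \<open>For \<open>\<mu> = \<kappa>\<close> this contradicts the regularity of
      \<open>\<kappa>\<close>, a consequence of strong compactness; for larger \<open>\<mu>\<close>
      it contradicts the cofinality hypothesis.\<close>
    show False
    proof (cases "\<mu> = \<kappa>")
      case True
      obtain f' where f': "V.cofinal_map f' \<gamma> \<mu>" using qcof by blast
      have "\<exists>x\<in>V.ext \<kappa>. \<forall>u\<in>V.ext \<gamma>. V.app f' u \<in> V.ext x"
        by (rule V.sc_regular[OF UNIV_I compact g V.dfun1_app[OF UNIV_I]]) (use V.cofinal_mapD(1)[OF f'] True in simp)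
      then obtain w where w: "w \<in> V.ext \<mu>" "\<forall>u\<in>V.ext \<gamma>. V.app f' u \<in> V.ext w" using True by blast
      obtain u where "u \<in> V.ext \<gamma>" "w = V.app f' u \<or> w \<in> V.ext (V.app f' u)" using V.cofinal_mapD(2)[OF f' w(1)] by blast
      then show False using w(2) V.Ord_irrefl V.Ord_asym V.Ord_elem[OF m(1) w(1)] by metis
    next
      case False
      then have "\<kappa> \<in> V.ext \<mu>" using V.Ord_linear[OF m(1) k_Ord] nk by blast
      then have "E \<kappa> \<mu>" using V.ext_E by blast
      then have "\<exists>\<beta>. V.is_cof \<beta> \<mu> \<and> (\<beta> = \<kappa> \<or> E \<kappa> \<beta>)"
        using reg mM \<open>I.regular_cardinal \<mu>\<close> unfolding regulars_have_large_cofinality_def by blast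
      then show False using large_cofinality_iff[OF m(1)] g qcof by blast
    qed
  qed
  then show ?thesis using m(2) by blast
qed

text \<open>The ultrafilter \<open>U\<close> of the universe only supplies largeness; the cofinal
  sets, the intervals and the cover are built inside \<open>M\<close> with the trace
  \<open>W\<close>, and the small set is read as a set of indices of intervals.\<close>

lemma cover_below_regular:
  assumes reg: "regulars_have_large_cofinality E \<kappa> M" and am: "ultrafilters_amenable E \<kappa> M"
    and d: "\<delta> \<in> M" "I.regular_cardinal \<delta>" "E \<kappa> \<delta>" and \<theta>: "\<theta> \<in> V.ext \<kappa>" "V.Lim \<theta>"
    and s: "V.ext \<sigma> \<subseteq> V.ext \<delta>" "V.card_less \<sigma> \<kappa>"
  shows "\<exists>\<tau>\<in>M. V.ext \<sigma> \<subseteq> V.ext \<tau> \<and> V.card_less \<tau> \<kappa>"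
proof -
  have od: "V.Ord \<delta>" using I_regular_Ord[OF d(1,2)] .
  note ed = I_ext[OF d(1)]
  have dM: "x \<in> M" if "x \<in> V.ext \<delta>" for x using M_trans[OF d(1) that] .
  have ne: "V.ext \<delta> \<noteq> {}" and lim: "\<And>x. x \<in> V.ext \<delta> \<Longrightarrow> \<exists>y\<in>V.ext \<delta>. E x y"
    using d(2) unfolding I.regular_cardinal_def ed by blast+
  have succ: "V.osucc x \<in> V.ext \<delta>" if x: "x \<in> V.ext \<delta>" for x
  proof -
    obtain y where y: "y \<in> V.ext \<delta>" "x \<in> V.ext y" using lim[OF x] V.ext_E by blast
    have "V.osucc x \<in> V.ext y \<or> V.osucc x = y" using V.osucc_mem[OF V.Ord_elem[OF od y(1)] y(2)] .
    then show ?thesis using V.Ord_trans[OF od y(1)] y(1) by blast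
  qed
  have cof: "\<not> V.cofinal_map f \<gamma> \<delta>" if "\<gamma> \<in> V.ext \<kappa>" for \<gamma> f
    using reg d large_cofinality_iff[OF od] that unfolding regulars_have_large_cofinality_def by blast
  obtain U where U: "kuf U \<delta>" and tails: "\<And>\<alpha>. \<alpha> \<in> V.ext \<delta> \<Longrightarrow> V.ae U \<delta> (\<lambda>\<xi>. E \<alpha> \<xi>)"
    and normal: "\<And>f. V.dfun1 f \<Longrightarrow> \<forall>\<xi>\<in>V.ext \<delta>. f \<xi> \<in> V.ext \<delta> \<Longrightarrow> V.ae U \<delta> (\<lambda>\<xi>. f \<xi> \<in> V.ext \<xi>) \<Longrightarrow>
      \<exists>\<alpha>\<in>V.ext \<delta>. V.ae U \<delta> (\<lambda>\<xi>. \<alpha> \<notin> V.ext (f \<xi>))"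
    and smallcof: "V.ae U \<delta> (\<lambda>\<xi>. \<exists>\<mu>\<in>V.ext \<kappa>. \<exists>f\<in>UNIV. V.cofinal_map f \<mu> \<xi>)"
    using V.weakly_normal_ultrafilter[OF UNIV_I compact od ne cof \<theta>] by blast
  obtain W where W: "W \<in> M" "V.ext W = V.ext U \<inter> M" using am d(1) U unfolding ultrafilters_amenable_def by blast
  \<comment> \<open>\<open>S\<close> collects in \<open>M\<close> the points of small cofinality in
    the sense of \<open>M\<close>; it is large because small cofinality in the universe passes down
    to \<open>M\<close>.\<close>
  define S where "S = I.mk {\<xi> \<in> I.ext \<delta>. \<exists>\<mu>\<in>I.ext \<kappa>. \<exists>c\<in>M. I.cofinal_map c \<mu> \<xi>}"
  have iS: "I.isset {\<xi> \<in> I.ext \<delta>. \<exists>\<mu>\<in>I.ext \<kappa>. \<exists>c\<in>M. I.cofinal_map c \<mu> \<xi>}"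
    by (intro I.isset_Collect I.isset_ext d(1) dfn k_M)
  have SM: "S \<in> M" unfolding S_def using I_mk(1)[OF iS] .
  have eS: "V.ext S = {\<xi> \<in> V.ext \<delta>. \<exists>\<mu>\<in>V.ext \<kappa>. \<exists>c\<in>M. I.cofinal_map c \<mu> \<xi>}"
    using I_mk(2)[OF iS] unfolding S_def ed I_ext[OF k_M] .
  have dS: "V.definable (\<lambda>s. s 0 \<in> V.ext S)" by (intro dfn UNIV_I)
  have aeS: "V.ae U \<delta> (\<lambda>\<xi>. \<xi> \<in> V.ext S)"
  proof (rule V.ae_mono[OF kufD U _ dS smallcof])
    show "V.definable (\<lambda>s. \<exists>\<mu>\<in>V.ext \<kappa>. \<exists>f\<in>UNIV. V.cofinal_map f \<mu> (s 0))" by (intro dfn UNIV_I)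
    fix \<xi> assume x: "\<xi> \<in> V.ext \<delta>" "\<exists>\<mu>\<in>V.ext \<kappa>. \<exists>f\<in>UNIV. V.cofinal_map f \<mu> \<xi>"
    then show "\<xi> \<in> V.ext S" unfolding eS using small_cofinality_in_M[OF reg V.Ord_elem[OF od x(1)]] by blast
  qed
  \<comment> \<open>Two choices in \<open>M\<close> fix for every \<open>\<xi>\<close> in
    \<open>S\<close> a length \<open>m \<xi>\<close> below \<open>\<kappa>\<close> and a cofinal map
    \<open>cc \<xi>\<close> of that length; \<open>p \<xi> u\<close> is its value at
    \<open>u\<close>.\<close>
  have "I.drel2 (\<lambda>\<xi> \<mu>. \<mu> \<in> I.ext \<kappa> \<and> (\<exists>c\<in>M. I.cofinal_map c \<mu> \<xi>))" unfolding I.drel2_def by (intro dfn k_M)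
  from I.collection_choice[OF this I.isset_ext[OF SM]]
  obtain m where m: "I.dfun1 m" "\<And>\<xi>. \<xi> \<in> V.ext S \<Longrightarrow> m \<xi> \<in> V.ext \<kappa> \<and> (\<exists>c\<in>M. I.cofinal_map c (m \<xi>) \<xi>)"
    unfolding I_ext[OF SM] I_ext[OF k_M] eS using M_trans[OF k_M] by blast
  have "I.drel2 (\<lambda>\<xi> c. I.cofinal_map c (m \<xi>) \<xi>)" unfolding I.drel2_def by (intro dfn I.dfun1D[OF m(1)])
  from I.collection_choice[OF this I.isset_ext[OF SM]]
  obtain cc where cc: "I.dfun1 cc" "\<And>\<xi>. \<xi> \<in> V.ext S \<Longrightarrow> I.cofinal_map (cc \<xi>) (m \<xi>) \<xi>"
    unfolding I_ext[OF SM] using m(2) by blast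
  define p where "p \<xi> u = I.app (cc \<xi>) u" for \<xi> u
  have p: "I.dfun2 p" unfolding I.dfun2_def p_def by (intro dfn I.dfun1D[OF cc(1)])
  have mM: "m \<xi> \<in> M" if "\<xi> \<in> V.ext S" for \<xi> using m(2)[OF that] M_trans[OF k_M] by blast
  have Sd: "\<xi> \<in> V.ext \<delta>" if "\<xi> \<in> V.ext S" for \<xi> using that unfolding eS by blast
  have p1: "p \<xi> u \<in> V.ext \<xi>" if "\<xi> \<in> V.ext S" "u \<in> V.ext (m \<xi>)" for \<xi> u
    unfolding p_def using I.cofinal_mapD(1)[OF cc(2)[OF that(1)], of u] that(2)
      I_ext[OF mM[OF that(1)]] I_ext[OF dM[OF Sd[OF that(1)]]] by simp
  have p2: "\<exists>u\<in>V.ext (m \<xi>). \<alpha> = p \<xi> u \<or> \<alpha> \<in> V.ext (p \<xi> u)" if "\<xi> \<in> V.ext S" "\<alpha> \<in> V.ext \<xi>" for \<xi> \<alpha>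
    unfolding p_def using I.cofinal_mapD(2)[OF cc(2)[OF that(1)], of \<alpha>] that(2)
      I_ext[OF mM[OF that(1)]] I_ext[OF dM[OF Sd[OF that(1)]]] I_ext[OF I.app_in] by simp
  \<comment> \<open>The interval contains its left end \<open>\<alpha>\<close> and omits its right
    end \<open>\<beta>\<close>, so that intervals meeting only at an end are disjoint.\<close>
  define hit where "hit \<xi> u \<alpha> \<beta> \<longleftrightarrow> (\<alpha> = p \<xi> u \<or> \<alpha> \<in> I.ext (p \<xi> u)) \<and> p \<xi> u \<in> I.ext \<beta>" for \<xi> u \<alpha> \<beta>
  define T where "T \<alpha> \<beta> = I.mk {\<xi> \<in> I.ext \<delta>. \<xi> \<in> I.ext S \<and> (\<exists>u\<in>I.ext (m \<xi>). hit \<xi> u \<alpha> \<beta>)}" for \<alpha> \<beta>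
  have T: "I.dfun2 T" unfolding I.dfun2_def T_def hit_def by (intro dfn I.dfun1D[OF m(1)] I.dfun2D[OF p] d(1) SM)
  have eT: "T \<alpha> \<beta> \<in> M" "V.ext (T \<alpha> \<beta>) = {\<xi> \<in> V.ext S. \<exists>u\<in>V.ext (m \<xi>). hit \<xi> u \<alpha> \<beta>}"
    if "\<alpha> \<in> M" "\<beta> \<in> M" for \<alpha> \<beta>
  proof -
    have i: "I.isset {\<xi> \<in> I.ext \<delta>. \<xi> \<in> I.ext S \<and> (\<exists>u\<in>I.ext (m \<xi>). hit \<xi> u \<alpha> \<beta>)}"
      unfolding hit_def by (intro I.isset_Collect I.isset_ext dfn I.dfun1D[OF m(1)] I.dfun2D[OF p] d(1) SM that)
    show "T \<alpha> \<beta> \<in> M" unfolding T_def using I_mk(1)[OF i] .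
    have "{\<xi> \<in> I.ext \<delta>. \<xi> \<in> I.ext S \<and> (\<exists>u\<in>I.ext (m \<xi>). hit \<xi> u \<alpha> \<beta>)} =
      {\<xi> \<in> V.ext S. \<exists>u\<in>V.ext (m \<xi>). hit \<xi> u \<alpha> \<beta>}"
      unfolding ed I_ext[OF SM] using Sd I_ext[OF mM] by blast
    then show "V.ext (T \<alpha> \<beta>) = {\<xi> \<in> V.ext S. \<exists>u\<in>V.ext (m \<xi>). hit \<xi> u \<alpha> \<beta>}"
      unfolding T_def I_mk(2)[OF i] .
  qed
  have hits: "\<exists>\<beta>\<in>V.ext \<delta>. T \<alpha> \<beta> \<in> V.ext W" if a: "\<alpha> \<in> V.ext \<delta>" for \<alpha>
  proof -
    have aM: "\<alpha> \<in> M" using dM[OF a] .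
    \<comment> \<open>A choice \<open>f\<close> of points past \<open>\<alpha>\<close> in the
      cofinal sets is regressive on a large set. Elsewhere the value \<open>\<alpha>\<close> keeps
      it inside \<open>\<delta>\<close>, since \<open>normal\<close> asks for a function on all of
      \<open>\<delta>\<close>.\<close>
    define R where "R \<xi> v \<longleftrightarrow> v \<in> I.ext \<delta> \<and> (\<xi> \<in> I.ext S \<and> \<alpha> \<in> I.ext \<xi> \<longrightarrow>
      v \<in> I.ext \<xi> \<and> (\<exists>u\<in>I.ext (m \<xi>). v = p \<xi> u \<and> (\<alpha> = p \<xi> u \<or> \<alpha> \<in> I.ext (p \<xi> u))))" for \<xi> v
    have R: "I.drel2 R" unfolding I.drel2_def R_def
      by (intro dfn I.dfun1D[OF m(1)] I.dfun2D[OF p] d(1) SM aM)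
    have pM: "p \<xi> u \<in> M" for \<xi> u unfolding p_def by simp
    have "\<exists>v\<in>M. R \<xi> v" if x: "\<xi> \<in> I.ext \<delta>" for \<xi>
    proof (cases "\<xi> \<in> I.ext S \<and> \<alpha> \<in> I.ext \<xi>")
      case True
      have x': "\<xi> \<in> V.ext \<delta>" and xS: "\<xi> \<in> V.ext S" using x True unfolding ed I_ext[OF SM] by blast+
      have ax: "\<alpha> \<in> V.ext \<xi>" using True I_ext[OF dM[OF x']] by simp
      obtain u where u: "u \<in> V.ext (m \<xi>)" "\<alpha> = p \<xi> u \<or> \<alpha> \<in> V.ext (p \<xi> u)" using p2[OF xS ax] by blast
      have px: "p \<xi> u \<in> V.ext \<xi>" using p1[OF xS u(1)] .
      have "R \<xi> (p \<xi> u)" unfolding R_def ed I_ext[OF dM[OF x']] I_ext[OF mM[OF xS]] I_ext[OF pM]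
        using V.Ord_trans[OF od x' px] px u by blast
      then show ?thesis using pM by blast
    next
      case False
      then have "R \<xi> \<alpha>" unfolding R_def ed using a by blast
      then show ?thesis using aM by blast
    qed
    from I.collection_choice[OF R I.isset_ext[OF d(1)] this]
    obtain f where f: "I.dfun1 f" "\<And>\<xi>. \<xi> \<in> V.ext \<delta> \<Longrightarrow> R \<xi> (f \<xi>)" unfolding ed by blast
    obtain f' where f': "V.dfun1 f'" "\<And>\<xi>. \<xi> \<in> V.ext \<delta> \<Longrightarrow> f' \<xi> = f \<xi>" using fun_transfer[OF f(1) d(1)] by blast
    have fd: "\<forall>\<xi>\<in>V.ext \<delta>. f' \<xi> \<in> V.ext \<delta>" using f(2) f'(2) unfolding R_def ed by simp
    have good: "f' \<xi> \<in> V.ext \<xi> \<and> (\<exists>u\<in>V.ext (m \<xi>). f' \<xi> = p \<xi> u \<and> (\<alpha> = p \<xi> u \<or> \<alpha> \<in> V.ext (p \<xi> u)))"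
      if x: "\<xi> \<in> V.ext \<delta>" "\<xi> \<in> V.ext S" "E \<alpha> \<xi>" for \<xi>
    proof -
      have "\<alpha> \<in> I.ext \<xi>" using x(3) V.ext_E I_ext[OF dM[OF x(1)]] by blast
      then have "f \<xi> \<in> I.ext \<xi> \<and> (\<exists>u\<in>I.ext (m \<xi>). f \<xi> = p \<xi> u \<and> (\<alpha> = p \<xi> u \<or> \<alpha> \<in> I.ext (p \<xi> u)))"
        using f(2)[OF x(1)] x(2) unfolding R_def I_ext[OF SM] by blast
      then show ?thesis using f'(2)[OF x(1)] unfolding I_ext[OF dM[OF x(1)]] I_ext[OF mM[OF x(2)]] I_ext[OF pM] by simp
    qed
    have ds: "V.definable (\<lambda>s. E \<alpha> (s 0))" "V.definable (\<lambda>s. s 0 \<in> V.ext S \<and> E \<alpha> (s 0))"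
      "V.definable (\<lambda>s. f' (s 0) \<in> V.ext (s 0))" by (intro dfn UNIV_I V.dfun1D[OF f'(1)])+
    have aeSa: "V.ae U \<delta> (\<lambda>\<xi>. \<xi> \<in> V.ext S \<and> E \<alpha> \<xi>)" by (rule V.ae_conj[OF kufD U dS ds(1) aeS tails[OF a]])
    have "V.ae U \<delta> (\<lambda>\<xi>. f' \<xi> \<in> V.ext \<xi>)" by (rule V.ae_mono[OF kufD U ds(2,3) aeSa]) (use good in blast)
    from normal[OF f'(1) fd this] obtain \<beta>0 where b0: "\<beta>0 \<in> V.ext \<delta>" "V.ae U \<delta> (\<lambda>\<xi>. \<beta>0 \<notin> V.ext (f' \<xi>))" by blast
    \<comment> \<open>Almost everywhere \<open>f' \<xi>\<close> is at most \<open>\<beta>0\<close>;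
      the interval omits its right end, hence the successor.\<close>
    define \<beta> where "\<beta> = V.osucc \<beta>0"
    have b: "\<beta> \<in> V.ext \<delta>" unfolding \<beta>_def using succ[OF b0(1)] .
    have eb: "V.ext \<beta> = insert \<beta>0 (V.ext \<beta>0)" unfolding \<beta>_def using V.ext_osucc[OF UNIV_I] .
    have bM: "\<beta> \<in> M" using dM[OF b] .
    have ds': "V.definable (\<lambda>s. \<beta>0 \<notin> V.ext (f' (s 0)))"
      "V.definable (\<lambda>s. (s 0 \<in> V.ext S \<and> E \<alpha> (s 0)) \<and> \<beta>0 \<notin> V.ext (f' (s 0)))"
      "V.definable (\<lambda>s. s 0 \<in> V.ext (T \<alpha> \<beta>))" by (intro dfn UNIV_I V.dfun1D[OF f'(1)])+
    have "V.ae U \<delta> (\<lambda>\<xi>. (\<xi> \<in> V.ext S \<and> E \<alpha> \<xi>) \<and> \<beta>0 \<notin> V.ext (f' \<xi>))"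
      by (rule V.ae_conj[OF kufD U ds(2) ds'(1) aeSa b0(2)])
    then have "V.ae U \<delta> (\<lambda>\<xi>. \<xi> \<in> V.ext (T \<alpha> \<beta>))"
    proof (rule V.ae_mono[OF kufD U ds'(2,3)])
      fix \<xi> assume x: "\<xi> \<in> V.ext \<delta>" and h: "(\<xi> \<in> V.ext S \<and> E \<alpha> \<xi>) \<and> \<beta>0 \<notin> V.ext (f' \<xi>)"
      have fx: "f' \<xi> \<in> V.ext \<delta>" using fd x by blast
      have "f' \<xi> \<in> V.ext \<beta>" unfolding eb
        using V.Ord_linear[OF V.Ord_elem[OF od b0(1)] V.Ord_elem[OF od fx]] h by blast
      then show "\<xi> \<in> V.ext (T \<alpha> \<beta>)" using good[OF x] h
        unfolding eT(2)[OF aM bM] hit_def I_ext[OF pM] I_ext[OF bM] by auto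
    qed
    moreover have "V.ext (T \<alpha> \<beta>) \<subseteq> V.ext \<delta>" unfolding eT(2)[OF aM bM] using Sd by blast
    ultimately have "T \<alpha> \<beta> \<in> V.ext W" unfolding W(2) using mem_ultrafilter_iff eT(1)[OF aM bM] by blast
    then show ?thesis using b by blast
  qed
  \<comment> \<open>Membership in \<open>U\<close> has become membership in \<open>W\<close>, an
    element of \<open>M\<close>, so the right ends \<open>b\<close> are chosen in
    \<open>M\<close>.\<close>
  have "I.drel2 (\<lambda>\<alpha> \<beta>. \<beta> \<in> I.ext \<delta> \<and> T \<alpha> \<beta> \<in> I.ext W)" unfolding I.drel2_def by (intro dfn I.dfun2D[OF T] d(1) W(1))
  from I.collection_choice[OF this I.isset_ext[OF d(1)]]
  obtain b where b: "I.dfun1 b" "\<And>\<alpha>. \<alpha> \<in> V.ext \<delta> \<Longrightarrow> b \<alpha> \<in> V.ext \<delta> \<and> T \<alpha> (b \<alpha>) \<in> V.ext W"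
    unfolding ed I_ext[OF W(1)] using hits dM by blast
  define le where "le \<alpha> \<beta> \<longleftrightarrow> \<alpha> = \<beta> \<or> \<alpha> \<in> I.ext \<beta>" for \<alpha> \<beta>
  obtain c where c: "I.dfun1 c" "\<And>B. B \<in> M \<Longrightarrow> I.ext B \<subseteq> V.ext \<delta> \<Longrightarrow> I.ext B \<noteq> {} \<Longrightarrow> c B \<in> I.ext B"
    using I.choice[OF d(1)] unfolding ed by blast
  \<comment> \<open>Every interval starts at or after the right ends of all earlier ones; the set of
    earlier left ends determines where that is possible.\<close>
  define F where "F z = c (I.mk {\<nu> \<in> I.ext \<delta>. \<forall>x\<in>I.ext z. le (b x) \<nu>})" for z
  have F: "I.dfun1 F" unfolding I.dfun1_def F_def le_def by (intro dfn I.dfun1D[OF c(1)] I.dfun1D[OF b(1)] d(1))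
  obtain G where G: "I.dfun1 G" and rec: "\<And>\<alpha>. V.Ord \<alpha> \<Longrightarrow> G \<alpha> = F (I.mk (G ` I.ext \<alpha>))"
    using I.recursion[OF F] by auto
  have Gall: "i \<in> I.ext \<delta> \<longrightarrow> G i \<in> I.ext \<delta> \<and> (\<forall>j\<in>I.ext i. le (b (G j)) (G i))" if "V.Ord i" for i
  proof -
    have oi: "I.Ord i" using that by simp
    show ?thesis
    proof (rule I.Ord_induct[OF _ _ oi])
      show "I.definable (\<lambda>s. s 0 \<in> I.ext \<delta> \<longrightarrow> G (s 0) \<in> I.ext \<delta> \<and> (\<forall>j\<in>I.ext (s 0). le (b (G j)) (G (s 0))))"
        unfolding le_def by (intro dfn I.dfun1D[OF G] I.dfun1D[OF b(1)] d(1))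
      fix i assume i: "I.Ord i" and IH: "\<And>j. j \<in> I.ext i \<Longrightarrow>
        j \<in> I.ext \<delta> \<longrightarrow> G j \<in> I.ext \<delta> \<and> (\<forall>l\<in>I.ext j. le (b (G l)) (G j))"
      show "i \<in> I.ext \<delta> \<longrightarrow> G i \<in> I.ext \<delta> \<and> (\<forall>j\<in>I.ext i. le (b (G j)) (G i))"
      proof
        assume id: "i \<in> I.ext \<delta>"
        have iM: "i \<in> M" using id by (rule I.ext_D)
        have iOrd: "V.Ord i" using i by simp
        have dOrd: "I.Ord \<delta>" using od by simp
        have Gd: "G j \<in> V.ext \<delta>" if "j \<in> I.ext i" for j
          using IH[OF that] I.Ord_trans[OF dOrd id that] unfolding ed by blast
        have bG: "I.dfun1 (\<lambda>j. b (G j))" by (rule I.dfun1_comp[OF b(1) G])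
        \<comment> \<open>Regularity of \<open>\<delta>\<close> in \<open>M\<close> bounds the right
          ends met so far, so the recursion runs through all of \<open>\<delta>\<close>.\<close>
        have "\<exists>\<nu>\<in>I.ext \<delta>. \<forall>j\<in>I.ext i. b (G j) \<in> I.ext \<nu>"
        proof (rule ccontr)
          assume nb: "\<not> ?thesis"
          have "\<exists>f\<in>M. I.cofinal_map f i \<delta>"
          proof (rule I.cofinal_mapI[OF bG iM])
            show bd: "b (G j) \<in> I.ext \<delta>" if "j \<in> I.ext i" for j using b(2)[OF Gd[OF that]] unfolding ed by blast
            fix x assume x: "x \<in> I.ext \<delta>"
            obtain j where j: "j \<in> I.ext i" "b (G j) \<notin> I.ext x" using nb x by blast
            have "x = b (G j) \<or> x \<in> I.ext (b (G j))"
              using I.Ord_linear[OF I.Ord_elem[OF dOrd x] I.Ord_elem[OF dOrd bd[OF j(1)]]] j(2) by blast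
            then show "\<exists>j\<in>I.ext i. x = b (G j) \<or> x \<in> I.ext (b (G j))" using j(1) by blast
          qed
          then show False using d(2) id unfolding I.regular_cardinal_def I.is_cof_def by blast
        qed
        then obtain \<nu> where nu: "\<nu> \<in> I.ext \<delta>" "\<forall>j\<in>I.ext i. le (b (G j)) \<nu>" unfolding le_def by blast
        have eG: "I.ext (I.mk (G ` I.ext i)) = G ` I.ext i" by (intro I.ext_mk I.isset_image G I.isset_ext iM)
        define B where "B = {\<nu> \<in> I.ext \<delta>. \<forall>x\<in>I.ext (I.mk (G ` I.ext i)). le (b x) \<nu>}"
        have "I.isset B" unfolding B_def le_def by (intro I.isset_Collect I.isset_ext I.mk_in dfn d(1) I.dfun1D[OF b(1)])
        then have eB: "I.ext (I.mk B) = B" by (rule I.ext_mk)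
        have nuB: "\<nu> \<in> B" unfolding B_def eG using nu by blast
        have Bd: "B \<subseteq> V.ext \<delta>" unfolding B_def ed by blast
        have "c (I.mk B) \<in> I.ext (I.mk B)"
          by (rule c(2)[OF I.mk_in]) (use nuB Bd in \<open>auto simp: eB\<close>)
        moreover have "G i = c (I.mk B)" using rec[OF iOrd] unfolding F_def B_def .
        ultimately have "G i \<in> B" unfolding eB by simp
        then show "G i \<in> I.ext \<delta> \<and> (\<forall>j\<in>I.ext i. le (b (G j)) (G i))" unfolding B_def eG by simp
      qed
    qed
  qed
  have Gd: "G i \<in> V.ext \<delta>" if "i \<in> V.ext \<delta>" for i
    using Gall[OF V.Ord_elem[OF od that]] that unfolding ed by blast
  have Gb: "le (b (G j)) (G i)" if "i \<in> V.ext \<delta>" "j \<in> V.ext i" for i j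
    using Gall[OF V.Ord_elem[OF od that(1)]] that unfolding ed I_ext[OF dM[OF that(1)]] by blast
  define t where "t i = T (G i) (b (G i))" for i
  have t: "I.dfun1 t" unfolding I.dfun1_def t_def by (intro dfn I.dfun2D[OF T] I.dfun1D[OF G] I.dfun1D[OF b(1)])
  obtain t' where t': "V.dfun1 t'" "\<And>i. i \<in> V.ext \<delta> \<Longrightarrow> t' i = t i" using fun_transfer[OF t d(1)] by blast
  have tW: "t i \<in> V.ext U" if "i \<in> V.ext \<delta>" for i
    using b(2)[OF Gd[OF that]] W(2) unfolding t_def by blast
  have et: "V.ext (t i) = {\<xi> \<in> V.ext S. \<exists>u\<in>V.ext (m \<xi>). hit \<xi> u (G i) (b (G i))}" if i: "i \<in> V.ext \<delta>" for i
    unfolding t_def using eT(2)[OF dM[OF Gd[OF i]] dM] b(2)[OF Gd[OF i]] by blast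
  \<comment> \<open>The elements of \<open>\<sigma>\<close> serve as indices. Completeness in the
    universe yields one \<open>\<xi>\<close> whose cofinal set meets the interval of every index in
    \<open>\<sigma>\<close>, although \<open>\<sigma>\<close> need not be in
    \<open>M\<close>.\<close>
  have "V.ae U \<delta> (\<lambda>\<xi>. \<forall>i\<in>V.ext \<sigma>. \<xi> \<in> V.ext (t' i))"
  proof (rule V.ae_ball[OF kufD U _ UNIV_I s(2)])
    show "V.drel2 (\<lambda>i \<xi>. \<xi> \<in> V.ext (t' i))" unfolding V.drel2_def by (intro dfn V.dfun1D[OF t'(1)])
    fix i assume "i \<in> V.ext \<sigma>"
    then have i: "i \<in> V.ext \<delta>" using s(1) by blast
    have "V.ext (t i) \<subseteq> V.ext \<delta>" unfolding et[OF i] using Sd by blast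
    then show "V.ae U \<delta> (\<lambda>\<xi>. \<xi> \<in> V.ext (t' i))" using mem_ultrafilter_iff tW[OF i] t'(2)[OF i] by simp
  qed
  moreover have dt: "V.definable (\<lambda>s. \<forall>i\<in>V.ext \<sigma>. s 0 \<in> V.ext (t' i))" by (intro dfn UNIV_I V.dfun1D[OF t'(1)])
  ultimately have "V.ae U \<delta> (\<lambda>\<xi>. (\<forall>i\<in>V.ext \<sigma>. \<xi> \<in> V.ext (t' i)) \<and> \<xi> \<in> V.ext S)"
    by (intro V.ae_conj[OF kufD U _ dS _ aeS])
  moreover have "V.definable (\<lambda>s. (\<forall>i\<in>V.ext \<sigma>. s 0 \<in> V.ext (t' i)) \<and> s 0 \<in> V.ext S)"
    by (intro V.definable_conj dt dS)
  ultimately obtain \<xi> where x: "\<forall>i\<in>V.ext \<sigma>. \<xi> \<in> V.ext (t' i)" "\<xi> \<in> V.ext S"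
    using V.ae_ex[OF kufD U, of "\<lambda>\<xi>. (\<forall>i\<in>V.ext \<sigma>. \<xi> \<in> V.ext (t' i)) \<and> \<xi> \<in> V.ext S"] by blast
  have xM: "\<xi> \<in> M" using dM[OF Sd[OF x(2)]] .
  have mxM: "m \<xi> \<in> M" using mM[OF x(2)] .
  \<comment> \<open>All indices whose interval is met, formed in \<open>M\<close> from
    \<open>\<xi>\<close> alone and thus without reference to \<open>\<sigma>\<close>.\<close>
  define \<tau> where "\<tau> = I.mk {i \<in> I.ext \<delta>. \<exists>u\<in>I.ext (m \<xi>). hit \<xi> u (G i) (b (G i))}"
  have it: "I.isset {i \<in> I.ext \<delta>. \<exists>u\<in>I.ext (m \<xi>). hit \<xi> u (G i) (b (G i))}"
    unfolding hit_def by (intro I.isset_Collect I.isset_ext dfn d(1) mxM I.dfun1D[OF G] I.dfun1D[OF b(1)] I.dfun2D[OF p] xM)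
  have tM: "\<tau> \<in> M" unfolding \<tau>_def using I_mk(1)[OF it] .
  have e\<tau>: "V.ext \<tau> = {i \<in> V.ext \<delta>. \<exists>u\<in>V.ext (m \<xi>). hit \<xi> u (G i) (b (G i))}"
    using I_mk(2)[OF it] unfolding \<tau>_def ed I_ext[OF mxM] .
  have "V.ext \<sigma> \<subseteq> V.ext \<tau>"
  proof
    fix i assume i: "i \<in> V.ext \<sigma>"
    then have id: "i \<in> V.ext \<delta>" using s(1) by blast
    have "\<xi> \<in> V.ext (t' i)" using x(1) i by blast
    then have "\<xi> \<in> V.ext (t i)" using t'(2)[OF id] by simp
    then show "i \<in> V.ext \<tau>" unfolding e\<tau> et[OF id] using id by blast
  qed
  moreover have "V.card_less \<tau> \<kappa>"
  proof -
    have "I.drel2 (\<lambda>i u. u \<in> I.ext (m \<xi>) \<and> hit \<xi> u (G i) (b (G i)))"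
      unfolding I.drel2_def hit_def by (intro dfn mxM I.dfun1D[OF G] I.dfun1D[OF b(1)] I.dfun2D[OF p] xM)
    from I.collection_choice[OF this I.isset_ext[OF tM]]
    obtain q where q: "I.dfun1 q" "\<And>i. i \<in> V.ext \<tau> \<Longrightarrow> q i \<in> V.ext (m \<xi>) \<and> hit \<xi> (q i) (G i) (b (G i))"
      unfolding I_ext[OF tM] I_ext[OF mxM] e\<tau> using M_trans[OF mxM] by blast
    \<comment> \<open>Disjoint intervals share no point: for \<open>j\<close> below \<open>i\<close>
      the interval of \<open>j\<close> ends at or before the left end of that of \<open>i\<close>.
      So \<open>\<tau>\<close> injects into \<open>m \<xi>\<close>, which is below
      \<open>\<kappa>\<close>.\<close>
    have no: "q i \<noteq> q j" if ij: "i \<in> V.ext \<tau>" "j \<in> V.ext \<tau>" "j \<in> V.ext i" for i j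
    proof
      assume eq: "q i = q j"
      have i: "i \<in> V.ext \<delta>" and j: "j \<in> V.ext \<delta>" using ij unfolding e\<tau> by blast+
      define v where "v = p \<xi> (q i)"
      have hi: "G i = v \<or> G i \<in> I.ext v" and hj: "v \<in> I.ext (b (G j))"
        using q(2)[OF ij(1)] q(2)[OF ij(2)] eq unfolding hit_def v_def by simp_all
      have GM: "G i \<in> M" "b (G j) \<in> M" using dM[OF Gd[OF i]] dM b(2)[OF Gd[OF j]] by blast+
      have oG: "V.Ord (G i)" using V.Ord_elem[OF od Gd[OF i]] .
      have 1: "b (G j) = G i \<or> b (G j) \<in> V.ext (G i)" using Gb[OF i ij(3)] unfolding le_def I_ext[OF GM(1)] .
      have 2: "v \<in> V.ext (b (G j))" using hj unfolding I_ext[OF GM(2)] .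
      have "v \<in> V.ext (G i)" using 1 2 V.Ord_trans[OF oG] by metis
      moreover have "v \<in> M" unfolding v_def p_def by simp
      ultimately show False using hi V.Ord_irrefl[OF oG] V.Ord_asym[OF oG] unfolding I_ext[OF \<open>v \<in> M\<close>] by blast
    qed
    have "I.injects \<tau> (m \<xi>)"
    proof (rule I.injectsI[OF q(1)])
      show "inj_on q (I.ext \<tau>)" unfolding I_ext[OF tM]
      proof (rule inj_onI)
        fix i j assume ij: "i \<in> V.ext \<tau>" "j \<in> V.ext \<tau>" "q i = q j"
        then have "V.Ord i" "V.Ord j" using V.Ord_elem[OF od] unfolding e\<tau> by blast+
        then show "i = j" using V.Ord_linear no ij by metis
      qed
      show "q i \<in> I.ext (m \<xi>)" if "i \<in> I.ext \<tau>" for i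
        using q(2) that unfolding I_ext[OF tM] I_ext[OF mxM] by blast
    qed
    then have "V.injects \<tau> (m \<xi>)" by (rule I_injects[OF tM mxM])
    then show ?thesis using V.card_less_iff[OF k_Ord k_card UNIV_I] m(2)[OF x(2)] by blast
  qed
  ultimately show ?thesis using tM by blast
qed

lemma large_cofinality_cover:
  assumes reg: "regulars_have_large_cofinality E \<kappa> M" and am: "ultrafilters_amenable E \<kappa> M"
  shows "cover_property E \<kappa> M"
  unfolding cover_property_def
proof (intro allI impI, elim conjE)
  fix \<sigma> assume s: "V.ext \<sigma> \<subseteq> M" "V.card_less \<sigma> \<kappa>"
  show "\<exists>\<tau>\<in>M. V.ext \<sigma> \<subseteq> V.ext \<tau> \<and> V.card_less \<tau> \<kappa>"
  proof (cases "\<exists>\<theta>\<in>V.ext \<kappa>. V.Lim \<theta>")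
    case False
    then have "\<sigma> \<in> M" using finite_sets_in_M s by blast
    then show ?thesis using s by blast
  next
    case True
    then obtain \<theta> where \<theta>: "\<theta> \<in> V.ext \<kappa>" "V.Lim \<theta>" by blast
    obtain a where a: "a \<in> M" "V.ext \<sigma> \<subseteq> V.ext a" using bounded_in_M[OF s(1)] by blast
    \<comment> \<open>Adding \<open>\<kappa>\<close> forces the regular cardinal
      \<open>\<delta>\<close> of \<open>M\<close>, which does not inject into \<open>a'\<close>, to
      lie above \<open>\<kappa>\<close>.\<close>
    define a' where "a' = I.mk (I.ext a \<union> I.ext \<kappa>)"
    have ia: "I.isset (I.ext a \<union> I.ext \<kappa>)" by (intro I.isset_Un I.isset_ext a k_M)
    have a': "a' \<in> M" "I.ext a' = V.ext a \<union> V.ext \<kappa>"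
      unfolding a'_def using I_mk(1)[OF ia] I.ext_mk[OF ia] I_ext[OF a(1)] I_ext[OF k_M] by simp_all
    obtain \<delta> where d: "V.Ord \<delta>" "I.regular_cardinal \<delta>" "I.injects a' \<delta>" "\<not> I.injects \<delta> a'"
      using I.regular_cardinal_exists[OF a'(1)] by auto
    have dM: "\<delta> \<in> M" using Ord_M[OF d(1)] .
    have "\<kappa> \<in> V.ext \<delta>"
    proof (rule ccontr)
      assume "\<kappa> \<notin> V.ext \<delta>"
      then have "V.ext \<delta> \<subseteq> V.ext \<kappa>" using V.Ord_not_mem[OF k_Ord d(1)] by blast
      then have "I.injects \<delta> a'" using I_ext[OF dM] a'(2) by (intro I.injects_subset) blast
      then show False using d(4) by blast
    qed
    then have kd: "E \<kappa> \<delta>" using V.ext_E by blast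
    obtain j where j: "I.dfun1 j" "inj_on j (I.ext a')" "j ` I.ext a' \<subseteq> V.ext \<delta>"
      using d(3) unfolding I.injects_def I_ext[OF dM] by blast
    have sa: "V.ext \<sigma> \<subseteq> I.ext a'" using a(2) a'(2) by blast
    have ea: "I.ext a' = V.ext a'" using I_ext[OF a'(1)] .
    obtain j' where j': "V.dfun1 j'" "\<And>x. x \<in> V.ext a' \<Longrightarrow> j' x = j x" using fun_transfer[OF j(1) a'(1)] by blast
    define \<rho> where "\<rho> = V.mk (j' ` V.ext \<sigma>)"
    have e\<rho>: "V.ext \<rho> = j' ` V.ext \<sigma>" unfolding \<rho>_def by (intro V.ext_mk V.isset_image V.isset_ext UNIV_I j')
    have \<rho>d: "V.ext \<rho> \<subseteq> V.ext \<delta>"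
    proof
      fix y assume "y \<in> V.ext \<rho>"
      then obtain x where "x \<in> V.ext \<sigma>" "y = j' x" unfolding e\<rho> by blast
      then show "y \<in> V.ext \<delta>" using j(3) j'(2) sa unfolding ea by auto
    qed
    have \<rho>s: "V.card_less \<rho> \<kappa>" unfolding \<rho>_def by (rule V.card_less_image[OF k_Ord k_card UNIV_I j'(1) s(2)])
    obtain \<tau>1 where t1: "\<tau>1 \<in> M" "V.ext \<rho> \<subseteq> V.ext \<tau>1" "V.card_less \<tau>1 \<kappa>"
      using cover_below_regular[OF reg am dM d(2) kd \<theta> \<rho>d \<rho>s] by blast
    \<comment> \<open>The cover inside \<open>\<delta>\<close> is pulled back along
      \<open>j\<close>, an injection of \<open>M\<close>; so it lies in \<open>M\<close> and stays
      small.\<close>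
    define \<tau> where "\<tau> = I.mk {x \<in> I.ext a'. j x \<in> I.ext \<tau>1}"
    have it: "I.isset {x \<in> I.ext a'. j x \<in> I.ext \<tau>1}"
      by (intro I.isset_Collect I.isset_ext a'(1) dfn I.dfun1D[OF j(1)] t1(1))
    have tM: "\<tau> \<in> M" unfolding \<tau>_def using I_mk(1)[OF it] .
    have et: "V.ext \<tau> = {x \<in> V.ext a'. j x \<in> V.ext \<tau>1}"
      using I_mk(2)[OF it] unfolding \<tau>_def ea I_ext[OF t1(1)] .
    have "V.ext \<sigma> \<subseteq> V.ext \<tau>"
    proof
      fix x assume x: "x \<in> V.ext \<sigma>"
      then have xa: "x \<in> V.ext a'" using sa unfolding ea by blast
      have "j' x \<in> V.ext \<tau>1" using t1(2) x unfolding e\<rho> by blast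
      then show "x \<in> V.ext \<tau>" unfolding et using xa j'(2)[OF xa] by simp
    qed
    moreover have "V.card_less \<tau> \<kappa>"
    proof (rule V.card_less_injects[OF kufD _ t1(3)])
      show "V.injects \<tau> \<tau>1"
      proof (rule I_injects[OF tM t1(1)], rule I.injectsI[OF j(1)])
        show "inj_on j (I.ext \<tau>)" unfolding I_ext[OF tM] et
          by (rule inj_on_subset[OF j(2)]) (use ea in blast)
        show "j x \<in> I.ext \<tau>1" if "x \<in> I.ext \<tau>" for x
          using that unfolding I_ext[OF tM] I_ext[OF t1(1)] et by blast
      qed
    qed
    ultimately show ?thesis using tM by blast
  qed
qed

end

theorem theorem3p22:
  fixes E :: "'a \<Rightarrow> 'a \<Rightarrow> bool" and M :: "'a set" and \<kappa> :: 'a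
  assumes "set_structure.zfc_with UNIV E M"
    and "inner_model E M"
    and "set_structure.strongly_compact UNIV E \<kappa>"
  shows "(pseudoground E \<kappa> M \<longleftrightarrow>
            set_structure.strongly_compact M E \<kappa> \<and>
            ultrafilters_amenable E \<kappa> M \<and>
            ultrafilters_extend E \<kappa> M) \<and>
         (pseudoground E \<kappa> M \<longleftrightarrow>
            regulars_have_large_cofinality E \<kappa> M \<and>
            ultrafilters_amenable E \<kappa> M)"
proof -
  interpret compact_inner_model E M \<kappa>
    by unfold_locales (fact assms)+
  \<comment> \<open>Statement (2) leads back to (1) through (3): the extended ultrafilters give the
    cofinalities, these give cover, and cover with amenability gives approximation.\<close>
  show ?thesis
    using amenable pseudoground_strongly_compact pseudoground_extend cover_large_cofinality
      extend_large_cofinality large_cofinality_cover amenable_approximation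
    unfolding pseudoground_def by blast
qed

end
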